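(* Let $n=2^J$. The discrete wavelet bases $\mathcal D_n=(\psi_{j,k}^n:(j,k)\in\Omega_n)$ are asymptotically stable. In particular, the following holds. (a) (Distribution) Let $\epsilon_n$ be a sequence of noise vectors in $\mathbb R^n$ with independent $N(0,\sigma^2)$-distributed entries. Then $\|\mathbf W_n\epsilon_n\|_\infty$ is of Gumbel type with normalization constants $\sigma a(\chi,n)$, $\sigma b(\chi,n)$, where $a(\chi,n)=\frac{1}{\sqrt{2\log n}}$ and $b(\chi,n)=\sqrt{2\log n}-\frac{\log\log n+\log\pi}{2\sqrt{2\log n}}$; that is, $\mathbf P\{\|\mathbf W_n\epsilon_n\|_\infty\le\sigma a(\chi,n)z+\sigma b(\chi,n)\}\to\exp(-e^{-z})$ for all $z\in\mathbb R$. (b) (Confidence regions) Let $(\alpha_n)\subset(0,1)$ converge to some $\alpha\in[0,1)$ and let $T(\alpha_n,n):=-\sigma a(\chi,n)\log\log(1/(1-\alpha_n))+\sigma b(\chi,n)$. Then, with $V_n=u_n+\epsilon_n$, $$\lim_{n\to\infty}\mathbf P\{\|\mathbf W_n(u_n-V_n)\|_\infty\le T(\alpha_n,n)\,;\ \forall u_n\in\mathbb R^{n}\}=1-\alpha.$$ (c) (Smoothness) Let $p,q\ge1$, $r\ge0$, and let $\hat u_n^*$ denote the soft-thresholding estimator using the thresholds $T(\alpha_n,n)$. If the mother wavelet has $m>r$ vanishing moments and is $m$ times continuously differentiable, then $$\liminf_{n\to\infty}\mathbf P\{\|\hat u_n^*\|_{\mathcal B_{p,q}^r}\le\|u\|_{\mathcal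 B_{p,q}^r}\,;\ \forall u\in\mathcal B_{p,q}^r\}\ge1-\alpha.$$
   Context: Wavelets: $\varphi,\psi\in L^2(\mathbb R)$ are real-valued, compactly supported, unit norm father and mother wavelets of a biorthogonal multiresolution wavelet system. For $j\in\{0,1,\dots\}$, $k\in\{0,\dots,2^j-1\}$ put $\psi_{j,k}(t)=2^{j/2}\sum_{m\in\mathbb Z}\psi(2^j(t-m)-k)$, $\varphi_{j,k}(t)=2^{j/2}\sum_{m\in\mathbb Z}\varphi(2^j(t-m)-k)$ on $[0,1]$. There are subspaces $\mathcal V_j,\mathcal W_j\subset L^2(0,1)$ (spanned by the dual scaling functions, respectively dual wavelets, of the biorthogonal system) such that $u\mapsto(\langle\varphi_{j,k},u\rangle)_k$ is a bijection $\mathcal V_j\to\mathbb R^{2^j}$, $u\mapsto(\langle\psi_{j,k},u\rangle)_k$ is a bijection $\mathcal W_j\to\mathbb R^{2^j}$, $\mathcal V_j=\mathcal V_{j-1}\oplus\mathcal W_{j-1}$, and $\bigcup_j\mathcal V_j$ is dense in $L^2(0,1)$. As usual for compactly supported biorthogonal wavelets, the functions $\psi_{j,k}$ together with $\varphi_{0,0}$ form a Riesz basis of $L^2(0,1)$. Discretization: $n=2^J$, $\Omega_n=\{(j,k):0\le j\le J-1,\ 0\le k\le2^j-1\}$. For $u\in L^2(0,1)$ the discrete signal is $u_n(k)=\langle\varphi_{J,k},u\rangle$, $k=0,\dots,n-1$; for $u_n\in\mathbb R^n$, $u_n^*\in\mathcal V_J$ is the unique element with scaling coefficients $\langle\varphi_{J,k},u_n^*\rangle=u_n(k)$.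 The discrete wavelets $\psi_{j,k}^n\in\mathbb R^n$ are defined by $\langle\psi_{j,k}^n,u_n\rangle=\langle\psi_{j,k},u_n^*\rangle$ for all $u_n\in\mathbb R^n$, and are assumed to have unit Euclidean norm. $\mathbf W_n:\mathbb R^n\to\mathbb R^{\Omega_n}$, $(\mathbf W_nu_n)(j,k)=\langle\psi_{j,k}^n,u_n\rangle$. The data are $V_n=u_n+\epsilon_n$. The estimator is $\hat u_n=\mathbf W_n^{-1}\mathbf S(\mathbf W_nV_n,T)$, where $\mathbf S(Y,T)(\omega)=\operatorname{sign}(Y(\omega))(|Y(\omega)|-T)_+$ and $\mathbf W_n^{-1}$ is the inverse of $\mathbf W_n$ on the wavelet part $\{u_n:\langle\varphi_{0,0},u_n^*\rangle=0\}$; $\hat u_n^*\in\mathcal V_J$ is the element with scaling coefficients $\hat u_n$. Norms: for $x=(x(j,k))$, $\|x\|_{p,q,r}=\big(\sum_{j\ge0}2^{jsq}\|x(j,\cdot)\|_p^q\big)^{1/q}$ with $s=r+\frac12-\frac1p$; $\|u\|_{\mathcal B_{p,q}^r}:=\|(\langle\psi_{j,k},u\rangle)_{j,k}\|_{p,q,r}$, and $\mathcal B_{p,q}^r$ is the set of $u\in L^2(0,1)$ for which this is finite. Asymptotic stability of families $\mathcal D_n=(\phi^n_\omega:\omega\in\Omega_n)$ of unit vectors (frames of $\mathbb R^n$, or here of its wavelet part): (i) for some $\rho\in(0,1)$, $|\{(\omega,\omega')\in\Omega_n^2:\omega\ne\omega',|\langle\phi_\omega^n,\phi_{\omega'}^n\rangle|\ge\rho\}|=o(|\Omega_n|/\sqrt{\log|\Omega_n|})$;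 (ii) the optimal upper frame bounds $b_n$ in $\sum_\omega|\langle\phi_\omega^n,u\rangle|^2\le b_n\|u\|^2$ are bounded uniformly in $n$. Limits in $n$ are along powers of two; $\mathbf P\{A(u);\forall u\}$ is the probability of the intersection of the events $A(u)$, with the same noise for all $u$. *)

theory Defs
  imports "HOL-Probability.Probability"
begin

section \<open>Square integrable functions\<close>

text \<open>Elements of \<open>L\<^sup>2(A)\<close> are represented by functions on the real line; equality in
  \<open>L\<^sup>2(A)\<close> is equality almost everywhere on \<open>A\<close>.\<close>

definition L2_on :: "real set \<Rightarrow> (real \<Rightarrow> real) set" where
  "L2_on A = {f. set_borel_measurable lborel A f \<and> set_integrable lborel A (\<lambda>t. (f t)\<^sup>2)}"

definition L2_inner :: "real set \<Rightarrow> (real \<Rightarrow> real) \<Rightarrow> (real \<Rightarrow> real) \<Rightarrow> real" where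
  "L2_inner A f g = (LINT t:A|lborel. f t * g t)"

definition L2_norm_on :: "real set \<Rightarrow> (real \<Rightarrow> real) \<Rightarrow> real" where
  "L2_norm_on A f = sqrt (L2_inner A f f)"

definition closed_span :: "real set \<Rightarrow> 'i set \<Rightarrow> ('i \<Rightarrow> real \<Rightarrow> real) \<Rightarrow> (real \<Rightarrow> real) set" where
  "closed_span A I e = {f \<in> L2_on A. \<forall>\<delta>>0. \<exists>F c. finite F \<and> F \<subseteq> I \<and>
     L2_norm_on A (\<lambda>t. f t - (\<Sum>i\<in>F. c i * e i t)) < \<delta>}"

definition riesz_sequence :: "real set \<Rightarrow> 'i set \<Rightarrow> ('i \<Rightarrow> real \<Rightarrow> real) \<Rightarrow> bool" where
  "riesz_sequence A I e \<longleftrightarrow> (\<forall>i\<in>I. e i \<in> L2_on A) \<and>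
     (\<exists>a>0. \<exists>b. \<forall>F c. finite F \<and> F \<subseteq> I \<longrightarrow>
        a * (\<Sum>i\<in>F. (c i)\<^sup>2) \<le> (L2_norm_on A (\<lambda>t. \<Sum>i\<in>F. c i * e i t))\<^sup>2 \<and>
        (L2_norm_on A (\<lambda>t. \<Sum>i\<in>F. c i * e i t))\<^sup>2 \<le> b * (\<Sum>i\<in>F. (c i)\<^sup>2))"

definition riesz_basis :: "real set \<Rightarrow> 'i set \<Rightarrow> ('i \<Rightarrow> real \<Rightarrow> real) \<Rightarrow> bool" where
  "riesz_basis A I e \<longleftrightarrow> riesz_sequence A I e \<and> closed_span A I e = L2_on A"


section \<open>Compactly supported biorthogonal wavelets on the line\<close>

definition compactly_supported :: "(real \<Rightarrow> real) \<Rightarrow> bool" where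
  "compactly_supported f \<longleftrightarrow> (\<exists>R. \<forall>x. \<bar>x\<bar> > R \<longrightarrow> f x = 0)"

definition dilate :: "(real \<Rightarrow> real) \<Rightarrow> int \<Rightarrow> int \<Rightarrow> real \<Rightarrow> real" where
  "dilate f j k x = 2 powr (of_int j / 2) * f (2 powr of_int j * x - of_int k)"

definition scale_space :: "(real \<Rightarrow> real) \<Rightarrow> int \<Rightarrow> (real \<Rightarrow> real) set" where
  "scale_space \<phi> j = closed_span UNIV UNIV (dilate \<phi> j)"

text \<open>\<open>f\<close> is a finite combination of the functions \<open>\<phi>(2x - k)\<close>.\<close>

definition two_scale :: "(real \<Rightarrow> real) \<Rightarrow> (real \<Rightarrow> real) \<Rightarrow> bool" where
  "two_scale \<phi> f \<longleftrightarrow> (\<exists>K h. finite (K :: int set) \<and>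
     (AE x in lborel. f x = (\<Sum>k\<in>K. h k * dilate \<phi> 1 k x)))"

text \<open>Multiresolution analysis of \<open>L\<^sup>2(\<real>)\<close> generated by a compactly supported \<open>\<phi>\<close>.
  Nestedness of the scale spaces is the two-scale relation; compact support of \<open>\<phi>\<close> and
  of its dual makes the mask finite.\<close>

definition multiresolution :: "(real \<Rightarrow> real) \<Rightarrow> bool" where
  "multiresolution \<phi> \<longleftrightarrow>
     riesz_sequence UNIV UNIV (dilate \<phi> 0) \<and>
     two_scale \<phi> \<phi> \<and>
     (\<forall>f\<in>L2_on UNIV. \<forall>\<delta>>0. \<exists>j. \<exists>g\<in>scale_space \<phi> j. L2_norm_on UNIV (\<lambda>x. f x - g x) < \<delta>) \<and>
     (\<forall>f. (\<forall>j. f \<in> scale_space \<phi> j) \<longrightarrow> (AE x in lborel. f x = 0))"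

definition biorthogonal_wavelets ::
  "(real \<Rightarrow> real) \<Rightarrow> (real \<Rightarrow> real) \<Rightarrow> (real \<Rightarrow> real) \<Rightarrow> (real \<Rightarrow> real) \<Rightarrow> bool" where
  "biorthogonal_wavelets \<phi> \<psi> \<phi>d \<psi>d \<longleftrightarrow>
     (\<forall>f\<in>{\<phi>, \<psi>, \<phi>d, \<psi>d}. f \<in> L2_on UNIV \<and> compactly_supported f) \<and>
     multiresolution \<phi> \<and> multiresolution \<phi>d \<and>
     two_scale \<phi> \<psi> \<and> two_scale \<phi>d \<psi>d \<and>
     (\<forall>k l. L2_inner UNIV (dilate \<phi> 0 k) (dilate \<phi>d 0 l) = of_bool (k = l) \<and>
            L2_inner UNIV (dilate \<psi> 0 k) (dilate \<psi>d 0 l) = of_bool (k = l) \<and>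
            L2_inner UNIV (dilate \<phi> 0 k) (dilate \<psi>d 0 l) = 0 \<and>
            L2_inner UNIV (dilate \<psi> 0 k) (dilate \<phi>d 0 l) = 0)"

definition vanishing_moments :: "nat \<Rightarrow> (real \<Rightarrow> real) \<Rightarrow> bool" where
  "vanishing_moments m \<psi> \<longleftrightarrow> (\<forall>i<m. (LINT x|lborel. x ^ i * \<psi> x) = 0)"

definition continuously_differentiable :: "nat \<Rightarrow> (real \<Rightarrow> real) \<Rightarrow> bool" where
  "continuously_differentiable m f \<longleftrightarrow>
     (\<forall>i<m. \<forall>x. (deriv ^^ i) f differentiable (at x)) \<and> continuous_on UNIV ((deriv ^^ m) f)"


section \<open>Periodic wavelets on the unit interval\<close>

abbreviation unit_interval :: "real set" where
  "unit_interval \<equiv> {0<..<1}"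

text \<open>For compactly supported \<open>f\<close> the sum has only finitely many nonzero terms.\<close>

definition periodize :: "(real \<Rightarrow> real) \<Rightarrow> nat \<Rightarrow> nat \<Rightarrow> real \<Rightarrow> real" where
  "periodize f j k t = 2 powr (real j / 2) *
     (\<Sum>\<^sub>\<infinity>m\<in>(UNIV :: int set). f (2 ^ j * (t - of_int m) - real k))"

text \<open>\<open>\<real>\<^sup>n\<close> consists of the functions on \<open>{0,\<dots>,n-1}\<close>, extended by \<open>undefined\<close>.\<close>

definition Rn :: "nat \<Rightarrow> (nat \<Rightarrow> real) set" where
  "Rn n = ({..<n} \<rightarrow>\<^sub>E UNIV)"

definition dot :: "nat \<Rightarrow> (nat \<Rightarrow> real) \<Rightarrow> (nat \<Rightarrow> real) \<Rightarrow> real" where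
  "dot n x y = (\<Sum>k<n. x k * y k)"

definition enorm_on :: "nat \<Rightarrow> (nat \<Rightarrow> real) \<Rightarrow> real" where
  "enorm_on n x = sqrt (dot n x x)"

text \<open>The space \<open>V\<^sub>j\<close> is \<open>level_space \<phi>d j\<close>, and \<open>W\<^sub>j\<close> is \<open>level_space \<psi>d j\<close>. Elements are
  the combinations themselves rather than all representatives of their almost everywhere classes,
  so that an element is uniquely determined by its coefficients.\<close>

definition level_space :: "(real \<Rightarrow> real) \<Rightarrow> nat \<Rightarrow> (real \<Rightarrow> real) set" where
  "level_space f j = {(\<lambda>t. \<Sum>k<2^j. c k * periodize f j k t) | c :: nat \<Rightarrow> real. True}"

definition level_coeffs :: "(real \<Rightarrow> real) \<Rightarrow> nat \<Rightarrow> (real \<Rightarrow> real) \<Rightarrow> nat \<Rightarrow> real" where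
  "level_coeffs f j u = (\<lambda>k\<in>{..<2^j}. L2_inner unit_interval (periodize f j k) u)"

fun wavelet_system :: "(real \<Rightarrow> real) \<Rightarrow> (real \<Rightarrow> real) \<Rightarrow> (nat \<times> nat) option \<Rightarrow> real \<Rightarrow> real" where
  "wavelet_system \<phi> \<psi> None = periodize \<phi> 0 0"
| "wavelet_system \<phi> \<psi> (Some (j, k)) = periodize \<psi> j k"

text \<open>The properties that the periodic system inherits from the line. The second and third group of
  clauses say \<open>V\<^sub>j\<^sub>+\<^sub>1 = V\<^sub>j \<oplus> W\<^sub>j\<close> in \<open>L\<^sup>2(0,1)\<close> and that the union of the \<open>V\<^sub>j\<close> is dense.\<close>

definition periodic_multiresolution ::
  "(real \<Rightarrow> real) \<Rightarrow> (real \<Rightarrow> real) \<Rightarrow> (real \<Rightarrow> real) \<Rightarrow> (real \<Rightarrow> real) \<Rightarrow> bool" where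
  "periodic_multiresolution \<phi> \<psi> \<phi>d \<psi>d \<longleftrightarrow>
     (\<forall>j. bij_betw (level_coeffs \<phi> j) (level_space \<phi>d j) (Rn (2^j)) \<and>
          bij_betw (level_coeffs \<psi> j) (level_space \<psi>d j) (Rn (2^j))) \<and>
     (\<forall>j. (\<forall>f\<in>level_space \<phi>d (Suc j). \<exists>g\<in>level_space \<phi>d j. \<exists>h\<in>level_space \<psi>d j.
             AE t\<in>unit_interval in lborel. f t = g t + h t) \<and>
          (\<forall>g\<in>level_space \<phi>d j. \<forall>h\<in>level_space \<psi>d j. \<exists>f\<in>level_space \<phi>d (Suc j).
             AE t\<in>unit_interval in lborel. f t = g t + h t) \<and>
          (\<forall>g\<in>level_space \<phi>d j. \<forall>h\<in>level_space \<psi>d j.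
             (AE t\<in>unit_interval in lborel. g t = h t) \<longrightarrow>
             (AE t\<in>unit_interval in lborel. g t = 0))) \<and>
     (\<forall>u\<in>L2_on unit_interval. \<forall>\<delta>>0. \<exists>j. \<exists>f\<in>level_space \<phi>d j.
        L2_norm_on unit_interval (\<lambda>t. u t - f t) < \<delta>) \<and>
     riesz_basis unit_interval ({None} \<union> Some ` {(j, k). k < 2^j}) (wavelet_system \<phi> \<psi>)"


section \<open>Discretization\<close>

text \<open>Everything below is indexed by \<open>J\<close>, with \<open>n = 2^J\<close>.\<close>

definition Omega :: "nat \<Rightarrow> (nat \<times> nat) set" where
  "Omega J = {(j, k). j < J \<and> k < 2^j}"

definition u_star :: "(real \<Rightarrow> real) \<Rightarrow> (real \<Rightarrow> real) \<Rightarrow> nat \<Rightarrow> (nat \<Rightarrow> real) \<Rightarrow> real \<Rightarrow> real" where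
  "u_star \<phi> \<phi>d J x = (THE f. f \<in> level_space \<phi>d J \<and>
     (\<forall>k<2^J. L2_inner unit_interval (periodize \<phi> J k) f = x k))"

definition discrete_wavelet ::
  "(real \<Rightarrow> real) \<Rightarrow> (real \<Rightarrow> real) \<Rightarrow> (real \<Rightarrow> real) \<Rightarrow> nat \<Rightarrow> nat \<times> nat \<Rightarrow> nat \<Rightarrow> real" where
  "discrete_wavelet \<phi> \<psi> \<phi>d J \<omega> = (THE w. w \<in> Rn (2^J) \<and>
     (\<forall>x\<in>Rn (2^J). dot (2^J) w x =
        L2_inner unit_interval (periodize \<psi> (fst \<omega>) (snd \<omega>)) (u_star \<phi> \<phi>d J x)))"

definition W_op ::
  "(real \<Rightarrow> real) \<Rightarrow> (real \<Rightarrow> real) \<Rightarrow> (real \<Rightarrow> real) \<Rightarrow> nat \<Rightarrow> (nat \<Rightarrow> real) \<Rightarrow> nat \<times> nat \<Rightarrow> real" where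
  "W_op \<phi> \<psi> \<phi>d J x = (\<lambda>\<omega>\<in>Omega J. dot (2^J) (discrete_wavelet \<phi> \<psi> \<phi>d J \<omega>) x)"

definition wavelet_part :: "(real \<Rightarrow> real) \<Rightarrow> (real \<Rightarrow> real) \<Rightarrow> nat \<Rightarrow> (nat \<Rightarrow> real) set" where
  "wavelet_part \<phi> \<phi>d J =
     {x \<in> Rn (2^J). L2_inner unit_interval (periodize \<phi> 0 0) (u_star \<phi> \<phi>d J x) = 0}"

definition W_inv ::
  "(real \<Rightarrow> real) \<Rightarrow> (real \<Rightarrow> real) \<Rightarrow> (real \<Rightarrow> real) \<Rightarrow> nat \<Rightarrow> (nat \<times> nat \<Rightarrow> real) \<Rightarrow> nat \<Rightarrow> real" where
  "W_inv \<phi> \<psi> \<phi>d J = the_inv_into (wavelet_part \<phi> \<phi>d J) (W_op \<phi> \<psi> \<phi>d J)"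

definition soft :: "nat \<Rightarrow> (nat \<times> nat \<Rightarrow> real) \<Rightarrow> real \<Rightarrow> nat \<times> nat \<Rightarrow> real" where
  "soft J y T = (\<lambda>\<omega>\<in>Omega J. sgn (y \<omega>) * max (\<bar>y \<omega>\<bar> - T) 0)"

text \<open>The soft-thresholding estimator for data \<open>v\<close> and threshold \<open>T\<close>.\<close>

definition estimator ::
  "(real \<Rightarrow> real) \<Rightarrow> (real \<Rightarrow> real) \<Rightarrow> (real \<Rightarrow> real) \<Rightarrow> nat \<Rightarrow> real \<Rightarrow> (nat \<Rightarrow> real) \<Rightarrow> nat \<Rightarrow> real" where
  "estimator \<phi> \<psi> \<phi>d J T v = W_inv \<phi> \<psi> \<phi>d J (soft J (W_op \<phi> \<psi> \<phi>d J v) T)"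

definition add_noise :: "nat \<Rightarrow> (nat \<Rightarrow> real) \<Rightarrow> (nat \<Rightarrow> real) \<Rightarrow> nat \<Rightarrow> real" where
  "add_noise n u e = (\<lambda>k\<in>{..<n}. u k + e k)"

text \<open>The 0 only matters for the empty index set \<open>Omega 0\<close>.\<close>

definition sup_norm :: "nat \<Rightarrow> (nat \<times> nat \<Rightarrow> real) \<Rightarrow> real" where
  "sup_norm J y = Max (insert 0 ((\<lambda>\<omega>. \<bar>y \<omega>\<bar>) ` Omega J))"


section \<open>Besov norms\<close>

definition besov_seq_norm :: "real \<Rightarrow> real \<Rightarrow> real \<Rightarrow> (nat \<Rightarrow> nat \<Rightarrow> real) \<Rightarrow> ennreal" where
  "besov_seq_norm p q r x =
     (let s = r + 1/2 - 1/p;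
          a = (\<lambda>j. 2 powr (real j * s * q) *
                ((\<Sum>k<2^j. \<bar>x j k\<bar> powr p) powr (1/p)) powr q)
      in if summable a then ennreal ((\<Sum>j. a j) powr (1/q)) else \<infinity>)"

definition besov_norm ::
  "(real \<Rightarrow> real) \<Rightarrow> real \<Rightarrow> real \<Rightarrow> real \<Rightarrow> (real \<Rightarrow> real) \<Rightarrow> ennreal" where
  "besov_norm \<psi> p q r u =
     besov_seq_norm p q r (\<lambda>j k. L2_inner unit_interval (periodize \<psi> j k) u)"

definition besov_space ::
  "(real \<Rightarrow> real) \<Rightarrow> real \<Rightarrow> real \<Rightarrow> real \<Rightarrow> (real \<Rightarrow> real) set" where
  "besov_space \<psi> p q r = {u \<in> L2_on unit_interval. besov_norm \<psi> p q r u < \<infinity>}"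


section \<open>Asymptotic stability\<close>

definition is_frame :: "nat \<Rightarrow> (nat \<Rightarrow> real) set \<Rightarrow> 'i set \<Rightarrow> ('i \<Rightarrow> nat \<Rightarrow> real) \<Rightarrow> bool" where
  "is_frame n H I D \<longleftrightarrow> (\<exists>a>0. \<exists>b. \<forall>u\<in>H.
     a * (enorm_on n u)\<^sup>2 \<le> (\<Sum>\<omega>\<in>I. \<bar>dot n (D \<omega>) u\<bar>\<^sup>2) \<and>
     (\<Sum>\<omega>\<in>I. \<bar>dot n (D \<omega>) u\<bar>\<^sup>2) \<le> b * (enorm_on n u)\<^sup>2)"

text \<open>The optimal upper bound is taken over all of \<open>\<real>\<^sup>n\<close>; it dominates the one over any subspace.\<close>

definition upper_frame_bound :: "nat \<Rightarrow> 'i set \<Rightarrow> ('i \<Rightarrow> nat \<Rightarrow> real) \<Rightarrow> real" where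
  "upper_frame_bound n I D =
     Inf {b. 0 \<le> b \<and> (\<forall>u\<in>Rn n. (\<Sum>\<omega>\<in>I. \<bar>dot n (D \<omega>) u\<bar>\<^sup>2) \<le> b * (enorm_on n u)\<^sup>2)}"

text \<open>\<open>D J\<close> is a family of unit vectors in \<open>\<real>\<^sup>n\<close>, \<open>n = 2^J\<close>, which is a frame of the subspace
  \<open>H J\<close>.\<close>

definition asymptotically_stable ::
  "(nat \<Rightarrow> (nat \<Rightarrow> real) set) \<Rightarrow> (nat \<Rightarrow> 'i set) \<Rightarrow> (nat \<Rightarrow> 'i \<Rightarrow> nat \<Rightarrow> real) \<Rightarrow> bool" where
  "asymptotically_stable H I D \<longleftrightarrow>
     (\<forall>J. is_frame (2^J) (H J) (I J) (D J) \<and>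
          (\<forall>\<omega>\<in>I J. D J \<omega> \<in> Rn (2^J) \<and> enorm_on (2^J) (D J \<omega>) = 1)) \<and>
     (\<exists>\<rho>. 0 < \<rho> \<and> \<rho> < 1 \<and>
        (\<lambda>J. real (card {(\<omega>, \<omega>'). \<omega> \<in> I J \<and> \<omega>' \<in> I J \<and> \<omega> \<noteq> \<omega>' \<and>
                          \<bar>dot (2^J) (D J \<omega>) (D J \<omega>')\<bar> \<ge> \<rho>}))
          \<in> o(\<lambda>J. real (card (I J)) / sqrt (ln (real (card (I J)))))) \<and>
     (\<exists>B. \<forall>J. upper_frame_bound (2^J) (I J) (D J) \<le> B)"


section \<open>Normalization constants and thresholds\<close>

definition a_chi :: "nat \<Rightarrow> real" where
  "a_chi n = 1 / sqrt (2 * ln (real n))"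

definition b_chi :: "nat \<Rightarrow> real" where
  "b_chi n = sqrt (2 * ln (real n)) -
     (ln (ln (real n)) + ln pi) / (2 * sqrt (2 * ln (real n)))"

definition threshold :: "real \<Rightarrow> real \<Rightarrow> nat \<Rightarrow> real" where
  "threshold \<sigma> \<alpha> n = - \<sigma> * a_chi n * ln (ln (1 / (1 - \<alpha>))) + \<sigma> * b_chi n"

end

theory Submission
  imports Defs "HOL-Real_Asymp.Real_Asymp"
begin

text \<open>The discrete wavelet \<open>\<psi>\<^sup>n\<close> with index \<open>\<omega>\<close> is the coefficient vector of the periodic
  wavelet in the scaling functions of level \<open>J\<close>. Uniform Bessel bounds for the periodized scaling functions
  therefore carry the Riesz bounds of the periodic wavelets over to \<open>\<real>\<^sup>n\<close>. The upper Riesz bound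
  controls the frame bounds; the lower one, applied to two vectors, keeps all correlations below some
  \<open>\<rho> < 1\<close>, so that there are no strongly correlated pairs at all.

  For the maximum of the correlated standard normal variables \<open>X\<^sub>l\<close> one variable \<open>X\<^sub>i\<close> is split off at a time:
  \<open>X\<^sub>l = r\<^sub>l X\<^sub>i + U\<^sub>l\<close>, where the family \<open>U\<close> is independent of \<open>X\<^sub>i\<close>. If \<open>\<bar>r\<^sub>l\<bar> \<le> \<tau>\<close> with \<open>\<tau>\<close> a small
  negative power of \<open>n\<close>, replacing \<open>X\<^sub>l\<close> by \<open>U\<^sub>l\<close> changes the event \<open>\<bar>X\<^sub>l\<bar> \<le> T\<close> only if \<open>\<bar>U\<^sub>l\<bar>\<close>
  lies in a narrow band around \<open>T\<close>. By the Bessel inequality only \<open>O(1/\<tau>\<^sup>2)\<close> indices \<open>l\<close> remain, and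
  for these the joint tail is at most \<open>2 exp(-T\<^sup>2/(1 + \<rho>))\<close>. Hence the distribution function of the maximum
  at \<open>T\<close> is \<open>(1 - p)\<^sup>n\<close> up to a vanishing error, \<open>p\<close> being the tail of one variable, and Mills' ratio
  yields the Gumbel limit.

  As soon as \<open>T \<ge> 0\<close>, the event in (c) coincides with the event that all noise coefficients are at most \<open>T\<close>:
  in that case soft thresholding increases no coefficient, and conversely the choice \<open>u = 0\<close> forces
  all noise coefficients below the threshold. In particular the event is measurable.\<close>

section \<open>Independence of Gaussian projections\<close>

text \<open>The errors of all n splittings add up, so a single one must cost o(1/n); this shapes the
  estimate. With L = ln n, truncating the split variable at 2 sqrt L costs at most 1/n^2. A union
  bound for the band costs about n^(-\<kappa>) up to logarithms if \<tau> = n^(-\<kappa>), far too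
  much; but the band event depends on the residuals alone, so intersecting it with the independent
  event |X_i| > T gains the factor p, of order 1/n. A strongly correlated pair has joint tail about
  n^(-2/(1 + \<rho>)), and there are O(n^(2 \<kappa>)) such indices. Their total is o(1/n) once 2
  \<kappa> < (1 - \<rho>)/(1 + \<rho>), and a positive \<kappa> of this kind exists because \<rho> <
  1. Sampling causes no error in (c): for j < J the wavelet lies in the span of the scaling
  functions of level J, so its inner product with u is computed exactly from the samples, and for j
  \<ge> J the reconstruction has no wavelet coefficients.\<close>

lemma std_normal_density_rotation:
  assumes "s\<^sup>2 + c\<^sup>2 = 1"
  shows "std_normal_density (s * x - c * z) * std_normal_density (c * x + s * z) =
    std_normal_density x * std_normal_density z"
proof -
  have "(s * x - c * z)\<^sup>2 + (c * x + s * z)\<^sup>2 = (s\<^sup>2 + c\<^sup>2) * (x\<^sup>2 + z\<^sup>2)"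
    by (simp add: power2_eq_square algebra_simps)
  then have "(s * x - c * z)\<^sup>2 + (c * x + s * z)\<^sup>2 = x\<^sup>2 + z\<^sup>2" using assms by simp
  then have "- (s * x - c * z)\<^sup>2 / 2 + - (c * x + s * z)\<^sup>2 / 2 = - x\<^sup>2 / 2 + - z\<^sup>2 / 2" by simp
  then have "exp (- (s * x - c * z)\<^sup>2 / 2) * exp (- (c * x + s * z)\<^sup>2 / 2) = exp (- x\<^sup>2 / 2) * exp (- z\<^sup>2 / 2)"
    by (simp flip: exp_add)
  then show ?thesis unfolding std_normal_density_def by (simp add: algebra_simps)
qed

text \<open>The rotation is factored into two one-dimensional affine substitutions, one for each
  inner integral, with Fubini between them. Their Jacobians 1/s and s cancel.\<close>

lemma nn_integral_std_normal_rotation: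
  fixes f :: "real \<times> real \<Rightarrow> ennreal"
  assumes f [measurable]: "f \<in> borel_measurable (borel \<Otimes>\<^sub>M borel)"
    and s: "s > 0" and sc: "s\<^sup>2 + c\<^sup>2 = 1"
  shows "(\<integral>\<^sup>+y. \<integral>\<^sup>+w. f (s * w + c * y, - c * w + s * y) *
            ennreal (std_normal_density w * std_normal_density y) \<partial>lborel \<partial>lborel) =
         (\<integral>\<^sup>+x. \<integral>\<^sup>+z. f (x, z) * ennreal (std_normal_density x * std_normal_density z) \<partial>lborel \<partial>lborel)"
    (is "?L = ?R")
proof -
  let ?r = std_normal_density
  have c2: "c * c = 1 - s * s" using sc by (simp add: power2_eq_square)
  have e1: "s * (- c * y / s + 1 / s * x) + c * y = x" for x y using s by (simp add: field_simps)
  have e2: "- c * (- c * y / s + 1 / s * x) + s * y = (y - c * x) / s" for x y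
  proof -
    have "- c * (- c * y / s + 1 / s * x) + s * y = ((c * c + s * s) * y - c * x) / s"
      using s by (simp add: field_simps)
    then show ?thesis using c2 by simp
  qed
  \<comment> \<open>At fixed \<open>y\<close> the new variable is
    \<open>x = s * w + c * y\<close>.\<close>
  have 1: "(\<integral>\<^sup>+w. f (s * w + c * y, - c * w + s * y) * ennreal (?r w * ?r y) \<partial>lborel) =
     (\<integral>\<^sup>+x. ennreal (1 / s) * (f (x, (y - c * x) / s) * ennreal (?r (- c * y / s + 1 / s * x) * ?r y)) \<partial>lborel)" for y
    apply (subst nn_integral_real_affine[where c = "1 / s" and t = "- c * y / s"])
    using s apply simp_all
    apply (subst nn_integral_cmult[symmetric])
     apply measurable
    using e1 e2 by simp
  have e3: "(c * x + s * z - c * x) / s = z" for x z using s by simp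
  have e4: "- c * (c * x + s * z) / s + 1 / s * x = s * x - c * z" for x z
  proof -
    have "- c * (c * x + s * z) / s + 1 / s * x = ((1 - c * c) * x - c * s * z) / s"
      using s by (simp add: field_simps)
    also have "\<dots> = (s * s * x - c * s * z) / s" using c2 by simp
    also have "\<dots> = s * x - c * z" using s by (simp add: field_simps)
    finally show ?thesis .
  qed
  \<comment> \<open>At fixed \<open>x\<close> the new variable is
    \<open>z = (y - c * x) / s\<close>.\<close>
  have 2: "(\<integral>\<^sup>+y. ennreal (1 / s) * (f (x, (y - c * x) / s) * ennreal (?r (- c * y / s + 1 / s * x) * ?r y)) \<partial>lborel)
     = (\<integral>\<^sup>+z. f (x, z) * ennreal (?r x * ?r z) \<partial>lborel)" for x
  proof -
    have "(\<integral>\<^sup>+y. ennreal (1 / s) * (f (x, (y - c * x) / s) * ennreal (?r (- c * y / s + 1 / s * x) * ?r y)) \<partial>lborel)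
      = ennreal s * (\<integral>\<^sup>+z. ennreal (1 / s) * (f (x, (c * x + s * z - c * x) / s) *
           ennreal (?r (- c * (c * x + s * z) / s + 1 / s * x) * ?r (c * x + s * z))) \<partial>lborel)"
      by (subst nn_integral_real_affine[where c = s and t = "c * x"]) (use s in simp_all)
    also have "\<dots> = ennreal s * (\<integral>\<^sup>+z. ennreal (1 / s) * (f (x, z) * ennreal (?r x * ?r z)) \<partial>lborel)"
      unfolding e3 e4 std_normal_density_rotation[OF sc] ..
    also have "\<dots> = (\<integral>\<^sup>+z. ennreal s * (ennreal (1 / s) * (f (x, z) * ennreal (?r x * ?r z))) \<partial>lborel)"
      by (rule nn_integral_cmult[symmetric]) measurable
    also have "\<dots> = (\<integral>\<^sup>+z. f (x, z) * ennreal (?r x * ?r z) \<partial>lborel)"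
      using s by (simp add: mult.assoc[symmetric] ennreal_mult[symmetric])
    finally show ?thesis .
  qed
  have "?L = (\<integral>\<^sup>+y. \<integral>\<^sup>+x. ennreal (1 / s) * (f (x, (y - c * x) / s) * ennreal (?r (- c * y / s + 1 / s * x) * ?r y)) \<partial>lborel \<partial>lborel)"
    unfolding 1 ..
  also have "\<dots> = (\<integral>\<^sup>+x. \<integral>\<^sup>+y. ennreal (1 / s) * (f (x, (y - c * x) / s) * ennreal (?r (- c * y / s + 1 / s * x) * ?r y)) \<partial>lborel \<partial>lborel)"
    by (rule lborel_pair.Fubini') measurable
  also have "\<dots> = ?R" unfolding 2 ..
  finally show ?thesis .
qed

text \<open>The library's \<open>indep_var\<close> requires both variables to have the same type.\<close>

definition (in prob_space) indep_rv :: "'b measure \<Rightarrow> ('a \<Rightarrow> 'b) \<Rightarrow> 'c measure \<Rightarrow> ('a \<Rightarrow> 'c) \<Rightarrow> bool" where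
  "indep_rv S X T Y \<longleftrightarrow> X \<in> measurable M S \<and> Y \<in> measurable M T \<and>
     distr M S X \<Otimes>\<^sub>M distr M T Y = distr M (S \<Otimes>\<^sub>M T) (\<lambda>x. (X x, Y x))"

lemma (in prob_space) indep_rvD:
  assumes "indep_rv S X T Y"
  shows "X \<in> measurable M S" "Y \<in> measurable M T"
    "distr M (S \<Otimes>\<^sub>M T) (\<lambda>x. (X x, Y x)) = distr M S X \<Otimes>\<^sub>M distr M T Y"
  using assms by (simp_all add: indep_rv_def)

lemma (in prob_space) indep_var_imp_indep_rv: "indep_var S X T Y \<Longrightarrow> indep_rv S X T Y"
  by (simp add: indep_rv_def indep_var_distribution_eq)

section \<open>Independence under maps, exchange and regrouping\<close>

lemma (in prob_space) indep_rv_compose: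
  assumes "indep_rv S X T Y" and f [measurable]: "f \<in> measurable S S'" and g [measurable]: "g \<in> measurable T T'"
  shows "indep_rv S' (\<lambda>x. f (X x)) T' (\<lambda>x. g (Y x))"
proof -
  note [measurable] = indep_rvD(1,2)[OF assms(1)]
  interpret Y: prob_space "distr (distr M T Y) T' g"
    by (intro prob_space.prob_space_distr[OF prob_space_distr]) measurable
  have "distr M (S' \<Otimes>\<^sub>M T') (\<lambda>x. (f (X x), g (Y x))) =
      distr (distr M (S \<Otimes>\<^sub>M T) (\<lambda>x. (X x, Y x))) (S' \<Otimes>\<^sub>M T') (\<lambda>(x, y). (f x, g y))"
    by (subst distr_distr) (simp_all add: comp_def)
  also have "\<dots> = distr (distr M S X) S' f \<Otimes>\<^sub>M distr (distr M T Y) T' g"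
    unfolding indep_rvD(3)[OF assms(1)] 
    by (intro pair_measure_distr[symmetric] Y.sigma_finite_measure_axioms) measurable
  finally show ?thesis
    by (simp add: indep_rv_def distr_distr comp_def)
qed

lemma (in prob_space) indep_rv_swap:
  assumes "indep_rv S X T Y"
  shows "indep_rv T Y S X"
proof -
  note [measurable] = indep_rvD(1,2)[OF assms]
  interpret X: prob_space "distr M S X" by (rule prob_space_distr) measurable
  interpret Y: prob_space "distr M T Y" by (rule prob_space_distr) measurable
  interpret YX: pair_prob_space "distr M T Y" "distr M S X" ..
  have "distr M T Y \<Otimes>\<^sub>M distr M S X = distr (distr M S X \<Otimes>\<^sub>M distr M T Y) (T \<Otimes>\<^sub>M S) (\<lambda>(x, y). (y, x))"
    by (subst YX.distr_pair_swap) (auto intro!: distr_cong sets_pair_measure_cong)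
  also have "\<dots> = distr M (T \<Otimes>\<^sub>M S) (\<lambda>x. (Y x, X x))"
    unfolding indep_rvD(3)[OF assms, symmetric] by (subst distr_distr) (simp_all add: comp_def)
  finally show ?thesis by (simp add: indep_rv_def)
qed

lemma (in prob_space) indep_rv_prob:
  assumes "indep_rv S X T Y" and A: "A \<in> sets S" and B: "B \<in> sets T"
  shows "prob {x \<in> space M. X x \<in> A \<and> Y x \<in> B} = prob {x \<in> space M. X x \<in> A} * prob {x \<in> space M. Y x \<in> B}"
proof -
  note [measurable] = indep_rvD(1,2)[OF assms(1)]
  interpret X: prob_space "distr M S X" by (rule prob_space_distr) measurable
  interpret Y: prob_space "distr M T Y" by (rule prob_space_distr) measurable
  interpret XY: pair_prob_space "distr M S X" "distr M T Y" ..
  have "prob {x \<in> space M. X x \<in> A \<and> Y x \<in> B} = measure (distr M (S \<Otimes>\<^sub>M T) (\<lambda>x. (X x, Y x))) (A \<times> B)"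
    using A B by (subst measure_distr) (auto intro!: arg_cong[where f = prob])
  also have "\<dots> = measure (distr M S X) A * measure (distr M T Y) B"
    unfolding indep_rvD(3)[OF assms(1)] using A B
    by (simp add: measure_def Y.emeasure_pair_measure_Times enn2real_mult)
  also have "\<dots> = prob {x \<in> space M. X x \<in> A} * prob {x \<in> space M. Y x \<in> B}"
    using A B by (subst (1 2) measure_distr) (auto intro!: arg_cong2[where f = "(*)"] arg_cong[where f = prob])
  finally show ?thesis .
qed

text \<open>Both hypotheses together say that \<open>X\<close>, \<open>Y\<close> and
  \<open>U\<close> are mutually independent, so the law of the triple is the product of the three
  marginals in either bracketing. The lemma moves a variable to the other side when independence is
  established in stages.\<close>

lemma (in prob_space) indep_rv_reassoc:
  assumes XY: "indep_rv S X T Y" and XYU: "indep_rv (S \<Otimes>\<^sub>M T) (\<lambda>x. (X x, Y x)) R U"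
  shows "indep_rv S X (T \<Otimes>\<^sub>M R) (\<lambda>x. (Y x, U x))"
proof -
  note X [measurable] = indep_rvD(1)[OF XY] and Y [measurable] = indep_rvD(2)[OF XY]
    and U [measurable] = indep_rvD(2)[OF XYU]
  let ?X = "distr M S X" and ?Y = "distr M T Y" and ?U = "distr M R U"
  interpret X: prob_space ?X by (rule prob_space_distr) fact
  interpret Y: prob_space ?Y by (rule prob_space_distr) fact
  interpret U: prob_space ?U by (rule prob_space_distr) fact
  have YU: "indep_rv T Y R U"
    using indep_rv_compose[OF XYU, of snd T "\<lambda>x. x" R] by simp
  have dYU: "distr M (T \<Otimes>\<^sub>M R) (\<lambda>x. (Y x, U x)) = ?Y \<Otimes>\<^sub>M ?U"
    by (rule indep_rvD(3)[OF YU])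
  have dXY: "distr M (S \<Otimes>\<^sub>M T) (\<lambda>x. (X x, Y x)) = ?X \<Otimes>\<^sub>M ?Y"
    by (rule indep_rvD(3)[OF XY])
  have dXYU: "distr M ((S \<Otimes>\<^sub>M T) \<Otimes>\<^sub>M R) (\<lambda>x. ((X x, Y x), U x)) = (?X \<Otimes>\<^sub>M ?Y) \<Otimes>\<^sub>M ?U"
    using indep_rvD(3)[OF XYU] dXY by simp
  interpret XY: prob_space "?X \<Otimes>\<^sub>M ?Y" unfolding dXY[symmetric] by (rule prob_space_distr) measurable
  interpret YU: prob_space "?Y \<Otimes>\<^sub>M ?U" unfolding dYU[symmetric] by (rule prob_space_distr) measurable
  have "?X \<Otimes>\<^sub>M distr M (T \<Otimes>\<^sub>M R) (\<lambda>x. (Y x, U x)) = distr M (S \<Otimes>\<^sub>M (T \<Otimes>\<^sub>M R)) (\<lambda>x. (X x, Y x, U x))"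
  proof (rule measure_eqI)
    show "sets (?X \<Otimes>\<^sub>M distr M (T \<Otimes>\<^sub>M R) (\<lambda>x. (Y x, U x))) = sets (distr M (S \<Otimes>\<^sub>M (T \<Otimes>\<^sub>M R)) (\<lambda>x. (X x, Y x, U x)))"
      by (simp cong: sets_pair_measure_cong)
    fix A assume "A \<in> sets (?X \<Otimes>\<^sub>M distr M (T \<Otimes>\<^sub>M R) (\<lambda>x. (Y x, U x)))"
    then have A [measurable]: "A \<in> sets (S \<Otimes>\<^sub>M (T \<Otimes>\<^sub>M R))" by (simp cong: sets_pair_measure_cong)
    have A2: "A \<in> sets (?X \<Otimes>\<^sub>M (?Y \<Otimes>\<^sub>M ?U))" using A by (simp cong: sets_pair_measure_cong)
    \<comment> \<open>The indicator of \<open>A\<close> read in the other bracketing, so that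
      iterated integration over the known law applies.\<close>
    define f where "f p = (indicator A (fst (fst p), snd (fst p), snd p) :: ennreal)" for p
    have f [measurable]: "f \<in> borel_measurable ((S \<Otimes>\<^sub>M T) \<Otimes>\<^sub>M R)" unfolding f_def[abs_def] by measurable
    have f2: "f \<in> borel_measurable ((?X \<Otimes>\<^sub>M ?Y) \<Otimes>\<^sub>M ?U)" using f by (simp cong: measurable_cong_sets sets_pair_measure_cong)
    have "emeasure (distr M (S \<Otimes>\<^sub>M (T \<Otimes>\<^sub>M R)) (\<lambda>x. (X x, Y x, U x))) A
       = (\<integral>\<^sup>+p. indicator A p \<partial>(distr M (S \<Otimes>\<^sub>M (T \<Otimes>\<^sub>M R)) (\<lambda>x. (X x, Y x, U x))))" using A by simp
    also have "\<dots> = (\<integral>\<^sup>+x. indicator A (X x, Y x, U x) \<partial>M)" by (rule nn_integral_distr) measurable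
    also have "\<dots> = (\<integral>\<^sup>+p. f p \<partial>(distr M ((S \<Otimes>\<^sub>M T) \<Otimes>\<^sub>M R) (\<lambda>x. ((X x, Y x), U x))))"
      by (subst nn_integral_distr) (simp_all add: f_def)
    also have "\<dots> = (\<integral>\<^sup>+q. \<integral>\<^sup>+u. f (q, u) \<partial>?U \<partial>(?X \<Otimes>\<^sub>M ?Y))"
      unfolding dXYU by (rule U.nn_integral_fst[symmetric]) (rule f2)
    also have "\<dots> = (\<integral>\<^sup>+x. \<integral>\<^sup>+y. \<integral>\<^sup>+u. f ((x, y), u) \<partial>?U \<partial>?Y \<partial>?X)"
      using U.borel_measurable_nn_integral_fst[OF f2] by (simp add: Y.nn_integral_fst[symmetric])
    also have "\<dots> = (\<integral>\<^sup>+x. \<integral>\<^sup>+p. indicator A (x, p) \<partial>(?Y \<Otimes>\<^sub>M ?U) \<partial>?X)"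
    proof (rule nn_integral_cong)
      fix x assume "x \<in> space ?X"
      then have "(\<lambda>p. indicator A (x, p) :: ennreal) \<in> borel_measurable (?Y \<Otimes>\<^sub>M ?U)"
        using A2 by measurable
      then show "(\<integral>\<^sup>+y. \<integral>\<^sup>+u. f ((x, y), u) \<partial>?U \<partial>?Y) = (\<integral>\<^sup>+p. indicator A (x, p) \<partial>(?Y \<Otimes>\<^sub>M ?U))"
        by (simp add: U.nn_integral_fst[symmetric] f_def)
    qed
    also have "\<dots> = (\<integral>\<^sup>+p. indicator A p \<partial>(?X \<Otimes>\<^sub>M (?Y \<Otimes>\<^sub>M ?U)))"
      using A2 by (intro YU.nn_integral_fst) measurable
    also have "\<dots> = emeasure (?X \<Otimes>\<^sub>M (?Y \<Otimes>\<^sub>M ?U)) A" using A2 by simp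
    finally show "emeasure (?X \<Otimes>\<^sub>M distr M (T \<Otimes>\<^sub>M R) (\<lambda>x. (Y x, U x))) A =
      emeasure (distr M (S \<Otimes>\<^sub>M (T \<Otimes>\<^sub>M R)) (\<lambda>x. (X x, Y x, U x))) A" unfolding dYU by simp
  qed
  then show ?thesis by (simp add: indep_rv_def)
qed

text \<open>The standard Gaussian measure of the plane is invariant under rotations, so the rotated
  pair again has a product law.\<close>

lemma (in prob_space) indep_normal_rotation:
  fixes W E :: "'a \<Rightarrow> real"
  assumes WE: "indep_rv borel W borel E"
    and W: "distributed M lborel W std_normal_density" and E: "distributed M lborel E std_normal_density"
    and s: "s > 0" and sc: "s\<^sup>2 + c\<^sup>2 = 1"
  shows "indep_rv borel (\<lambda>x. s * W x + c * E x) borel (\<lambda>x. - c * W x + s * E x)"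
proof -
  note [measurable] = indep_rvD(1,2)[OF WE]
  let ?r = std_normal_density
  let ?X = "\<lambda>x. s * W x + c * E x" and ?Y = "\<lambda>x. - c * W x + s * E x"
  have "indep_var borel W borel E" using WE by (simp add: indep_rv_def indep_var_distribution_eq)
  then have "indep_var lborel W lborel E" unfolding indep_var_eq by simp
  from distributed_joint_indep[OF _ _ W E this]
  have j: "distributed M (lborel \<Otimes>\<^sub>M lborel) (\<lambda>x. (W x, E x)) (\<lambda>(x, y). ennreal (?r x * ?r y))"
    by (simp add: sigma_finite_lborel ennreal_mult' split_beta')
  let ?N = "density lborel ?r"
  interpret N: prob_space ?N by (rule prob_space_normal_density) simp
  interpret NN: pair_prob_space ?N ?N ..
  have jd: "distr M (borel \<Otimes>\<^sub>M borel) (\<lambda>x. (?X x, ?Y x)) = ?N \<Otimes>\<^sub>M ?N"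
  proof (rule measure_eqI)
    show "sets (distr M (borel \<Otimes>\<^sub>M borel) (\<lambda>x. (?X x, ?Y x))) = sets (?N \<Otimes>\<^sub>M ?N)"
      by (simp cong: sets_pair_measure_cong)
    fix A assume "A \<in> sets (distr M (borel \<Otimes>\<^sub>M borel) (\<lambda>x. (?X x, ?Y x)))"
    then have A [measurable]: "A \<in> sets (borel \<Otimes>\<^sub>M borel)" by simp
    have A2: "A \<in> sets (?N \<Otimes>\<^sub>M ?N)" using A by (simp cong: sets_pair_measure_cong)
    have "emeasure (distr M (borel \<Otimes>\<^sub>M borel) (\<lambda>x. (?X x, ?Y x))) A =
       (\<integral>\<^sup>+p. indicator A p \<partial>(distr M (borel \<Otimes>\<^sub>M borel) (\<lambda>x. (?X x, ?Y x))))" by simp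
    also have "\<dots> = (\<integral>\<^sup>+x. indicator A (?X x, ?Y x) \<partial>M)" by (rule nn_integral_distr) measurable
    also have "\<dots> = (\<integral>\<^sup>+p. (case p of (w, y) \<Rightarrow> ennreal (?r w * ?r y)) * (case p of (w, y) \<Rightarrow> indicator A (s * w + c * y, - c * w + s * y))
          \<partial>(lborel \<Otimes>\<^sub>M lborel))"
      by (subst distributed_nn_integral[OF j]) simp_all
    also have "\<dots> = (\<integral>\<^sup>+y. \<integral>\<^sup>+w. indicator A (s * w + c * y, - c * w + s * y) *
            ennreal (?r w * ?r y) \<partial>lborel \<partial>lborel)"
      by (subst lborel_pair.nn_integral_snd[symmetric]) (simp_all add: mult.commute)
    also have "\<dots> = (\<integral>\<^sup>+x. \<integral>\<^sup>+z. indicator A (x, z) * ennreal (?r x * ?r z) \<partial>lborel \<partial>lborel)"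
      by (rule nn_integral_std_normal_rotation) (use s sc in measurable)
    also have "\<dots> = (\<integral>\<^sup>+x. \<integral>\<^sup>+z. indicator A (x, z) \<partial>?N \<partial>?N)"
    proof -
      have "(\<integral>\<^sup>+z. indicator A (x, z) * ennreal (?r x * ?r z) \<partial>lborel) = ennreal (?r x) * (\<integral>\<^sup>+z. indicator A (x, z) \<partial>?N)" for x
      proof -
        have "(\<integral>\<^sup>+z. indicator A (x, z) * ennreal (?r x * ?r z) \<partial>lborel) =
            (\<integral>\<^sup>+z. ennreal (?r x) * (ennreal (?r z) * indicator A (x, z)) \<partial>lborel)"
          by (intro nn_integral_cong) (simp add: ennreal_mult' ac_simps)
        also have "\<dots> = ennreal (?r x) * (\<integral>\<^sup>+z. ennreal (?r z) * indicator A (x, z) \<partial>lborel)"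
          by (rule nn_integral_cmult) measurable
        finally show ?thesis by (subst nn_integral_density) simp_all
      qed
      moreover have "(\<lambda>x. \<integral>\<^sup>+z. indicator A (x, z) \<partial>?N) \<in> borel_measurable lborel"
        using N.borel_measurable_nn_integral_fst[of "indicator A" ?N] A2 by simp
      ultimately show ?thesis by (subst nn_integral_density[of _ lborel]) simp_all
    qed
    also have "\<dots> = (\<integral>\<^sup>+p. indicator A p \<partial>(?N \<Otimes>\<^sub>M ?N))"
      using A2 by (intro N.nn_integral_fst) measurable
    finally show "emeasure (distr M (borel \<Otimes>\<^sub>M borel) (\<lambda>x. (?X x, ?Y x))) A = emeasure (?N \<Otimes>\<^sub>M ?N) A"
      using A2 by simp
  qed
  \<comment> \<open>The marginals are read off from the joint law by projection.\<close>
  have "distr M borel ?X = distr (distr M (borel \<Otimes>\<^sub>M borel) (\<lambda>x. (?X x, ?Y x))) borel fst"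
    by (subst distr_distr) (simp_all add: comp_def)
  also have "\<dots> = distr (?N \<Otimes>\<^sub>M ?N) ?N fst" unfolding jd by (rule distr_cong) simp_all
  also have "\<dots> = ?N" by (rule N.distr_pair_fst)
  finally have dX: "distr M borel ?X = ?N" .
  have "distr M borel ?Y = distr (distr M (borel \<Otimes>\<^sub>M borel) (\<lambda>x. (?X x, ?Y x))) borel snd"
    by (subst distr_distr) (simp_all add: comp_def)
  also have "\<dots> = distr (?N \<Otimes>\<^sub>M ?N) ?N snd" unfolding jd by (rule distr_cong) simp_all
  also have "\<dots> = ?N"
  proof -
    have "distr (?N \<Otimes>\<^sub>M ?N) ?N snd = distr (distr (?N \<Otimes>\<^sub>M ?N) (?N \<Otimes>\<^sub>M ?N) (\<lambda>(x, y). (y, x))) ?N fst"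
      by (subst distr_distr) (auto simp: comp_def intro!: distr_cong)
    also have "\<dots> = ?N" unfolding NN.distr_pair_swap[symmetric] by (rule N.distr_pair_fst)
    finally show ?thesis .
  qed
  finally have dY: "distr M borel ?Y = ?N" .
  show ?thesis unfolding indep_rv_def
  proof (intro conjI)
    show "distr M borel ?X \<Otimes>\<^sub>M distr M borel ?Y = distr M (borel \<Otimes>\<^sub>M borel) (\<lambda>x. (?X x, ?Y x))"
      by (simp only: dX dY jd)
  qed measurable
qed

lemma (in prob_space) linear_combination_normal:
  fixes e :: "'i \<Rightarrow> 'a \<Rightarrow> real"
  assumes K: "finite K" and ind: "indep_vars (\<lambda>_. borel) e K"
    and normal: "\<And>k. k \<in> K \<Longrightarrow> distributed M lborel (e k) std_normal_density"
    and pos: "(\<Sum>k\<in>K. (v k)\<^sup>2) > 0"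
  shows "distributed M lborel (\<lambda>x. \<Sum>k\<in>K. v k * e k x) (normal_density 0 (sqrt (\<Sum>k\<in>K. (v k)\<^sup>2)))"
proof -
  \<comment> \<open>A term with coefficient zero has no density, so it is removed before the sum
    rule for independent normal variables is applied.\<close>
  let ?K = "{k \<in> K. v k \<noteq> 0}"
  have eq: "(\<Sum>k\<in>K. (v k)\<^sup>2) = (\<Sum>k\<in>?K. \<bar>v k\<bar>\<^sup>2)"
    using K by (auto intro!: sum.mono_neutral_cong_right)
  have "?K \<noteq> {}" using pos unfolding eq by (metis less_irrefl sum.empty)
  moreover have "indep_vars (\<lambda>_. borel) (\<lambda>k x. v k * e k x) ?K"
    by (rule indep_vars_compose2[where Y = "\<lambda>k t. v k * t" and M' = "\<lambda>_. borel"])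
      (auto intro: indep_vars_subset[OF ind])
  moreover have "distributed M lborel (\<lambda>x. v k * e k x) (normal_density 0 \<bar>v k\<bar>)" if "k \<in> ?K" for k
    using normal_density_affine[OF normal[of k], of "v k" 0] that by simp
  ultimately have "distributed M lborel (\<lambda>x. \<Sum>k\<in>?K. v k * e k x) (normal_density (\<Sum>k\<in>?K. 0) (sqrt (\<Sum>k\<in>?K. \<bar>v k\<bar>\<^sup>2)))"
    using K by (intro sum_indep_normal) auto
  moreover have "(\<lambda>x. \<Sum>k\<in>?K. v k * e k x) = (\<lambda>x. \<Sum>k\<in>K. v k * e k x)"
    using K by (intro ext sum.mono_neutral_cong_left) auto
  ultimately show ?thesis by (simp add: eq)
qed

text \<open>In the induction, the normalized old projection and the new variable are rotated in their plane;
  the residuals of the old variables are independent of this plane.\<close>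

lemma (in prob_space) normal_projection_indep:
  fixes e :: "'i \<Rightarrow> 'a \<Rightarrow> real"
  assumes "finite K" and "indep_vars (\<lambda>_. borel) e K"
    and "\<And>k. k \<in> K \<Longrightarrow> distributed M lborel (e k) std_normal_density"
    and "(\<Sum>k\<in>K. (v k)\<^sup>2) = 1"
  shows "indep_rv borel (\<lambda>x. \<Sum>i\<in>K. v i * e i x)
    (PiM K (\<lambda>_. borel)) (\<lambda>x. \<lambda>k\<in>K. e k x - v k * (\<Sum>i\<in>K. v i * e i x))"
  using assms
proof (induction K arbitrary: v rule: finite_induct)
  case empty
  then show ?case by simp
next
  case (insert i K)
  define s where "s = sqrt (\<Sum>k\<in>K. (v k)\<^sup>2)"
  define c where "c = v i"
  have s0: "s \<ge> 0" unfolding s_def by (simp add: sum_nonneg)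
  have s2: "s\<^sup>2 = (\<Sum>k\<in>K. (v k)\<^sup>2)" unfolding s_def by (simp add: sum_nonneg)
  have sc: "s\<^sup>2 + c\<^sup>2 = 1" using insert unfolding s2 c_def by simp
  have ind: "indep_rv (PiM K (\<lambda>_. borel)) (\<lambda>x. \<lambda>k\<in>K. e k x) (PiM {i} (\<lambda>_. borel)) (\<lambda>x. \<lambda>k\<in>{i}. e k x)"
  proof -
    have "indep_rv (PiM K (\<lambda>_. borel)) (\<lambda>x. restrict (\<lambda>k. e k x) K) (PiM {i} (\<lambda>_. borel)) (\<lambda>x. restrict (\<lambda>k. e k x) {i})"
      using insert by (intro indep_var_imp_indep_rv indep_var_restrict) auto
    then show ?thesis .
  qed
  show ?case
  proof (cases "s = 0")
    \<comment> \<open>The vector is concentrated at \<open>i\<close>, with \<open>c\<close> equal to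
      1 or -1, and the plane degenerates. The residual at \<open>i\<close> is zero and the other
      residuals are the old variables.\<close>
    case True
    then have v0: "v k = 0" if "k \<in> K" for k
      using s2 that insert(1) by (simp add: sum_nonneg_eq_0_iff)
    have c1: "c * c = 1" using sc True by (simp add: power2_eq_square)
    have X: "(\<Sum>k\<in>insert i K. v k * e k x) = c * e i x" for x
      using insert(1,2) v0 by (simp add: c_def)
    have m: "(\<lambda>g. \<lambda>k\<in>insert i K. if k \<in> K then g k else 0) \<in>
        measurable (PiM K (\<lambda>_. borel)) (PiM (insert i K) (\<lambda>_. borel :: real measure))"
    proof (rule measurable_restrict)
      fix k show "(\<lambda>g. if k \<in> K then g k else 0) \<in> measurable (PiM K (\<lambda>_. borel)) (borel :: real measure)"
        by (cases "k \<in> K") simp_all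
    qed
    have "indep_rv borel (\<lambda>x. c * (restrict (\<lambda>k. e k x) {i}) i) (PiM (insert i K) (\<lambda>_. borel))
      (\<lambda>x. (\<lambda>g. \<lambda>k\<in>insert i K. if k \<in> K then g k else 0) (restrict (\<lambda>k. e k x) K))"
      by (rule indep_rv_compose[OF indep_rv_swap[OF ind] _ m]) simp
    moreover have "(\<lambda>g. \<lambda>k\<in>insert i K. if k \<in> K then g k else 0) (restrict (\<lambda>k. e k x) K) =
       (\<lambda>k\<in>insert i K. e k x - v k * (\<Sum>i\<in>insert i K. v i * e i x))" for x
      unfolding X using v0 insert(2) c1 by (auto simp: fun_eq_iff c_def mult.assoc[symmetric])
    ultimately have "indep_rv borel (\<lambda>x. c * e i x) (PiM (insert i K) (\<lambda>_. borel))
       (\<lambda>x. \<lambda>k\<in>insert i K. e k x - v k * (\<Sum>i\<in>insert i K. v i * e i x))"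
      by (simp only: restrict_apply singletonI if_True)
    then show ?thesis by (simp only: X)
  next
    case False
    with s0 have s: "s > 0" by simp
    define w where "w k = v k / s" for k
    have w1: "(\<Sum>k\<in>K. (w k)\<^sup>2) = 1"
      unfolding w_def using s by (simp add: power_divide sum_divide_distrib[symmetric] s2[symmetric])
    have indK: "indep_vars (\<lambda>_. borel) e K" using insert by (auto intro: indep_vars_subset)
    define W where "W x = (\<Sum>k\<in>K. w k * e k x)" for x
    define U where "U x = (\<lambda>k\<in>K. e k x - w k * W x)" for x
    let ?P = "PiM K (\<lambda>_. borel :: real measure)"
    have WU: "indep_rv borel W ?P U"
      unfolding U_def W_def using insert indK w1 by (intro insert.IH) auto
    define f where "f g = ((\<lambda>k\<in>K. g k - w k * (\<Sum>k\<in>K. w k * g k)), (\<Sum>k\<in>K. w k * g k))" for g :: "'i \<Rightarrow> real"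
    have f [measurable]: "f \<in> measurable ?P (?P \<Otimes>\<^sub>M borel)"
      unfolding f_def by measurable
    have fe: "f (\<lambda>k\<in>K. e k x) = (U x, W x)" for x
      unfolding f_def U_def W_def by (auto simp: fun_eq_iff)
    have UWE: "indep_rv (?P \<Otimes>\<^sub>M borel) (\<lambda>x. (U x, W x)) borel (e i)"
      using indep_rv_compose[OF ind f, of "\<lambda>g. g i" borel] by (simp add: fe)
    have WE: "indep_rv borel W borel (e i)"
      using indep_rv_compose[OF UWE, of snd borel "\<lambda>x. x" borel] by simp
    define X where "X x = s * W x + c * e i x" for x
    define Y where "Y x = - c * W x + s * e i x" for x
    have dW: "distributed M lborel W std_normal_density"
      using linear_combination_normal[OF insert(1) indK, of w] insert w1 by (simp add: W_def[abs_def])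
    have XY: "indep_rv borel X borel Y"
      unfolding X_def Y_def using WE dW s sc insert by (intro indep_normal_rotation) auto
    have "indep_rv ?P U (borel \<Otimes>\<^sub>M borel) (\<lambda>x. (W x, e i x))"
      by (rule indep_rv_reassoc[OF indep_rv_swap[OF WU] UWE])
    from indep_rv_compose[OF this, of "\<lambda>x. x" ?P "\<lambda>(a, b). (s * a + c * b, - c * a + s * b)" "borel \<Otimes>\<^sub>M borel"]
    have "indep_rv ?P U (borel \<Otimes>\<^sub>M borel) (\<lambda>x. (X x, Y x))"
      by (simp add: X_def Y_def)
    from indep_rv_reassoc[OF XY indep_rv_swap[OF this]]
    have X_YU: "indep_rv borel X (borel \<Otimes>\<^sub>M ?P) (\<lambda>x. (Y x, U x))" .
    \<comment> \<open>In the orthonormal frame formed by \<open>w\<close> and the unit vector of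
      \<open>i\<close>, \<open>X\<close> is the coordinate along (s, c) and \<open>Y\<close> the one
      along (-c, s). The new residual is \<open>U\<close> plus \<open>Y\<close> times the second
      direction, which gives the two cases.\<close>
    have m: "(\<lambda>(y, u). \<lambda>k\<in>insert i K. if k \<in> K then u k - w k * c * y else s * y) \<in>
       measurable (borel \<Otimes>\<^sub>M ?P) (PiM (insert i K) (\<lambda>_. borel))"
      unfolding split_beta'
    proof (rule measurable_restrict)
      fix k show "(\<lambda>p. if k \<in> K then snd p k - w k * c * fst p else s * fst p) \<in> borel_measurable (borel \<Otimes>\<^sub>M ?P)"
        by (cases "k \<in> K") simp_all
    qed
    from indep_rv_compose[OF X_YU _ m, of "\<lambda>x. x" borel]
    have "indep_rv borel X (PiM (insert i K) (\<lambda>_. borel))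
       (\<lambda>x. \<lambda>k\<in>insert i K. if k \<in> K then U x k - w k * c * Y x else s * Y x)"
      by simp
    moreover have XX: "(\<Sum>k\<in>insert i K. v k * e k x) = X x" for x
      unfolding X_def W_def c_def w_def using insert(1,2) s by (simp add: sum_distrib_left)
    moreover have "(\<lambda>k\<in>insert i K. if k \<in> K then U x k - w k * c * Y x else s * Y x) =
      (\<lambda>k\<in>insert i K. e k x - v k * X x)" for x
    proof -
      have ss: "s * s = 1 - c * c" using sc by (simp add: power2_eq_square)
      have 1: "U x k - w k * c * Y x = e k x - v k * X x" if "k \<in> K" for k
      proof -
        have "v k = w k * s" using s by (simp add: w_def)
        then have "U x k - w k * c * Y x - (e k x - v k * X x) = w k * (W x * (c * c + s * s - 1))"
          unfolding U_def X_def Y_def using that by (simp add: algebra_simps)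
        then show ?thesis using ss by simp
      qed
      have 2: "s * Y x = e i x - v i * X x"
      proof -
        have "s * Y x - (e i x - v i * X x) = e i x * (s * s + c * c - 1)"
          unfolding X_def Y_def c_def by (simp add: algebra_simps)
        then show ?thesis using ss by simp
      qed
      show ?thesis using 1 2 insert(2) by (auto simp: fun_eq_iff)
    qed
    ultimately show ?thesis by (simp only:)
  qed
qed

section \<open>Tails of the normal distribution\<close>

lemma (in prob_space) prob_normal_in:
  fixes X :: "'a \<Rightarrow> real"
  assumes X: "distributed M lborel X (normal_density 0 s)" and s: "s > 0" and "B \<in> sets borel"
  shows "prob {x \<in> space M. X x \<in> B} = (LINT x:B|lborel. normal_density 0 s x)"
proof -
  note [measurable] = distributed_measurable[OF X]
  have "ennreal (prob {x \<in> space M. X x \<in> B}) = emeasure M (X -` B \<inter> space M)"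
    by (auto simp: emeasure_eq_measure intro!: arg_cong[where f = prob])
  also have "\<dots> = (\<integral>\<^sup>+x. ennreal (normal_density 0 s x) * indicator B x \<partial>lborel)"
    using distributed_emeasure[OF X, of B] assms(3) by simp
  also have "\<dots> = (\<integral>\<^sup>+x. ennreal (indicator B x *\<^sub>R normal_density 0 s x) \<partial>lborel)"
    by (intro nn_integral_cong) (auto split: split_indicator)
  also have "\<dots> = ennreal (LINT x:B|lborel. normal_density 0 s x)"
    unfolding set_lebesgue_integral_def
    by (rule nn_integral_eq_integral) 
      (use assms in \<open>auto simp del: real_scaleR_def split: split_indicator intro!: integrable_mult_indicator\<close>)
  finally show ?thesis
    by (simp add: set_lebesgue_integral_def)
qed

definition normal_tail :: "real \<Rightarrow> real" where
  "normal_tail t = (LINT x:{x. \<bar>x\<bar> > t}|lborel. std_normal_density x)"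

lemma normal_tail_nonneg: "normal_tail t \<ge> 0"
  unfolding normal_tail_def set_lebesgue_integral_def by simp

lemma (in prob_space) prob_abs_normal_gt:
  assumes X: "distributed M lborel X (normal_density 0 s)" and s: "s > 0"
  shows "prob {x \<in> space M. \<bar>X x\<bar> > t} = normal_tail (t / s)"
proof -
  have "distributed M lborel (\<lambda>x. X x / s) std_normal_density"
    using normal_standard_normal_convert[OF s, of X 0] X by simp
  then have "prob {x \<in> space M. X x / s \<in> {x. \<bar>x\<bar> > t / s}} = normal_tail (t / s)"
    unfolding normal_tail_def by (rule prob_normal_in) simp_all
  then show ?thesis using s by (simp add: divide_less_cancel)
qed

lemma normal_tail_eq:
  assumes "t \<ge> 0"
  shows "ennreal (normal_tail t) = 2 * (\<integral>\<^sup>+x. ennreal (std_normal_density x) * indicator {t..} x \<partial>lborel)"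
proof -
  let ?r = std_normal_density
  have "ennreal (normal_tail t) = (\<integral>\<^sup>+x. ennreal (indicator {x. \<bar>x\<bar> > t} x *\<^sub>R ?r x) \<partial>lborel)"
    unfolding normal_tail_def set_lebesgue_integral_def
    by (rule nn_integral_eq_integral[symmetric])
      (auto intro!: integrable_mult_indicator simp del: real_scaleR_def split: split_indicator)
  also have "\<dots> = (\<integral>\<^sup>+x. ennreal (?r x) * indicator {t<..} x + ennreal (?r x) * indicator {..< - t} x \<partial>lborel)"
    using assms by (intro nn_integral_cong) (auto split: split_indicator)
  also have "\<dots> = (\<integral>\<^sup>+x. ennreal (?r x) * indicator {t<..} x \<partial>lborel) + (\<integral>\<^sup>+x. ennreal (?r x) * indicator {..< - t} x \<partial>lborel)"
    by (rule nn_integral_add) measurable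
  also have "(\<integral>\<^sup>+x. ennreal (?r x) * indicator {..< - t} x \<partial>lborel) = (\<integral>\<^sup>+x. ennreal (?r x) * indicator {t<..} x \<partial>lborel)"
    by (subst nn_integral_real_affine[where c = "-1" and t = 0])
      (auto simp: normal_density_def intro!: nn_integral_cong split: split_indicator)
  also have "(\<integral>\<^sup>+x. ennreal (?r x) * indicator {t<..} x \<partial>lborel) = (\<integral>\<^sup>+x. ennreal (?r x) * indicator {t..} x \<partial>lborel)"
    by (intro nn_integral_cong_AE AE_I[where N = "{t}"]) (auto split: split_indicator)
  finally show ?thesis by (simp add: mult_2)
qed

lemma std_normal_density_has_derivative:
  "(std_normal_density has_real_derivative (- x * std_normal_density x)) (at x)"
  unfolding std_normal_density_def[abs_def]
  by (auto intro!: derivative_eq_intros simp: field_simps)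

text \<open>One half of Mills' ratio: with r the density, enlarging the integrand by the factor 1 +
  1/x^2 gives it the explicit antiderivative -r(x)/x.\<close>

lemma normal_tail_upper:
  assumes "t > 0"
  shows "normal_tail t \<le> 2 * std_normal_density t / t"
proof -
  let ?r = std_normal_density
  have "(\<integral>\<^sup>+x. ennreal (?r x) * indicator {t..} x \<partial>lborel) \<le> (\<integral>\<^sup>+x. ennreal (?r x * (1 + 1 / x\<^sup>2)) * indicator {t..} x \<partial>lborel)"
    using assms by (intro nn_integral_mono) (auto split: split_indicator intro!: ennreal_leI simp: field_simps)
  also have "\<dots> = ennreal (0 - (- ?r t / t))"
  proof (rule nn_integral_FTC_atLeast)
    show "((\<lambda>x. - ?r x / x) \<longlongrightarrow> 0) at_top" unfolding std_normal_density_def by real_asymp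
    fix x assume "t \<le> x"
    then show "((\<lambda>x. - ?r x / x) has_real_derivative ?r x * (1 + 1 / x\<^sup>2)) (at x)"
      using assms by (auto intro!: derivative_eq_intros std_normal_density_has_derivative simp: field_simps power2_eq_square)
  qed (auto intro!: mult_nonneg_nonneg)
  finally have "ennreal (normal_tail t) \<le> 2 * ennreal (?r t / t)"
    unfolding normal_tail_eq[OF less_imp_le[OF assms]] by (intro mult_left_mono) auto
  also have "\<dots> = ennreal (2 * ?r t / t)" using assms
    by (simp add: ennreal_mult'[symmetric] flip: ennreal_numeral)
  finally show ?thesis using assms by (subst (asm) ennreal_le_iff) auto
qed

text \<open>The other half: damping the density by 1 - 3/x^4 yields the antiderivative -r(x)(1/x -
  1/x^3). From 2 on the damped integrand is nonnegative.\<close>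

lemma normal_tail_lower:
  assumes "t \<ge> 2"
  shows "normal_tail t \<ge> 2 * std_normal_density t * (1 / t - 1 / t ^ 3)"
proof -
  let ?r = std_normal_density
  have p4: "x ^ 4 \<ge> 16" if "t \<le> x" for x using power_mono[of 2 x 4] assms that by simp
  have "ennreal (0 - (- ?r t * (1 / t - 1 / t ^ 3))) = (\<integral>\<^sup>+x. ennreal (?r x * (1 - 3 / x ^ 4)) * indicator {t..} x \<partial>lborel)"
  proof (rule nn_integral_FTC_atLeast[symmetric])
    show "((\<lambda>x. - ?r x * (1 / x - 1 / x ^ 3)) \<longlongrightarrow> 0) at_top" unfolding std_normal_density_def by real_asymp
    fix x assume x: "t \<le> x"
    then show "((\<lambda>x. - ?r x * (1 / x - 1 / x ^ 3)) has_real_derivative ?r x * (1 - 3 / x ^ 4)) (at x)"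
      using assms by (auto intro!: derivative_eq_intros std_normal_density_has_derivative simp: field_simps eval_nat_numeral)
    show "0 \<le> ?r x * (1 - 3 / x ^ 4)" using p4[OF x] by (intro mult_nonneg_nonneg) (auto simp: divide_le_eq)
  qed measurable
  also have "\<dots> \<le> (\<integral>\<^sup>+x. ennreal (?r x) * indicator {t..} x \<partial>lborel)"
    using assms by (intro nn_integral_mono) (auto split: split_indicator intro!: ennreal_leI simp: field_simps mult_left_le)
  finally have "2 * ennreal (?r t * (1 / t - 1 / t ^ 3)) \<le> ennreal (normal_tail t)"
    using assms by (subst normal_tail_eq) (auto intro!: mult_left_mono)
  moreover have "2 * ennreal (?r t * (1 / t - 1 / t ^ 3)) = ennreal (2 * ?r t * (1 / t - 1 / t ^ 3))"
    by (simp add: ennreal_mult' mult.assoc flip: ennreal_numeral)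
  ultimately show ?thesis by (simp add: normal_tail_nonneg)
qed

text \<open>The factor 2 of the two-sided tail is absorbed by sqrt(2 pi) \<ge> 2.\<close>

lemma normal_tail_le_exp:
  assumes "t \<ge> 1"
  shows "normal_tail t \<le> exp (- t\<^sup>2 / 2)"
proof -
  have "2 \<le> sqrt (2 * pi)" using pi_gt3 by (intro real_le_rsqrt) auto
  then have "std_normal_density t \<le> exp (- t\<^sup>2 / 2) / 2"
    unfolding std_normal_density_def by (simp add: field_simps mult_left_mono)
  moreover have "2 * std_normal_density t / t \<le> 2 * std_normal_density t"
    using assms mult_right_mono[of 1 t "std_normal_density t"] by (simp add: field_simps)
  ultimately show ?thesis using normal_tail_upper[of t] assms by linarith
qed

section \<open>Maxima of weakly correlated Gaussian variables\<close>

text \<open>\<open>N\<close> is the number of variables, \<open>b\<close> the Bessel bound, \<open>\<rho>\<close> bounds all correlations, \<open>\<tau>\<close> separates weak from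
  strong correlation, and \<open>\<Lambda>\<close> is the level at which the split variable is truncated.\<close>

definition decoupling_error :: "real \<Rightarrow> real \<Rightarrow> real \<Rightarrow> real \<Rightarrow> real \<Rightarrow> real \<Rightarrow> real" where
  "decoupling_error N b \<rho> \<tau> \<Lambda> T =
     2 * normal_tail \<Lambda> + 2 * (normal_tail T * (N * (4 * (\<tau> * \<Lambda>) * exp (- (T - \<tau> * \<Lambda>)\<^sup>2 / 2))))
     + b / \<tau>\<^sup>2 * (2 * exp (- T\<^sup>2 / (1 + \<rho>)) + (normal_tail T)\<^sup>2)"

locale std_normal_family = prob_space M for M :: "'a measure" +
  fixes e :: "'i \<Rightarrow> 'a \<Rightarrow> real" and K :: "'i set"
  assumes finite_K: "finite K"
    and indep_e: "indep_vars (\<lambda>_. borel) e K"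
    and normal_e: "\<And>k. k \<in> K \<Longrightarrow> distributed M lborel (e k) std_normal_density"
begin

definition lin :: "('i \<Rightarrow> real) \<Rightarrow> 'a \<Rightarrow> real" where
  "lin v x = (\<Sum>k\<in>K. v k * e k x)"

definition ip :: "('i \<Rightarrow> real) \<Rightarrow> ('i \<Rightarrow> real) \<Rightarrow> real" where
  "ip v w = (\<Sum>k\<in>K. v k * w k)"

lemma e_measurable [measurable]: "k \<in> K \<Longrightarrow> e k \<in> borel_measurable M"
  using distributed_measurable[OF normal_e] by simp

lemma lin_measurable [measurable]: "lin v \<in> borel_measurable M"
  unfolding lin_def[abs_def] by measurable

lemma lin_normal:
  assumes "ip v v > 0"
  shows "distributed M lborel (lin v) (normal_density 0 (sqrt (ip v v)))"
  using linear_combination_normal[OF finite_K indep_e normal_e, of v] assms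
  unfolding lin_def[abs_def] ip_def by (simp add: power2_eq_square)

lemma prob_lin_gt:
  assumes "ip v v > 0"
  shows "prob {x \<in> space M. \<bar>lin v x\<bar> > t} = normal_tail (t / sqrt (ip v v))"
  using prob_abs_normal_gt[OF lin_normal[OF assms]] assms by simp

text \<open>If both variables exceed \<open>T\<close> in modulus, then their sum or their difference
  exceeds \<open>2 * T\<close>. Either has variance at most 2 + 2 \<rho>, and (2 T)^2 / (2 (2 + 2
  \<rho>)) = T^2 / (1 + \<rho>).\<close>

lemma prob_joint_tail:
  assumes v: "ip v v = 1" and w: "ip w w = 1" and r: "\<bar>ip v w\<bar> \<le> \<rho>" and \<rho>: "\<rho> < 1" and T: "T \<ge> 1"
  shows "prob {x \<in> space M. \<bar>lin v x\<bar> > T \<and> \<bar>lin w x\<bar> > T} \<le> 2 * exp (- T\<^sup>2 / (1 + \<rho>))"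
proof -
  \<comment> \<open>Here \<open>c\<close> is 1 for the sum and -1 for the difference.\<close>
  have step: "prob {x \<in> space M. \<bar>lin (\<lambda>k. v k + c * w k) x\<bar> > 2 * T} \<le> exp (- T\<^sup>2 / (1 + \<rho>))"
    if c: "c * c = 1" for c
  proof -
    let ?u = "\<lambda>k. v k + c * w k"
    have cw: "c = 1 \<or> c = -1" using c square_eq_1_iff by auto
    have u: "ip ?u ?u = 2 + 2 * c * ip v w"
    proof -
      have "ip ?u ?u = ip v v + (c * c) * ip w w + 2 * c * ip v w"
        unfolding ip_def by (simp add: algebra_simps sum.distrib sum_distrib_left)
      then show ?thesis using v w c by simp
    qed
    have up: "0 < ip ?u ?u" and u4: "ip ?u ?u \<le> 2 + 2 * \<rho>" using r \<rho> cw unfolding u by auto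
    then have s2: "sqrt (ip ?u ?u) \<le> 2" using \<rho> by (intro real_le_lsqrt) auto
    have "prob {x \<in> space M. \<bar>lin ?u x\<bar> > 2 * T} = normal_tail (2 * T / sqrt (ip ?u ?u))"
      by (rule prob_lin_gt) (rule up)
    also have "\<dots> \<le> exp (- (2 * T / sqrt (ip ?u ?u))\<^sup>2 / 2)"
    proof (rule normal_tail_le_exp)
      \<comment> \<open>The standardized level has to be at least 1 for the exponential tail
        bound.\<close>
      have "sqrt (ip ?u ?u) \<le> 2 * T" using s2 T by linarith
      then show "1 \<le> 2 * T / sqrt (ip ?u ?u)" using up by (simp add: le_divide_eq)
    qed
    also have "- (2 * T / sqrt (ip ?u ?u))\<^sup>2 / 2 = - (2 * T\<^sup>2 / ip ?u ?u)"
      using up by (simp add: power_divide power_mult_distrib)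
    also have "exp (- (2 * T\<^sup>2 / ip ?u ?u)) \<le> exp (- T\<^sup>2 / (1 + \<rho>))"
    proof -
      have "2 * T\<^sup>2 / (2 + 2 * \<rho>) \<le> 2 * T\<^sup>2 / ip ?u ?u"
        using up u4 by (intro divide_left_mono) auto
      moreover have "2 * T\<^sup>2 / (2 + 2 * \<rho>) = T\<^sup>2 / (1 + \<rho>)" using up u4 by (simp add: field_simps)
      ultimately show ?thesis by simp
    qed
    finally show ?thesis .
  qed
  have lin_add: "lin (\<lambda>k. v k + c * w k) x = lin v x + c * lin w x" for c x
    unfolding lin_def by (simp add: algebra_simps sum.distrib sum_distrib_left)
  have "prob {x \<in> space M. \<bar>lin v x\<bar> > T \<and> \<bar>lin w x\<bar> > T} \<le>
    prob ({x \<in> space M. \<bar>lin (\<lambda>k. v k + 1 * w k) x\<bar> > 2 * T} \<union> {x \<in> space M. \<bar>lin (\<lambda>k. v k + (-1) * w k) x\<bar> > 2 * T})"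
    unfolding lin_add by (rule finite_measure_mono) (auto simp: abs_if split: if_splits)
  also have "\<dots> \<le> prob {x \<in> space M. \<bar>lin (\<lambda>k. v k + 1 * w k) x\<bar> > 2 * T} + prob {x \<in> space M. \<bar>lin (\<lambda>k. v k + (-1) * w k) x\<bar> > 2 * T}"
    by (rule measure_Un_le) measurable
  also have "\<dots> \<le> exp (- T\<^sup>2 / (1 + \<rho>)) + exp (- T\<^sup>2 / (1 + \<rho>))" by (intro add_mono step) auto
  finally show ?thesis by simp
qed

text \<open>The residual has variance between 3/4 and 1. The lower bound makes the normalizing
  factor of its density at most 1, the upper bound makes the exponential at most that of variance 1,
  and the two intervals of the band have total length 4 s.\<close>

lemma prob_residual_band:
  assumes v: "ip v v = 1" and w: "ip w w = 1" and r: "\<bar>ip v w\<bar> \<le> 1/2" and s: "0 \<le> s" "s \<le> T"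
  shows "prob {x \<in> space M. T - s \<le> \<bar>lin (\<lambda>k. w k - ip v w * v k) x\<bar> \<and> \<bar>lin (\<lambda>k. w k - ip v w * v k) x\<bar> \<le> T + s}
    \<le> 4 * s * exp (- (T - s)\<^sup>2 / 2)"
proof -
  let ?r = "ip v w"
  let ?u = "\<lambda>k. w k - ?r * v k"
  let ?B = "{x :: real. T - s \<le> \<bar>x\<bar> \<and> \<bar>x\<bar> \<le> T + s}"
  have u: "ip ?u ?u = 1 - ?r\<^sup>2"
  proof -
    have "ip (\<lambda>k. w k - t * v k) (\<lambda>k. w k - t * v k) = ip w w + t * t * ip v v - 2 * t * ip v w" for t
      unfolding ip_def by (simp add: algebra_simps sum.distrib sum_subtractf sum_distrib_left)
    from this[of ?r] show ?thesis using v w by (simp add: power2_eq_square)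
  qed
  have r2: "?r\<^sup>2 \<le> 1/4" using power_mono[OF r, of 2] by (simp add: power2_eq_square)
  have up: "ip ?u ?u > 0" "ip ?u ?u \<le> 1" "ip ?u ?u \<ge> 3/4" using r2 unfolding u by auto
  let ?d = "normal_density 0 (sqrt (ip ?u ?u))"
  have B: "?B \<in> sets borel" by measurable
  have "prob {x \<in> space M. lin ?u x \<in> ?B} = (LINT x:?B|lborel. ?d x)"
    using lin_normal[OF up(1)] up(1) B by (intro prob_normal_in) auto
  also have "\<dots> \<le> (LINT x:({T - s..T + s} \<union> {-(T + s)..-(T - s)})|lborel. exp (- (T - s)\<^sup>2 / 2))"
    unfolding set_lebesgue_integral_def
  proof (rule integral_mono)
    have "?B \<subseteq> {T - s..T + s} \<union> {-(T + s)..-(T - s)}" by auto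
    show "integrable lborel (\<lambda>x. indicator ({T - s..T + s} \<union> {-(T + s)..-(T - s)}) x *\<^sub>R exp (- (T - s)\<^sup>2 / 2))"
      by (intro integrable_scaleR_left impI integrable_real_indicator) 
         (auto intro!: le_less_trans[OF emeasure_subadditive] simp: emeasure_lborel_Icc_eq)
    show "integrable lborel (\<lambda>x. indicator ?B x *\<^sub>R ?d x)"
      using B up by (intro integrable_mult_indicator integrable_normal_density) auto
    fix x
    have "?d x \<le> exp (- (T - s)\<^sup>2 / 2)" if x: "T - s \<le> \<bar>x\<bar>"
    proof -
      have "1 \<le> 2 * pi * ip ?u ?u" using pi_gt3 up mult_mono[of 3 "pi" "3/4" "ip ?u ?u"] by auto
      then have "1 / sqrt (2 * pi * ip ?u ?u) \<le> 1" by simp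
      moreover have "exp (- x\<^sup>2 / (2 * ip ?u ?u)) \<le> exp (- (T - s)\<^sup>2 / 2)"
      proof -
        have "(T - s)\<^sup>2 \<le> x\<^sup>2" using x s abs_le_square_iff[of "T - s" x] by simp
        also have "x\<^sup>2 \<le> x\<^sup>2 / ip ?u ?u" using up mult_right_mono[of "ip ?u ?u" 1 "x\<^sup>2"] by (simp add: le_divide_eq mult.commute)
        finally have "(T - s)\<^sup>2 / 2 \<le> x\<^sup>2 / ip ?u ?u / 2" by simp
        then show ?thesis by (simp add: mult.commute)
      qed
      ultimately show ?thesis unfolding normal_density_def 
        using up mult_mono[of "1 / sqrt (2 * pi * ip ?u ?u)" 1 "exp (- x\<^sup>2 / (2 * ip ?u ?u))" "exp (- (T - s)\<^sup>2 / 2)"] by simp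
    qed
    then show "indicator ?B x *\<^sub>R ?d x \<le> indicator ({T - s..T + s} \<union> {-(T + s)..-(T - s)}) x *\<^sub>R exp (- (T - s)\<^sup>2 / 2)"
      by (auto split: split_indicator)
  qed
  also have "\<dots> = measure lborel ({T - s..T + s} \<union> {-(T + s)..-(T - s)}) * exp (- (T - s)\<^sup>2 / 2)"
    unfolding set_lebesgue_integral_def by simp
  also have "\<dots> \<le> 4 * s * exp (- (T - s)\<^sup>2 / 2)"
  proof (rule mult_right_mono)
    have "measure lborel ({T - s..T + s} \<union> {-(T + s)..-(T - s)}) \<le> measure lborel {T - s..T + s} + measure lborel {-(T + s)..-(T - s)}"
      by (rule measure_subadditive) (auto simp: emeasure_lborel_Icc_eq)
    then show "measure lborel ({T - s..T + s} \<union> {-(T + s)..-(T - s)}) \<le> 4 * s" using s by simp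
  qed simp
  finally show ?thesis by simp
qed

text \<open>While |lin v| \<le> \<Lambda>, passing from a variable to its residual moves it by at
  most s = \<tau> \<Lambda>, so the comparison with \<open>T\<close> can change its truth value only
  if some residual lies in the band. The band event \<open>N\<close> is determined by the residuals,
  hence \<open>A \<inter> N\<close> has probability p P(N); this factor p keeps the error small
  after summation over all variables.\<close>

lemma decoupling_small:
  assumes v: "ip v v = 1" and S: "finite S" and w: "\<And>l. l \<in> S \<Longrightarrow> ip (w l) (w l) = 1"
    and r: "\<And>l. l \<in> S \<Longrightarrow> \<bar>ip v (w l)\<bar> \<le> \<tau>" and \<tau>: "0 < \<tau>" "\<tau> \<le> 1/2" and \<Lambda>: "\<Lambda> > 0" and T: "\<tau> * \<Lambda> \<le> T"
  shows "\<bar>prob {x \<in> space M. \<bar>lin v x\<bar> > T \<and> (\<forall>l\<in>S. \<bar>lin (w l) x\<bar> \<le> T)} -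
      normal_tail T * prob {x \<in> space M. \<forall>l\<in>S. \<bar>lin (w l) x\<bar> \<le> T}\<bar>
     \<le> 2 * normal_tail \<Lambda> + 2 * (normal_tail T * (real (card S) * (4 * (\<tau> * \<Lambda>) * exp (- (T - \<tau> * \<Lambda>)\<^sup>2 / 2))))"
proof -
  define s where "s = \<tau> * \<Lambda>"
  have s: "0 \<le> s" "s \<le> T" using \<tau> \<Lambda> T by (auto simp: s_def)
  define U where "U l x = lin (\<lambda>k. w l k - ip v (w l) * v k) x" for l x
  have U: "U l x = lin (w l) x - ip v (w l) * lin v x" for l x
    unfolding U_def lin_def by (simp add: algebra_simps sum_subtractf sum_distrib_left)
  have Um [measurable]: "U l \<in> borel_measurable M" for l unfolding U_def[abs_def] by measurable
  define p where "p = normal_tail T"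
  define N where "N = {x \<in> space M. \<exists>l\<in>S. T - s \<le> \<bar>U l x\<bar> \<and> \<bar>U l x\<bar> \<le> T + s}"
  define A where "A = {x \<in> space M. \<bar>lin v x\<bar> > T}"
  define B where "B = {x \<in> space M. \<forall>l\<in>S. \<bar>lin (w l) x\<bar> \<le> T}"
  define C where "C = {x \<in> space M. \<forall>l\<in>S. \<bar>U l x\<bar> \<le> T}"
  define D where "D = {x \<in> space M. \<bar>lin v x\<bar> > \<Lambda>}"
  have [measurable]: "N \<in> events" "A \<in> events" "B \<in> events" "C \<in> events" "D \<in> events"
    unfolding N_def A_def B_def C_def D_def using S by measurable
  have pA: "prob A = p" and pD: "prob D = normal_tail \<Lambda>"
    unfolding A_def D_def p_def using prob_lin_gt[of v] v by simp_all
  have p: "0 \<le> p" "p \<le> 1" using pA by (auto simp flip: pA)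
  let ?q = "real (card S) * (4 * s * exp (- (T - s)\<^sup>2 / 2))"
  have pN: "prob N \<le> ?q"
  proof -
    have "prob N = prob (\<Union>l\<in>S. {x \<in> space M. T - s \<le> \<bar>U l x\<bar> \<and> \<bar>U l x\<bar> \<le> T + s})"
      unfolding N_def by (rule arg_cong[where f = prob]) auto
    also have "\<dots> \<le> (\<Sum>l\<in>S. prob {x \<in> space M. T - s \<le> \<bar>U l x\<bar> \<and> \<bar>U l x\<bar> \<le> T + s})"
      using S by (intro finite_measure_subadditive_finite) auto
    also have "\<dots> \<le> (\<Sum>l\<in>S. 4 * s * exp (- (T - s)\<^sup>2 / 2))"
      unfolding U_def using v w s order_trans[OF r \<tau>(2)] by (intro sum_mono prob_residual_band) auto
    finally show ?thesis by simp
  qed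
  have BC: "x \<in> B \<longleftrightarrow> x \<in> C" if "x \<in> space M" "x \<notin> D" "x \<notin> N" for x
  proof -
    have "\<bar>lin (w l) x\<bar> \<le> T \<longleftrightarrow> \<bar>U l x\<bar> \<le> T" if l: "l \<in> S" for l
    proof -
      have "\<bar>ip v (w l) * lin v x\<bar> \<le> s" unfolding s_def abs_mult
        using \<open>x \<notin> D\<close> \<open>x \<in> space M\<close> r[OF l] \<tau> by (intro mult_mono) (auto simp: D_def)
      moreover have "\<not> (T - s \<le> \<bar>U l x\<bar> \<and> \<bar>U l x\<bar> \<le> T + s)" using \<open>x \<notin> N\<close> \<open>x \<in> space M\<close> l by (auto simp: N_def)
      ultimately show ?thesis unfolding U by linarith
    qed
    then show ?thesis using that by (auto simp: B_def C_def)
  qed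
  have indep: "prob {x \<in> space M. lin v x \<in> {t. \<bar>t\<bar> > T} \<and> (\<lambda>k\<in>K. e k x - v k * lin v x) \<in> H} =
      p * prob {x \<in> space M. (\<lambda>k\<in>K. e k x - v k * lin v x) \<in> H}" if H: "H \<in> sets (PiM K (\<lambda>_. borel))" for H
  proof -
    have "(\<Sum>k\<in>K. (v k)\<^sup>2) = 1" using v by (simp add: ip_def power2_eq_square)
    from normal_projection_indep[OF finite_K indep_e normal_e this]
    have "indep_rv borel (lin v) (PiM K (\<lambda>_. borel)) (\<lambda>x. \<lambda>k\<in>K. e k x - v k * lin v x)"
      by (simp add: lin_def[abs_def])
    from indep_rv_prob[OF this _ H, of "{t. \<bar>t\<bar> > T}"] show ?thesis
      using pA by (simp add: A_def)
  qed
  \<comment> \<open>Every \<open>U l\<close> is a linear function of the projected noise vector,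
    which is independent of \<open>lin v\<close>; so the events \<open>C\<close> and
    \<open>N\<close> factorize with \<open>A\<close>.\<close>
  have UE: "U l x = (\<Sum>k\<in>K. w l k * (\<lambda>k\<in>K. e k x - v k * lin v x) k)" for l x
  proof -
    have "(\<Sum>k\<in>K. w l k * (\<lambda>k\<in>K. e k x - v k * lin v x) k) = (\<Sum>k\<in>K. w l k * e k x - (v k * w l k) * lin v x)"
      by (intro sum.cong) (auto simp: algebra_simps)
    also have "\<dots> = U l x" unfolding U by (simp add: sum_subtractf lin_def ip_def sum_distrib_right)
    finally show ?thesis by simp
  qed
  let ?P = "PiM K (\<lambda>_. borel :: real measure)"
  have split: "prob (A \<inter> Z) = p * prob Z"
    if Z: "\<And>x. x \<in> Z \<longleftrightarrow> x \<in> space M \<and> (\<lambda>k\<in>K. e k x - v k * lin v x) \<in> H" and H: "H \<in> sets ?P" for Z H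
  proof -
    have "A \<inter> Z = {x \<in> space M. lin v x \<in> {t. \<bar>t\<bar> > T} \<and> (\<lambda>k\<in>K. e k x - v k * lin v x) \<in> H}"
      using Z by (auto simp: A_def)
    moreover have "Z = {x \<in> space M. (\<lambda>k\<in>K. e k x - v k * lin v x) \<in> H}" using Z by auto
    ultimately show ?thesis using indep[OF H] by (simp only:)
  qed
  have pAC: "prob (A \<inter> C) = p * prob C"
  proof (rule split)
    show "x \<in> C \<longleftrightarrow> x \<in> space M \<and> (\<lambda>k\<in>K. e k x - v k * lin v x) \<in> {g \<in> space ?P. \<forall>l\<in>S. \<bar>\<Sum>k\<in>K. w l k * g k\<bar> \<le> T}" for x
      unfolding C_def UE by (auto simp: space_PiM)
  qed (use S in measurable)
  have pAN: "prob (A \<inter> N) = p * prob N"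
  proof (rule split)
    show "x \<in> N \<longleftrightarrow> x \<in> space M \<and> (\<lambda>k\<in>K. e k x - v k * lin v x) \<in>
        {g \<in> space ?P. \<exists>l\<in>S. T - s \<le> \<bar>\<Sum>k\<in>K. w l k * g k\<bar> \<and> \<bar>\<Sum>k\<in>K. w l k * g k\<bar> \<le> T + s}" for x
      unfolding N_def UE by (auto simp: space_PiM)
  qed (use S in measurable)
  have sub3: "prob E \<le> prob F + prob D + prob G" if "E \<subseteq> F \<union> D \<union> G" "F \<in> events" "G \<in> events" for E F G
  proof -
    have "prob E \<le> prob (F \<union> D \<union> G)" using that by (intro finite_measure_mono) auto
    also have "\<dots> \<le> prob (F \<union> D) + prob G" using that by (intro measure_Un_le) auto
    also have "\<dots> \<le> prob F + prob D + prob G" using that by (intro add_right_mono measure_Un_le) auto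
    finally show ?thesis .
  qed
  have sp: "A \<subseteq> space M" "B \<subseteq> space M" "C \<subseteq> space M" by (auto simp: A_def B_def C_def)
  \<comment> \<open>The comparison runs from \<open>A \<inter> B\<close> to
    \<open>A \<inter> C\<close>, factorizes there, and returns from \<open>C\<close> to
    \<open>B\<close>.\<close>
  have "prob (A \<inter> B) \<le> prob (A \<inter> C) + prob D + prob (A \<inter> N)" by (rule sub3) (use sp BC in auto)
  moreover have "prob (A \<inter> C) \<le> prob (A \<inter> B) + prob D + prob (A \<inter> N)" by (rule sub3) (use sp BC in auto)
  moreover have "prob B \<le> prob C + prob D + prob N" by (rule sub3) (use sp BC in auto)
  moreover have "prob C \<le> prob B + prob D + prob N" by (rule sub3) (use sp BC in auto)
  ultimately have 1: "\<bar>prob (A \<inter> B) - p * prob C\<bar> \<le> prob D + p * prob N" and 2: "\<bar>prob C - prob B\<bar> \<le> prob D + prob N"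
    unfolding pAC pAN by linarith+
  have "\<bar>p * prob C - p * prob B\<bar> = p * \<bar>prob C - prob B\<bar>" using p by (simp add: abs_mult right_diff_distrib[symmetric])
  also have "\<dots> \<le> p * (prob D + prob N)" using 2 p by (intro mult_left_mono) auto
  also have "\<dots> \<le> prob D + p * prob N" using p mult_right_mono[of p 1 "prob D"] by (simp add: algebra_simps)
  finally have "\<bar>prob (A \<inter> B) - p * prob B\<bar> \<le> 2 * prob D + 2 * (p * prob N)" using 1 by linarith
  also have "\<dots> \<le> 2 * normal_tail \<Lambda> + 2 * (p * ?q)" unfolding pD using pN p by (intro add_left_mono mult_left_mono) auto
  moreover have "A \<inter> B = {x \<in> space M. \<bar>lin v x\<bar> > T \<and> (\<forall>l\<in>S. \<bar>lin (w l) x\<bar> \<le> T)}" by (auto simp: A_def B_def)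
  ultimately show ?thesis by (simp add: p_def B_def s_def)
qed


text \<open>The strongly correlated indices \<open>L\<close> are removed from both events and put
  back. On the side with \<open>A\<close> each costs a joint tail; on the product side each costs p,
  multiplied by the outer p. The Bessel bound limits their number to b / \<tau>^2, and the remaining
  indices fall under the weakly correlated case.\<close>

lemma decoupling:
  assumes v: "ip v v = 1" and S: "finite S" and w: "\<And>l. l \<in> S \<Longrightarrow> ip (w l) (w l) = 1"
    and r: "\<And>l. l \<in> S \<Longrightarrow> \<bar>ip v (w l)\<bar> \<le> \<rho>" and \<rho>: "\<rho> < 1" and bessel: "(\<Sum>l\<in>S. (ip v (w l))\<^sup>2) \<le> b"
    and \<tau>: "0 < \<tau>" "\<tau> \<le> 1/2" and \<Lambda>: "\<Lambda> > 0" and T: "\<tau> * \<Lambda> \<le> T" "1 \<le> T"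
  shows "\<bar>prob {x \<in> space M. \<bar>lin v x\<bar> > T \<and> (\<forall>l\<in>S. \<bar>lin (w l) x\<bar> \<le> T)} -
      normal_tail T * prob {x \<in> space M. \<forall>l\<in>S. \<bar>lin (w l) x\<bar> \<le> T}\<bar>
     \<le> decoupling_error (card S) b \<rho> \<tau> \<Lambda> T"
proof -
  define p where "p = normal_tail T"
  define L where "L = {l \<in> S. \<bar>ip v (w l)\<bar> > \<tau>}"
  define R where "R = {l \<in> S. \<bar>ip v (w l)\<bar> \<le> \<tau>}"
  have fin: "finite L" "finite R" using S by (auto simp: L_def R_def)
  have S_eq: "S = R \<union> L" by (auto simp: L_def R_def)
  have "real (card L) * \<tau>\<^sup>2 = (\<Sum>l\<in>L. \<tau>\<^sup>2)" by simp
  also have "\<dots> \<le> (\<Sum>l\<in>L. (ip v (w l))\<^sup>2)"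
    using \<tau> power_mono[of \<tau> "\<bar>ip v (w l)\<bar>" 2 for l] by (intro sum_mono) (auto simp: L_def)
  also have "\<dots> \<le> b" using S bessel by (intro order_trans[OF sum_mono2 bessel]) (auto simp: L_def)
  finally have cL: "real (card L) \<le> b / \<tau>\<^sup>2" using \<tau> by (simp add: le_divide_eq)
  define A where "A = {x \<in> space M. \<bar>lin v x\<bar> > T}"
  define B where "B = {x \<in> space M. \<forall>l\<in>R. \<bar>lin (w l) x\<bar> \<le> T}"
  define D where "D = {x \<in> space M. \<forall>l\<in>L. \<bar>lin (w l) x\<bar> \<le> T}"
  define F where "F l = {x \<in> space M. \<bar>lin (w l) x\<bar> > T}" for l
  have evs [measurable]: "A \<in> events" "B \<in> events" "D \<in> events" "F l \<in> events" for l
    unfolding A_def B_def D_def F_def using fin by measurable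
  have pA: "prob A = p" unfolding A_def p_def using prob_lin_gt[of v] v by simp
  have pF: "prob (F l) = p" if "l \<in> L" for l unfolding F_def p_def using prob_lin_gt[of "w l"] w that by (simp add: L_def)
  have p0: "0 \<le> p" using pA by (auto simp flip: pA)
  have c1: "prob (A \<inter> B) - prob (A \<inter> (B \<inter> D)) \<le> real (card L) * (2 * exp (- T\<^sup>2 / (1 + \<rho>)))"
  proof -
    have AF1: "(\<Union>l\<in>L. A \<inter> F l) \<in> events" by (intro sets.finite_UN fin sets.Int evs)
    have AF2: "A \<inter> (B \<inter> D) \<in> events" by (intro sets.Int evs)
    note AF = AF1 AF2
    have "prob (A \<inter> B) \<le> prob (A \<inter> (B \<inter> D) \<union> (\<Union>l\<in>L. A \<inter> F l))"
    proof (rule finite_measure_mono)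
      show "A \<inter> B \<subseteq> A \<inter> (B \<inter> D) \<union> (\<Union>l\<in>L. A \<inter> F l)"
      proof
        fix x assume x: "x \<in> A \<inter> B"
        then have "x \<in> space M" by (simp add: B_def)
        then have "x \<in> D \<or> (\<exists>l\<in>L. x \<in> F l)" by (auto simp: D_def F_def not_le)
        with x show "x \<in> A \<inter> (B \<inter> D) \<union> (\<Union>l\<in>L. A \<inter> F l)" by auto
      qed
    qed (intro sets.Un AF)
    also have "\<dots> \<le> prob (A \<inter> (B \<inter> D)) + prob (\<Union>l\<in>L. A \<inter> F l)"
      by (intro measure_Un_le AF)
    also have "prob (\<Union>l\<in>L. A \<inter> F l) \<le> (\<Sum>l\<in>L. prob (A \<inter> F l))"
      using fin by (intro finite_measure_subadditive_finite) auto
    also have "\<dots> \<le> (\<Sum>l\<in>L. 2 * exp (- T\<^sup>2 / (1 + \<rho>)))"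
    proof (rule sum_mono)
      fix l assume "l \<in> L"
      then have "prob {x \<in> space M. \<bar>lin v x\<bar> > T \<and> \<bar>lin (w l) x\<bar> > T} \<le> 2 * exp (- T\<^sup>2 / (1 + \<rho>))"
        using v w r \<rho> T by (intro prob_joint_tail) (auto simp: L_def)
      moreover have "A \<inter> F l = {x \<in> space M. \<bar>lin v x\<bar> > T \<and> \<bar>lin (w l) x\<bar> > T}" by (auto simp: A_def F_def)
      ultimately show "prob (A \<inter> F l) \<le> 2 * exp (- T\<^sup>2 / (1 + \<rho>))" by simp
    qed
    finally show ?thesis by simp
  qed
  have c2: "prob B - prob (B \<inter> D) \<le> real (card L) * p"
  proof -
    have BF1: "(\<Union>l\<in>L. F l) \<in> events" by (intro sets.finite_UN fin sets.Int evs)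
    have BF2: "B \<inter> D \<in> events" by (intro sets.Int evs)
    note BF = BF1 BF2
    have "prob B \<le> prob (B \<inter> D \<union> (\<Union>l\<in>L. F l))"
    proof (rule finite_measure_mono)
      show "B \<subseteq> B \<inter> D \<union> (\<Union>l\<in>L. F l)"
      proof
        fix x assume x: "x \<in> B"
        then have "x \<in> space M" by (simp add: B_def)
        then have "x \<in> D \<or> (\<exists>l\<in>L. x \<in> F l)" by (auto simp: D_def F_def not_le)
        with x show "x \<in> B \<inter> D \<union> (\<Union>l\<in>L. F l)" by auto
      qed
    qed (intro sets.Un BF)
    also have "\<dots> \<le> prob (B \<inter> D) + prob (\<Union>l\<in>L. F l)"
      by (intro measure_Un_le BF)
    also have "prob (\<Union>l\<in>L. F l) \<le> (\<Sum>l\<in>L. prob (F l))"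
      using fin by (intro finite_measure_subadditive_finite) auto
    also have "\<dots> = real (card L) * p" using pF by simp
    finally show ?thesis by simp
  qed
  have m: "prob (A \<inter> (B \<inter> D)) \<le> prob (A \<inter> B)" "prob (B \<inter> D) \<le> prob B"
    by (rule finite_measure_mono, blast, intro sets.Int evs)+
  have main: "\<bar>prob (A \<inter> B) - p * prob B\<bar> \<le> 2 * normal_tail \<Lambda> + 2 * (p * (real (card R) * (4 * (\<tau> * \<Lambda>) * exp (- (T - \<tau> * \<Lambda>)\<^sup>2 / 2))))"
  proof -
    have "A \<inter> B = {x \<in> space M. \<bar>lin v x\<bar> > T \<and> (\<forall>l\<in>R. \<bar>lin (w l) x\<bar> \<le> T)}" by (auto simp: A_def B_def)
    moreover have "\<bar>prob {x \<in> space M. \<bar>lin v x\<bar> > T \<and> (\<forall>l\<in>R. \<bar>lin (w l) x\<bar> \<le> T)} -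
      normal_tail T * prob {x \<in> space M. \<forall>l\<in>R. \<bar>lin (w l) x\<bar> \<le> T}\<bar>
     \<le> 2 * normal_tail \<Lambda> + 2 * (normal_tail T * (real (card R) * (4 * (\<tau> * \<Lambda>) * exp (- (T - \<tau> * \<Lambda>)\<^sup>2 / 2))))"
      by (rule decoupling_small[OF v fin(2) _ _ \<tau> \<Lambda> T(1)]) (use w in \<open>auto simp: R_def\<close>)
    ultimately show ?thesis unfolding p_def B_def by simp
  qed
  also have "\<dots> \<le> 2 * normal_tail \<Lambda> + 2 * (p * (real (card S) * (4 * (\<tau> * \<Lambda>) * exp (- (T - \<tau> * \<Lambda>)\<^sup>2 / 2))))"
    using p0 \<tau> \<Lambda> S by (intro add_left_mono mult_left_mono mult_right_mono) (auto intro!: card_mono simp: R_def)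
  finally have 1: "\<bar>prob (A \<inter> B) - p * prob B\<bar> \<le> \<dots>" .
  have 2: "p * prob (B \<inter> D) \<le> p * prob B" using m p0 by (intro mult_left_mono) auto
  have 3: "p * prob B - p * prob (B \<inter> D) \<le> real (card L) * p\<^sup>2"
    using mult_left_mono[OF c2 p0] by (simp add: algebra_simps power2_eq_square)
  have "real (card L) * (2 * exp (- T\<^sup>2 / (1 + \<rho>)) + p\<^sup>2) \<le> b / \<tau>\<^sup>2 * (2 * exp (- T\<^sup>2 / (1 + \<rho>)) + p\<^sup>2)"
    using cL by (intro mult_right_mono) auto
  then have 4: "real (card L) * (2 * exp (- T\<^sup>2 / (1 + \<rho>))) + real (card L) * p\<^sup>2 \<le> b / \<tau>\<^sup>2 * (2 * exp (- T\<^sup>2 / (1 + \<rho>)) + p\<^sup>2)"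
    by (simp add: distrib_left)
  have 5: "real (card L) * (2 * exp (- T\<^sup>2 / (1 + \<rho>))) \<ge> 0" "real (card L) * p\<^sup>2 \<ge> 0" by simp_all
  have "\<bar>prob (A \<inter> (B \<inter> D)) - p * prob (B \<inter> D)\<bar> \<le> 2 * normal_tail \<Lambda> + 2 * (p * (real (card S) * (4 * (\<tau> * \<Lambda>) * exp (- (T - \<tau> * \<Lambda>)\<^sup>2 / 2))))
      + b / \<tau>\<^sup>2 * (2 * exp (- T\<^sup>2 / (1 + \<rho>)) + p\<^sup>2)"
    using 1 2 3 4 5 c1 m(1) unfolding abs_le_iff by linarith
  moreover have "A \<inter> (B \<inter> D) = {x \<in> space M. \<bar>lin v x\<bar> > T \<and> (\<forall>l\<in>S. \<bar>lin (w l) x\<bar> \<le> T)}"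
    "B \<inter> D = {x \<in> space M. \<forall>l\<in>S. \<bar>lin (w l) x\<bar> \<le> T}"
    by (auto simp: A_def B_def D_def S_eq)
  ultimately show ?thesis by (simp only: p_def decoupling_error_def)
qed

text \<open>Adding one variable multiplies the distribution function by 1 - p up to the decoupling
  error. Since 0 \<le> 1 - p \<le> 1, earlier errors are not amplified and the total is at most
  their sum.\<close>

lemma maximum_comparison:
  assumes I: "finite I" and w: "\<And>i. i \<in> I \<Longrightarrow> ip (w i) (w i) = 1"
    and r: "\<And>i j. i \<in> I \<Longrightarrow> j \<in> I \<Longrightarrow> i \<noteq> j \<Longrightarrow> \<bar>ip (w i) (w j)\<bar> \<le> \<rho>" and \<rho>: "\<rho> < 1"
    and bessel: "\<And>i. i \<in> I \<Longrightarrow> (\<Sum>j\<in>I. (ip (w i) (w j))\<^sup>2) \<le> b"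
    and \<tau>: "0 < \<tau>" "\<tau> \<le> 1/2" and \<Lambda>: "\<Lambda> > 0" and T: "\<tau> * \<Lambda> \<le> T" "1 \<le> T"
  shows "\<bar>prob {x \<in> space M. \<forall>i\<in>I. \<bar>lin (w i) x\<bar> \<le> T} - (1 - normal_tail T) ^ card I\<bar>
     \<le> card I * decoupling_error (card I) b \<rho> \<tau> \<Lambda> T"
    (is "_ \<le> _ * ?E")
proof -
  define p where "p = normal_tail T"
  have p: "0 \<le> p" "p \<le> 1"
    using normal_tail_nonneg normal_tail_le_exp[OF T(2)] by (auto simp: p_def intro: order_trans)
  define B where "B S = {x \<in> space M. \<forall>i\<in>S. \<bar>lin (w i) x\<bar> \<le> T}" for S
  have "\<bar>prob (B S) - (1 - p) ^ card S\<bar> \<le> card S * ?E" if "finite S" "S \<subseteq> I" for S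
    using that
  proof (induction S)
    case empty
    then show ?case by (simp add: B_def prob_space)
  next
    case (insert i S)
    have [measurable]: "B S \<in> events" unfolding B_def using \<open>finite S\<close> by measurable
    define A where "A = {x \<in> space M. \<bar>lin (w i) x\<bar> > T}"
    have [measurable]: "A \<in> events" unfolding A_def by measurable
    have "B (insert i S) = B S - A \<inter> B S" by (auto simp: B_def A_def)
    then have e: "prob (B (insert i S)) = prob (B S) - prob (A \<inter> B S)"
      by (simp add: finite_measure_Diff)
    have AB: "A \<inter> B S = {x \<in> space M. \<bar>lin (w i) x\<bar> > T \<and> (\<forall>l\<in>S. \<bar>lin (w l) x\<bar> \<le> T)}"
      by (auto simp: A_def B_def)
    have i: "i \<in> I" and SI: "S \<subseteq> I" using insert by auto
    have bS: "(\<Sum>l\<in>S. (ip (w i) (w l))\<^sup>2) \<le> b"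
      by (rule order_trans[OF sum_mono2 bessel[OF i]]) (use I SI in auto)
    have "\<bar>prob (A \<inter> B S) - p * prob (B S)\<bar> \<le> decoupling_error (card S) b \<rho> \<tau> \<Lambda> T"
      unfolding AB unfolding p_def B_def
      by (rule decoupling) (use w i SI insert r \<rho> bS \<tau> \<Lambda> T in auto)
    also have "\<dots> \<le> ?E"
      using p \<tau> \<Lambda> I SI unfolding p_def decoupling_error_def
      by (intro add_right_mono add_left_mono mult_left_mono mult_right_mono) (auto intro!: card_mono)
    finally have 1: "\<bar>prob (A \<inter> B S) - p * prob (B S)\<bar> \<le> ?E" .
    have "prob (B (insert i S)) - (1 - p) ^ card (insert i S) =
       (1 - p) * (prob (B S) - (1 - p) ^ card S) - (prob (A \<inter> B S) - p * prob (B S))"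
      unfolding e using insert by (simp add: algebra_simps)
    also have "\<bar>\<dots>\<bar> \<le> (1 - p) * \<bar>prob (B S) - (1 - p) ^ card S\<bar> + \<bar>prob (A \<inter> B S) - p * prob (B S)\<bar>"
      using p by (intro order_trans[OF abs_triangle_ineq4]) (simp add: abs_mult)
    also have "\<dots> \<le> 1 * \<bar>prob (B S) - (1 - p) ^ card S\<bar> + ?E"
      using p 1 by (intro add_mono mult_right_mono) auto
    also have "\<dots> \<le> card S * ?E + ?E" using insert by auto
    also have "\<dots> = card (insert i S) * ?E" 
    proof -
      have "real (card S) * t + t = real (card (insert i S)) * t" for t
        using insert by (simp add: distrib_right)
      then show ?thesis .
    qed
    finally show ?case .
  qed
  from this[OF I] show ?thesis by (simp add: B_def p_def)
qed

end

section \<open>The Gumbel normalization\<close>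

text \<open>For \<open>L = ln n\<close> this is \<open>a(\<chi>,n) z + b(\<chi>,n)\<close>.\<close>

definition gumbel_level :: "real \<Rightarrow> real \<Rightarrow> real" where
  "gumbel_level z L = sqrt (2 * L) - (ln L + ln pi) / (2 * sqrt (2 * L)) + z / sqrt (2 * L)"

lemma gumbel_level_at_top: "filterlim (gumbel_level z) at_top at_top"
  unfolding gumbel_level_def by real_asymp

lemma gumbel_level_square:
  assumes "L > 0"
  shows "(gumbel_level z L)\<^sup>2 / 2 = L + z - (ln L + ln pi) / 2 + (z - (ln L + ln pi) / 2)\<^sup>2 / (4 * L)"
proof -
  define S where "S = sqrt (2 * L)"
  define A where "A = z - (ln L + ln pi) / 2"
  have S: "S > 0" "S\<^sup>2 = 2 * L" using assms by (auto simp: S_def)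
  have "gumbel_level z L = S + A / S"
    unfolding gumbel_level_def A_def S_def[symmetric] using S by (simp add: field_simps)
  then have "(gumbel_level z L)\<^sup>2 = S\<^sup>2 + 2 * A + A\<^sup>2 / S\<^sup>2"
    using S(1) by (simp add: power2_sum power_divide)
  then show ?thesis using S assms by (simp add: A_def field_simps)
qed

text \<open>With T the level this says T^2/2 = L - (ln L)/2 + z - (ln pi)/2 + o(1), because the
  remaining quadratic term is of order (ln L)^2 / L. The exponential estimates at this level rest on
  the expansion.\<close>

lemma gumbel_level_square_limit:
  "((\<lambda>L. L - (gumbel_level z L)\<^sup>2 / 2 - ln L / 2) \<longlongrightarrow> ln pi / 2 - z) at_top"
proof -
  have "((\<lambda>L. (c + ln L / 2)\<^sup>2 / (4 * L)) \<longlongrightarrow> 0) at_top" for c :: real by real_asymp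
  from tendsto_diff[OF tendsto_const this[of "ln pi / 2 - z"], of "ln pi / 2 - z"]
  have "((\<lambda>L. ln pi / 2 - z - (ln pi / 2 - z + ln L / 2)\<^sup>2 / (4 * L)) \<longlongrightarrow> ln pi / 2 - z) at_top"
    by simp
  moreover have "eventually (\<lambda>L. ln pi / 2 - z - (ln pi / 2 - z + ln L / 2)\<^sup>2 / (4 * L) =
      L - (gumbel_level z L)\<^sup>2 / 2 - ln L / 2) at_top"
    using eventually_gt_at_top[of 0]
  proof eventually_elim
    fix L :: real assume "L > 0"
    have "(ln pi / 2 - z + ln L / 2)\<^sup>2 = (z - (ln L + ln pi) / 2)\<^sup>2"
      by (simp add: power2_eq_square algebra_simps)
    then show "ln pi / 2 - z - (ln pi / 2 - z + ln L / 2)\<^sup>2 / (4 * L) = L - (gumbel_level z L)\<^sup>2 / 2 - ln L / 2"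
      unfolding gumbel_level_square[OF \<open>L > 0\<close>] by (simp add: field_simps)
  qed
  ultimately show ?thesis by (rule Lim_transform_eventually)
qed

text \<open>The logarithm of the expression is computed. The term ln T cancels the (ln L)/2 of the
  expansion of T^2/2, and the constants add up to -z. The factor 2 of the two-sided tail is the
  reason why \<open>b_chi\<close> contains ln pi instead of the ln(4 pi) known from one-sided
  maxima.\<close>

lemma mills_limit: "((\<lambda>L. exp L * (2 * std_normal_density (gumbel_level z L) / gumbel_level z L)) \<longlongrightarrow> exp (- z)) at_top"
proof -
  have 1: "((\<lambda>L. L + ln 2 - ln (sqrt (2 * pi)) - (gumbel_level z L)\<^sup>2 / 2 - ln (gumbel_level z L)) \<longlongrightarrow> - z) at_top"
  proof -
    note gumbel_level_square_limit[of z]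
    moreover have "((\<lambda>L. ln L / 2 - ln (gumbel_level z L)) \<longlongrightarrow> - ln 2 / 2) at_top"
      unfolding gumbel_level_def by real_asymp
    ultimately have "((\<lambda>L. (L - (gumbel_level z L)\<^sup>2 / 2 - ln L / 2) + (ln L / 2 - ln (gumbel_level z L)) + (ln 2 - ln (sqrt (2 * pi)))) \<longlongrightarrow>
      (ln pi / 2 - z) + (- ln 2 / 2) + (ln 2 - ln (sqrt (2 * pi)))) at_top"
      by (intro tendsto_add tendsto_const)
    moreover have "(ln pi / 2 - z) + (- ln 2 / 2) + (ln 2 - ln (sqrt (2 * pi))) = - z"
      by (simp add: ln_sqrt ln_mult add_divide_distrib)
    ultimately show ?thesis by (simp add: algebra_simps)
  qed
  have "eventually (\<lambda>L. gumbel_level z L > 0) at_top"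
    using gumbel_level_at_top filterlim_at_top_dense by blast
  then have "eventually (\<lambda>L. exp (L + ln 2 - ln (sqrt (2 * pi)) - (gumbel_level z L)\<^sup>2 / 2 - ln (gumbel_level z L)) =
     exp L * (2 * std_normal_density (gumbel_level z L) / gumbel_level z L)) at_top"
    unfolding exp_diff exp_add std_normal_density_def minus_divide_left[symmetric] exp_minus
    by eventually_elim (simp add: field_simps)
  with tendsto_exp[OF 1] show ?thesis by (blast intro: Lim_transform_eventually)
qed

text \<open>Both Mills bounds have the same leading term; they differ by the factor 1 - 1/T^2, which
  tends to 1.\<close>

lemma normal_tail_limit: "((\<lambda>L. exp L * normal_tail (gumbel_level z L)) \<longlongrightarrow> exp (- z)) at_top"
proof (rule tendsto_sandwich)
  have ge: "eventually (\<lambda>L. gumbel_level z L \<ge> 2) at_top"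
    using gumbel_level_at_top by (auto simp: filterlim_at_top)
  show "eventually (\<lambda>L. exp L * normal_tail (gumbel_level z L) \<le> exp L * (2 * std_normal_density (gumbel_level z L) / gumbel_level z L)) at_top"
    using ge by eventually_elim (intro mult_left_mono normal_tail_upper; simp)
  show "eventually (\<lambda>L. exp L * (2 * std_normal_density (gumbel_level z L) / gumbel_level z L) * (1 - 1 / (gumbel_level z L)\<^sup>2)
      \<le> exp L * normal_tail (gumbel_level z L)) at_top"
    using ge
  proof eventually_elim
    fix L assume g: "gumbel_level z L \<ge> 2"
    have "exp L * (2 * std_normal_density (gumbel_level z L) / gumbel_level z L) * (1 - 1 / (gumbel_level z L)\<^sup>2) =
       exp L * (2 * std_normal_density (gumbel_level z L) * (1 / gumbel_level z L - 1 / gumbel_level z L ^ 3))"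
      using g by (simp add: field_simps power2_eq_square power3_eq_cube)
    also have "\<dots> \<le> exp L * normal_tail (gumbel_level z L)"
      using normal_tail_lower[OF g] by (intro mult_left_mono) auto
    finally show "exp L * (2 * std_normal_density (gumbel_level z L) / gumbel_level z L) * (1 - 1 / (gumbel_level z L)\<^sup>2)
      \<le> exp L * normal_tail (gumbel_level z L)" .
  qed
  have "((\<lambda>L. 1 - 1 / (gumbel_level z L)\<^sup>2) \<longlongrightarrow> 1) at_top"
    unfolding gumbel_level_def by real_asymp
  from tendsto_mult[OF mills_limit this]
  show "((\<lambda>L. exp L * (2 * std_normal_density (gumbel_level z L) / gumbel_level z L) * (1 - 1 / (gumbel_level z L)\<^sup>2)) \<longlongrightarrow> exp (- z)) at_top"
    by simp
qed (rule mills_limit)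

text \<open>With n = exp L this is n times the error of one splitting. The level
  \<open>\<Lambda>\<close> is chosen so that its tail is at most n^(-2). The first upper bound on
  \<kappa> makes n^(1 + 2 \<kappa>) times a joint tail of order about n^(-2/(1 + \<rho>)) vanish;
  the bound 1/4 makes n^(-1 + 2 \<kappa>), the order of the term with p^2, vanish.\<close>

lemma comparison_error_limit:
  fixes z \<rho> \<kappa> b :: real
  assumes \<rho>: "0 < \<rho>" "\<rho> < 1" and \<kappa>: "0 < \<kappa>" "\<kappa> < (1 - \<rho>) / (2 * (1 + \<rho>))" "\<kappa> < 1/4"
  defines "T \<equiv> gumbel_level z"
  defines "\<tau> \<equiv> \<lambda>L. exp (- \<kappa> * L)"
  defines "\<Lambda> \<equiv> \<lambda>L. 2 * sqrt L"
  shows "((\<lambda>L. exp L * decoupling_error (exp L) b \<rho> (\<tau> L) (\<Lambda> L) (T L)) \<longlongrightarrow> 0) at_top"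
proof -
  have 1: "((\<lambda>L. exp L * normal_tail (\<Lambda> L)) \<longlongrightarrow> 0) at_top"
  proof (rule tendsto_sandwich[OF _ _ tendsto_const])
    show "eventually (\<lambda>L. 0 \<le> exp L * normal_tail (\<Lambda> L)) at_top"
      by (simp add: normal_tail_nonneg)
    show "eventually (\<lambda>L. exp L * normal_tail (\<Lambda> L) \<le> exp (- L)) at_top"
      using eventually_ge_at_top[of 1]
    proof eventually_elim
      fix L :: real assume "L \<ge> 1"
      then have "normal_tail (\<Lambda> L) \<le> exp (- (\<Lambda> L)\<^sup>2 / 2)" unfolding \<Lambda>_def 
        using real_sqrt_ge_one[OF \<open>L \<ge> 1\<close>] by (intro normal_tail_le_exp) linarith
      also have "\<dots> = exp (- 2 * L)" using \<open>L \<ge> 1\<close> by (simp add: \<Lambda>_def power_mult_distrib)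
      finally have "exp L * normal_tail (\<Lambda> L) \<le> exp L * exp (- 2 * L)" by simp
      then show "exp L * normal_tail (\<Lambda> L) \<le> exp (- L)" by (simp flip: exp_add)
    qed
    show "((\<lambda>L::real. exp (- L)) \<longlongrightarrow> 0) at_top" by real_asymp
  qed
  have p: "((\<lambda>L. exp L * normal_tail (T L)) \<longlongrightarrow> exp (- z)) at_top"
    unfolding T_def by (rule normal_tail_limit)
  have 2: "((\<lambda>L. exp L * (4 * (\<tau> L * \<Lambda> L) * exp (- (T L - \<tau> L * \<Lambda> L)\<^sup>2 / 2))) \<longlongrightarrow> 0) at_top"
  proof -
    \<comment> \<open>This is the logarithm of exp(L - (T - \<tau> \<Lambda>)^2 / 2) / sqrt(pi L).
      The shift by \<tau> \<Lambda> is exponentially small in \<open>L\<close> and does not affect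
      the limit.\<close>
    have "((\<lambda>L. ln L / 2 - (T L - \<tau> L * \<Lambda> L)\<^sup>2 / 2 + L - ln L - ln pi / 2) \<longlongrightarrow> - z) at_top"
    proof -
      have "((\<lambda>L. T L * (\<tau> L * \<Lambda> L)) \<longlongrightarrow> 0) at_top"
        unfolding T_def \<tau>_def \<Lambda>_def gumbel_level_def using \<kappa>(1) by real_asymp
      moreover have "((\<lambda>L. (\<tau> L * \<Lambda> L)\<^sup>2 / 2) \<longlongrightarrow> 0) at_top"
        unfolding \<tau>_def \<Lambda>_def using \<kappa>(1) by real_asymp
      ultimately have "((\<lambda>L. (L - (T L)\<^sup>2 / 2 - ln L / 2) + T L * (\<tau> L * \<Lambda> L) - (\<tau> L * \<Lambda> L)\<^sup>2 / 2 - ln pi / 2)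
          \<longlongrightarrow> (ln pi / 2 - z) + 0 - 0 - ln pi / 2) at_top"
        unfolding T_def by (intro tendsto_intros gumbel_level_square_limit)
      moreover have "(L - (T L)\<^sup>2 / 2 - ln L / 2) + T L * (\<tau> L * \<Lambda> L) - (\<tau> L * \<Lambda> L)\<^sup>2 / 2 - ln pi / 2 =
          ln L / 2 - (T L - \<tau> L * \<Lambda> L)\<^sup>2 / 2 + L - ln L - ln pi / 2" for L
        by (simp add: power2_diff add_divide_distrib diff_divide_distrib)
      ultimately show ?thesis by simp
    qed
    from tendsto_exp[OF this]
    have a: "((\<lambda>L. exp (ln L / 2 - (T L - \<tau> L * \<Lambda> L)\<^sup>2 / 2 + L - ln L - ln pi / 2)) \<longlongrightarrow> exp (- z)) at_top" .
    \<comment> \<open>The exponential decay of \<open>\<tau>\<close> outweighs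
      \<open>\<Lambda>\<close> and the square root of \<open>L\<close>.\<close>
    have b: "((\<lambda>L. 4 * \<tau> L * \<Lambda> L * sqrt pi * sqrt L) \<longlongrightarrow> 0) at_top"
      unfolding \<tau>_def \<Lambda>_def using \<kappa>(1) by real_asymp
    have "eventually (\<lambda>L. exp (ln L / 2 - (T L - \<tau> L * \<Lambda> L)\<^sup>2 / 2 + L - ln L - ln pi / 2) * (4 * \<tau> L * \<Lambda> L * sqrt pi * sqrt L) =
       exp L * (4 * (\<tau> L * \<Lambda> L) * exp (- (T L - \<tau> L * \<Lambda> L)\<^sup>2 / 2))) at_top"
      using eventually_gt_at_top[of 0]
    proof eventually_elim
      fix L :: real assume L: "L > 0"
      have "sqrt pi * sqrt L = exp (ln pi / 2 + ln L / 2)" 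
        using L by (simp add: exp_add ln_sqrt[symmetric])
      then have "exp (ln L / 2 - (T L - \<tau> L * \<Lambda> L)\<^sup>2 / 2 + L - ln L - ln pi / 2) * (sqrt pi * sqrt L) =
         exp (L + - (T L - \<tau> L * \<Lambda> L)\<^sup>2 / 2)" by (simp flip: exp_add)
      then show "exp (ln L / 2 - (T L - \<tau> L * \<Lambda> L)\<^sup>2 / 2 + L - ln L - ln pi / 2) * (4 * \<tau> L * \<Lambda> L * sqrt pi * sqrt L) =
       exp L * (4 * (\<tau> L * \<Lambda> L) * exp (- (T L - \<tau> L * \<Lambda> L)\<^sup>2 / 2))"
        unfolding exp_add by (simp add: algebra_simps)
    qed
    with tendsto_mult[OF a b] show ?thesis by (auto intro: Lim_transform_eventually)
  qed
  have 3: "((\<lambda>L. exp L / (\<tau> L)\<^sup>2 * exp (- (T L)\<^sup>2 / (1 + \<rho>))) \<longlongrightarrow> 0) at_top"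
  proof -
    \<comment> \<open>The margin left by \<kappa>: since T^2 / L tends to 2, the expression is
      exp(-(\<delta> + o(1)) L).\<close>
    define \<delta> where "\<delta> = 2 / (1 + \<rho>) - 1 - 2 * \<kappa>"
    have "(1 - \<rho>) / (1 + \<rho>) = 2 / (1 + \<rho>) - 1" using \<rho> by (simp add: field_simps)
    moreover have "2 * \<kappa> < (1 - \<rho>) / (1 + \<rho>)" using \<kappa>(2) \<rho> by (simp add: field_simps)
    ultimately have \<delta>: "\<delta> > 0" unfolding \<delta>_def by simp
    have "((\<lambda>L. ((T L)\<^sup>2 - 2 * L) / L) \<longlongrightarrow> 0) at_top"
    proof -
      have "((\<lambda>L::real. 1 / L) \<longlongrightarrow> 0) at_top" "((\<lambda>L::real. ln L / L) \<longlongrightarrow> 0) at_top" by real_asymp+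
      then have "((\<lambda>L. - 2 * ((L - (T L)\<^sup>2 / 2 - ln L / 2) * (1 / L)) - ln L / L) \<longlongrightarrow> - 2 * ((ln pi / 2 - z) * 0) - 0) at_top"
        unfolding T_def by (intro tendsto_intros gumbel_level_square_limit)
      moreover have "- 2 * ((L - (T L)\<^sup>2 / 2 - ln L / 2) * (1 / L)) - ln L / L = ((T L)\<^sup>2 - 2 * L) / L" for L
        by (cases "L = 0") (simp_all add: field_simps)
      ultimately show ?thesis by simp
    qed
    then have "((\<lambda>L. \<delta> + ((T L)\<^sup>2 - 2 * L) / L * (1 / (1 + \<rho>))) \<longlongrightarrow> \<delta> + 0 * (1 / (1 + \<rho>))) at_top"
      by (intro tendsto_intros)
    then have "filterlim (\<lambda>L. (\<delta> + ((T L)\<^sup>2 - 2 * L) / L * (1 / (1 + \<rho>))) * L) at_top at_top"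
      using \<delta> by (intro filterlim_tendsto_pos_mult_at_top[OF _ _ filterlim_ident]) auto
    then have "((\<lambda>L. exp (- ((\<delta> + ((T L)\<^sup>2 - 2 * L) / L * (1 / (1 + \<rho>))) * L))) \<longlongrightarrow> 0) at_top"
      by (intro filterlim_compose[OF exp_at_bot]) (simp add: filterlim_uminus_at_top[symmetric] filterlim_uminus_at_bot)
    moreover have "eventually (\<lambda>L. exp (- ((\<delta> + ((T L)\<^sup>2 - 2 * L) / L * (1 / (1 + \<rho>))) * L)) =
      exp L / (\<tau> L)\<^sup>2 * exp (- (T L)\<^sup>2 / (1 + \<rho>))) at_top"
      using eventually_gt_at_top[of 0]
    proof eventually_elim
      fix L :: real assume L: "L > 0"
      have "exp L / (\<tau> L)\<^sup>2 * exp (- (T L)\<^sup>2 / (1 + \<rho>)) = exp (L - 2 * (- \<kappa> * L) + (- (T L)\<^sup>2 / (1 + \<rho>)))"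
        unfolding \<tau>_def exp_add exp_diff by (simp add: power2_eq_square flip: exp_add)
      also have "L - 2 * (- \<kappa> * L) + (- (T L)\<^sup>2 / (1 + \<rho>)) = - ((\<delta> + ((T L)\<^sup>2 - 2 * L) / L * (1 / (1 + \<rho>))) * L)"
      proof -
        define c where "c = 1 / (1 + \<rho>)"
        have c: "t / (1 + \<rho>) = t * c" for t by (simp add: c_def)
        have "((T L)\<^sup>2 - 2 * L) / L * c * L = ((T L)\<^sup>2 - 2 * L) * c" using L by simp
        then show ?thesis unfolding \<delta>_def c by (simp add: algebra_simps)
      qed
      finally show "exp (- ((\<delta> + ((T L)\<^sup>2 - 2 * L) / L * (1 / (1 + \<rho>))) * L)) =
        exp L / (\<tau> L)\<^sup>2 * exp (- (T L)\<^sup>2 / (1 + \<rho>))" by simp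
    qed
    ultimately show ?thesis by (rule Lim_transform_eventually)
  qed
  \<comment> \<open>Writing n p^2 / \<tau>^2 as (n p)^2 / (n \<tau>^2) leaves this factor, because n
    p converges.\<close>
  have 4: "((\<lambda>L. exp (- L) / (\<tau> L)\<^sup>2) \<longlongrightarrow> 0) at_top"
  proof -
    have "exp (- L) / (\<tau> L)\<^sup>2 = exp (- ((1 - 2 * \<kappa>) * L))" for L
    proof -
      have "exp (- L) / (\<tau> L)\<^sup>2 = exp (- L - 2 * (- \<kappa> * L))"
        unfolding \<tau>_def exp_diff by (simp add: power2_eq_square flip: exp_add)
      then show ?thesis by (simp add: algebra_simps)
    qed
    moreover define d where "d = 1 - 2 * \<kappa>"
    moreover have "d > 0" using \<kappa> by (simp add: d_def)
    then have "((\<lambda>L. exp (- (d * L))) \<longlongrightarrow> 0) at_top" by real_asymp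
    ultimately show ?thesis by simp
  qed
  have "((\<lambda>L. 2 * (exp L * normal_tail (\<Lambda> L)) + 2 * ((exp L * normal_tail (T L)) * (exp L * (4 * (\<tau> L * \<Lambda> L) * exp (- (T L - \<tau> L * \<Lambda> L)\<^sup>2 / 2))))
       + b * (2 * (exp L / (\<tau> L)\<^sup>2 * exp (- (T L)\<^sup>2 / (1 + \<rho>))) + (exp (- L) / (\<tau> L)\<^sup>2) * (exp L * normal_tail (T L))\<^sup>2)) \<longlongrightarrow> 
     2 * 0 + 2 * (exp (- z) * 0) + b * (2 * 0 + 0 * (exp (- z))\<^sup>2)) at_top"
    by (intro tendsto_intros 1 2 3 4 p)
  moreover have "2 * (exp L * normal_tail (\<Lambda> L)) + 2 * ((exp L * normal_tail (T L)) * (exp L * (4 * (\<tau> L * \<Lambda> L) * exp (- (T L - \<tau> L * \<Lambda> L)\<^sup>2 / 2))))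
       + b * (2 * (exp L / (\<tau> L)\<^sup>2 * exp (- (T L)\<^sup>2 / (1 + \<rho>))) + (exp (- L) / (\<tau> L)\<^sup>2) * (exp L * normal_tail (T L))\<^sup>2)
     = exp L * decoupling_error (exp L) b \<rho> (\<tau> L) (\<Lambda> L) (T L)" for L
  proof -
    have "exp (- L) / (\<tau> L)\<^sup>2 * (exp L * normal_tail (T L))\<^sup>2 = (exp (- L) * exp L) * exp L / (\<tau> L)\<^sup>2 * (normal_tail (T L))\<^sup>2"
      by (simp add: power2_eq_square)
    then have "exp (- L) / (\<tau> L)\<^sup>2 * (exp L * normal_tail (T L))\<^sup>2 = exp L / (\<tau> L)\<^sup>2 * (normal_tail (T L))\<^sup>2"
      by (simp flip: exp_add)
    from arg_cong[OF this, of "\<lambda>t. b * t"] show ?thesis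
      by (simp add: decoupling_error_def algebra_simps)
  qed
  ultimately show ?thesis by simp
qed

section \<open>Passage to the Gumbel distribution\<close>

lemma one_minus_power_limit:
  fixes p :: "nat \<Rightarrow> real" and N :: "nat \<Rightarrow> nat"
  assumes "(\<lambda>J. real (N J) * p J) \<longlonglongrightarrow> c" and p: "p \<longlonglongrightarrow> 0"
  shows "(\<lambda>J. (1 - p J) ^ N J) \<longlonglongrightarrow> exp (- c)"
proof -
  \<comment> \<open>The value -1 at 0 is the continuous extension, so a vanishing \<open>p J\<close>
    is covered as well.\<close>
  define f where "f x = (if x = 0 then -1 else ln (1 - x) / x)" for x :: real
  have "(f \<longlongrightarrow> -1) (at 0)"
  proof -
    have "((\<lambda>x::real. ln (1 - x) / x) \<longlongrightarrow> -1) (at 0)" by real_asymp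
    then show ?thesis by (rule Lim_transform_eventually) (auto simp: f_def eventually_at_filter)
  qed
  then have "isCont f 0" by (simp add: isCont_def f_def)
  from isCont_tendsto_compose[OF this p] have "(\<lambda>J. f (p J)) \<longlonglongrightarrow> -1" by (simp add: f_def)
  from tendsto_exp[OF tendsto_mult[OF assms(1) this]]
  have "(\<lambda>J. exp (real (N J) * p J * f (p J))) \<longlonglongrightarrow> exp (- c)" by simp
  moreover have "eventually (\<lambda>J. p J < 1) sequentially"
    using p by (rule order_tendstoD) simp
  then have "eventually (\<lambda>J. exp (real (N J) * p J * f (p J)) = (1 - p J) ^ N J) sequentially"
  proof eventually_elim
    fix J assume "p J < 1"
    then have "p J * f (p J) = ln (1 - p J)" by (simp add: f_def)
    then have "exp (real (N J) * p J * f (p J)) = exp (ln (1 - p J)) ^ N J" by (simp add: mult.assoc exp_of_nat_mult)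
    then show "exp (real (N J) * p J * f (p J)) = (1 - p J) ^ N J" using \<open>p J < 1\<close> by simp
  qed
  ultimately show ?thesis by (rule Lim_transform_eventually)
qed

text \<open>Along powers of two ln n is J ln 2. The decoupling error increases with the number of
  variables, so it is evaluated at 2^J rather than at the cardinality of \<open>I J\<close>; the
  ratio of the two numbers tends to 1, hence the power has the same limit.\<close>

lemma gumbel_limit:
  fixes M :: "nat \<Rightarrow> 'a measure" and e :: "nat \<Rightarrow> nat \<Rightarrow> 'a \<Rightarrow> real"
    and I :: "nat \<Rightarrow> 'i set" and w :: "nat \<Rightarrow> 'i \<Rightarrow> nat \<Rightarrow> real"
  assumes fam: "\<And>J. std_normal_family (M J) (e J) {..<2^J}"
    and I: "\<And>J. finite (I J)" "\<And>J. card (I J) \<le> 2 ^ J" "(\<lambda>J. real (card (I J)) / 2 ^ J) \<longlonglongrightarrow> 1"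
    and unit: "\<And>J i. i \<in> I J \<Longrightarrow> dot (2^J) (w J i) (w J i) = 1"
    and corr: "\<And>J i i'. i \<in> I J \<Longrightarrow> i' \<in> I J \<Longrightarrow> i \<noteq> i' \<Longrightarrow> \<bar>dot (2^J) (w J i) (w J i')\<bar> \<le> \<rho>"
    and \<rho>: "0 < \<rho>" "\<rho> < 1"
    and bessel: "\<And>J i. i \<in> I J \<Longrightarrow> (\<Sum>i'\<in>I J. (dot (2^J) (w J i) (w J i'))\<^sup>2) \<le> b" and b: "b \<ge> 0"
  shows "(\<lambda>J. measure (M J) {x \<in> space (M J). \<forall>i\<in>I J. \<bar>\<Sum>k<2^J. w J i k * e J k x\<bar> \<le> gumbel_level z (real J * ln 2)})
     \<longlonglongrightarrow> exp (- exp (- z))"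
proof -
  let ?L = "\<lambda>J. real J * ln 2"
  define t where "t = (1 - \<rho>) / (2 * (1 + \<rho>))"
  \<comment> \<open>Halving \<open>t\<close> and the value 1/8 make both upper bounds on \<kappa>
    strict.\<close>
  define \<kappa> where "\<kappa> = min (1/8) (t / 2)"
  have "0 < t" using \<rho> by (simp add: t_def)
  then have \<kappa>: "0 < \<kappa>" "\<kappa> < (1 - \<rho>) / (2 * (1 + \<rho>))" "\<kappa> < 1/4"
    unfolding \<kappa>_def t_def[symmetric] by linarith+
  define T where "T = gumbel_level z"
  define \<tau> where "\<tau> L = exp (- \<kappa> * L)" for L
  define \<Lambda> where "\<Lambda> L = 2 * sqrt L" for L
  define E where "E N L = real N * decoupling_error N b \<rho> (\<tau> L) (\<Lambda> L) (T L)" for N L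
  have L: "filterlim ?L at_top sequentially" by real_asymp
  have expL: "exp (?L J) = 2 ^ J" for J by (simp add: exp_of_nat_mult)
  have E0: "(\<lambda>J. E (2^J) (?L J)) \<longlonglongrightarrow> 0"
    using filterlim_compose[OF comparison_error_limit[OF \<rho> \<kappa>, where z = z and b = b] L]
    unfolding E_def T_def \<tau>_def \<Lambda>_def by (simp add: expL)
  have ev: "eventually (\<lambda>L. \<tau> L \<le> 1/2 \<and> \<Lambda> L > 0 \<and> \<tau> L * \<Lambda> L \<le> T L \<and> 1 \<le> T L) at_top"
  proof (intro eventually_conj)
    have "(\<tau> \<longlongrightarrow> 0) at_top" unfolding \<tau>_def using \<kappa>(1) by real_asymp
    then have "eventually (\<lambda>L. \<tau> L < 1/2) at_top" by (rule order_tendstoD) simp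
    then show "eventually (\<lambda>L. \<tau> L \<le> 1/2) at_top" by eventually_elim simp
    show "eventually (\<lambda>L. \<Lambda> L > 0) at_top" unfolding \<Lambda>_def by real_asymp
    have "((\<lambda>L. \<tau> L * \<Lambda> L) \<longlongrightarrow> 0) at_top" unfolding \<tau>_def \<Lambda>_def using \<kappa>(1) by real_asymp
    then have 1: "eventually (\<lambda>L. \<tau> L * \<Lambda> L < 1) at_top" by (rule order_tendstoD) simp
    show 2: "eventually (\<lambda>L. 1 \<le> T L) at_top" unfolding T_def
      using gumbel_level_at_top by (auto simp: filterlim_at_top)
    from 1 2 show "eventually (\<lambda>L. \<tau> L * \<Lambda> L \<le> T L) at_top" by eventually_elim simp
  qed
  have bound: "eventually (\<lambda>J. \<bar>measure (M J) {x \<in> space (M J). \<forall>i\<in>I J. \<bar>\<Sum>k<2^J. w J i k * e J k x\<bar> \<le> T (?L J)} -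
      (1 - normal_tail (T (?L J))) ^ card (I J)\<bar> \<le> E (2^J) (?L J)) sequentially"
    using eventually_compose_filterlim[OF ev L]
  proof eventually_elim
    fix J
    assume *: "\<tau> (?L J) \<le> 1/2 \<and> \<Lambda> (?L J) > 0 \<and> \<tau> (?L J) * \<Lambda> (?L J) \<le> T (?L J) \<and> 1 \<le> T (?L J)"
    interpret std_normal_family "M J" "e J" "{..<2^J}" by (rule fam)
    have ip: "ip v u = dot (2^J) v u" for v u unfolding ip_def dot_def ..
    have t: "\<tau> (?L J) > 0" by (simp add: \<tau>_def)
    have "\<bar>prob {x \<in> space (M J). \<forall>i\<in>I J. \<bar>lin (w J i) x\<bar> \<le> T (?L J)} - (1 - normal_tail (T (?L J))) ^ card (I J)\<bar>
      \<le> E (card (I J)) (?L J)"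
      unfolding E_def
      by (rule maximum_comparison) (use I unit corr \<rho> bessel * t in \<open>auto simp: ip\<close>)
    also have "\<dots> \<le> E (2^J) (?L J)"
    proof -
      have "real (card (I J)) \<le> real (2^J)" using I(2)[of J] by (simp only: of_nat_le_iff)
      then show ?thesis unfolding E_def decoupling_error_def
        using * t b by (intro mult_mono add_mono mult_nonneg_nonneg add_nonneg_nonneg normal_tail_nonneg order_refl) auto
    qed
    finally show "\<bar>prob {x \<in> space (M J). \<forall>i\<in>I J. \<bar>\<Sum>k<2^J. w J i k * e J k x\<bar> \<le> T (?L J)} -
      (1 - normal_tail (T (?L J))) ^ card (I J)\<bar> \<le> E (2^J) (?L J)" unfolding lin_def .
  qed
  have np: "(\<lambda>J. 2^J * normal_tail (T (?L J))) \<longlonglongrightarrow> exp (- z)"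
    using filterlim_compose[OF normal_tail_limit[of z] L] by (simp add: T_def expL)
  have p0: "(\<lambda>J. normal_tail (T (?L J))) \<longlonglongrightarrow> 0"
  proof -
    have "(\<lambda>J. 1 / 2^J :: real) \<longlonglongrightarrow> 0" by real_asymp
    from tendsto_mult[OF np this] show ?thesis by simp
  qed
  have "(\<lambda>J. real (card (I J)) * normal_tail (T (?L J))) \<longlonglongrightarrow> exp (- z)"
    using tendsto_mult[OF I(3) np] by simp
  from one_minus_power_limit[OF this p0]
  have lim: "(\<lambda>J. (1 - normal_tail (T (?L J))) ^ card (I J)) \<longlonglongrightarrow> exp (- exp (- z))" .
  have "(\<lambda>J. measure (M J) {x \<in> space (M J). \<forall>i\<in>I J. \<bar>\<Sum>k<2^J. w J i k * e J k x\<bar> \<le> T (?L J)} -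
      (1 - normal_tail (T (?L J))) ^ card (I J)) \<longlonglongrightarrow> 0"
    by (rule Lim_null_comparison[OF _ E0]) (use bound in simp)
  from tendsto_add[OF this lim] show ?thesis by (simp add: T_def)
qed

section \<open>Square integrable functions\<close>

lemma L2_on_iff:
  "f \<in> L2_on A \<longleftrightarrow> (\<lambda>t. indicat_real A t * f t) \<in> borel_measurable borel \<and>
     integrable lborel (\<lambda>t. indicat_real A t * (f t)\<^sup>2)"
  by (simp add: L2_on_def set_borel_measurable_def set_integrable_def)

lemma L2_onI_cong:
  assumes "f \<in> L2_on A" "\<And>t. t \<in> A \<Longrightarrow> f t = g t"
  shows "g \<in> L2_on A"
proof -
  have 1: "(\<lambda>t. indicat_real A t * f t) = (\<lambda>t. indicat_real A t * g t)"
    "(\<lambda>t. indicat_real A t * (f t)\<^sup>2) = (\<lambda>t. indicat_real A t * (g t)\<^sup>2)"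
    using assms(2) by (auto simp: fun_eq_iff split: split_indicator)
  show ?thesis using assms(1) unfolding L2_on_iff 1 by blast
qed

lemma L2_on_mono:
  assumes "f \<in> L2_on B" "A \<subseteq> B" "A \<in> sets lborel"
  shows "f \<in> L2_on A"
  using assms unfolding L2_on_def
  by (auto intro: set_integrable_subset set_borel_measurable_subset)

lemma L2_on_mult_integrable:
  assumes f: "f \<in> L2_on A" and g: "g \<in> L2_on A"
  shows "set_integrable lborel A (\<lambda>t. f t * g t)"
proof -
  have F: "(\<lambda>t. indicator A t *\<^sub>R f t) \<in> borel_measurable lborel" "integrable lborel (\<lambda>t. indicator A t *\<^sub>R (f t)\<^sup>2)"
    and G: "(\<lambda>t. indicator A t *\<^sub>R g t) \<in> borel_measurable lborel" "integrable lborel (\<lambda>t. indicator A t *\<^sub>R (g t)\<^sup>2)"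
    using f g by (auto simp: L2_on_def set_borel_measurable_def set_integrable_def)
  have eq: "(\<lambda>t. indicator A t *\<^sub>R (f t * g t)) = (\<lambda>t. (indicator A t *\<^sub>R f t) * (indicator A t *\<^sub>R g t))"
    by (auto split: split_indicator)
  show ?thesis unfolding set_integrable_def
  proof (rule Bochner_Integration.integrable_bound)
    show "integrable lborel (\<lambda>t. indicator A t *\<^sub>R (f t)\<^sup>2 + indicator A t *\<^sub>R (g t)\<^sup>2)"
      using F G by (intro Bochner_Integration.integrable_add)
    show "(\<lambda>t. indicator A t *\<^sub>R (f t * g t)) \<in> borel_measurable lborel"
      unfolding eq using F G by (intro borel_measurable_times)
    have "\<bar>x * y\<bar> \<le> x\<^sup>2 + y\<^sup>2" for x y :: real
      using sum_squares_bound[of "\<bar>x\<bar>" "\<bar>y\<bar>"] mult_nonneg_nonneg[of "\<bar>x\<bar>" "\<bar>y\<bar>"]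
      unfolding abs_mult power2_abs by linarith
    then show "AE t in lborel. norm (indicator A t *\<^sub>R (f t * g t)) \<le> norm (indicator A t *\<^sub>R (f t)\<^sup>2 + indicator A t *\<^sub>R (g t)\<^sup>2)"
      by (auto split: split_indicator)
  qed
qed

lemma L2_on_add:
  assumes f: "f \<in> L2_on A" and g: "g \<in> L2_on A"
  shows "(\<lambda>t. f t + g t) \<in> L2_on A"
proof -
  have "set_borel_measurable lborel A (\<lambda>t. f t + g t)"
    using borel_measurable_add[of "\<lambda>t. indicat_real A t * f t" borel "\<lambda>t. indicat_real A t * g t"] f g
    unfolding L2_on_iff set_borel_measurable_def by (simp add: distrib_left)
  moreover have "set_integrable lborel A (\<lambda>t. (f t)\<^sup>2 + 2 * (f t * g t) + (g t)\<^sup>2)"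
    using f g L2_on_mult_integrable[OF f g] by (intro set_integral_add set_integrable_mult_right) (auto simp: L2_on_def)
  ultimately show ?thesis by (simp add: L2_on_def power2_sum algebra_simps)
qed

lemma L2_on_scale:
  assumes f: "f \<in> L2_on A"
  shows "(\<lambda>t. c * f t) \<in> L2_on A"
proof -
  have "set_borel_measurable lborel A (\<lambda>t. c * f t)"
    using borel_measurable_times[of "\<lambda>t. c" borel "\<lambda>t. indicat_real A t * f t"] f
    unfolding L2_on_iff set_borel_measurable_def by (simp add: mult.left_commute)
  then show ?thesis using f by (simp add: L2_on_def power_mult_distrib)
qed

lemma L2_on_zero: "(\<lambda>t. 0) \<in> L2_on A"
  by (simp add: L2_on_def set_borel_measurable_def set_integrable_def)

lemma L2_on_sum:
  assumes "\<And>i. i \<in> I \<Longrightarrow> f i \<in> L2_on A"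
  shows "(\<lambda>t. \<Sum>i\<in>I. f i t) \<in> L2_on A"
  using assms by (induction I rule: infinite_finite_induct) (auto simp: L2_on_zero intro: L2_on_add)

lemma L2_on_lincomb:
  assumes "\<And>i. i \<in> I \<Longrightarrow> f i \<in> L2_on A"
  shows "(\<lambda>t. \<Sum>i\<in>I. c i * f i t) \<in> L2_on A"
  using assms by (intro L2_on_sum L2_on_scale)

lemma L2_inner_commute: "L2_inner A f g = L2_inner A g f"
  by (simp add: L2_inner_def mult.commute)

lemma L2_inner_add_left:
  assumes "f \<in> L2_on A" "g \<in> L2_on A" "h \<in> L2_on A"
  shows "L2_inner A (\<lambda>t. f t + g t) h = L2_inner A f h + L2_inner A g h"
  using assms unfolding L2_inner_def
  by (simp add: distrib_right set_integral_add L2_on_mult_integrable)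

lemma L2_inner_scale_left: "L2_inner A (\<lambda>t. c * f t) h = c * L2_inner A f h"
  by (simp add: L2_inner_def mult.assoc)

lemma L2_inner_zero_left: "L2_inner A (\<lambda>t. 0) h = 0"
  by (simp add: L2_inner_def)

lemma L2_inner_lincomb_left:
  assumes "\<And>i. i \<in> I \<Longrightarrow> f i \<in> L2_on A" "h \<in> L2_on A"
  shows "L2_inner A (\<lambda>t. \<Sum>i\<in>I. c i * f i t) h = (\<Sum>i\<in>I. c i * L2_inner A (f i) h)"
  using assms
proof (induction I rule: infinite_finite_induct)
  case (insert i I)
  then show ?case
    by (simp add: L2_inner_add_left L2_on_scale L2_on_lincomb L2_inner_scale_left)
qed (simp_all add: L2_inner_zero_left)

lemma L2_inner_lincomb_right:
  assumes "\<And>i. i \<in> I \<Longrightarrow> f i \<in> L2_on A" "h \<in> L2_on A"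
  shows "L2_inner A h (\<lambda>t. \<Sum>i\<in>I. c i * f i t) = (\<Sum>i\<in>I. c i * L2_inner A h (f i))"
  using L2_inner_lincomb_left[of I f A h c] assms by (simp add: L2_inner_commute[of A h])

lemma L2_inner_add_right:
  assumes "f \<in> L2_on A" "g \<in> L2_on A" "h \<in> L2_on A"
  shows "L2_inner A h (\<lambda>t. f t + g t) = L2_inner A h f + L2_inner A h g"
  using L2_inner_add_left[OF assms] by (simp add: L2_inner_commute[of A h])

lemma L2_inner_cong_AE_left:
  assumes f: "f \<in> L2_on A" and g: "g \<in> L2_on A" and h: "h \<in> L2_on A" and ae: "AE t\<in>A in lborel. f t = g t"
  shows "L2_inner A f h = L2_inner A g h"
  unfolding L2_inner_def set_lebesgue_integral_def
proof (rule integral_cong_AE)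
  show "(\<lambda>t. indicator A t *\<^sub>R (f t * h t)) \<in> borel_measurable lborel"
    "(\<lambda>t. indicator A t *\<^sub>R (g t * h t)) \<in> borel_measurable lborel"
    using L2_on_mult_integrable[OF f h] L2_on_mult_integrable[OF g h] by (auto simp: set_integrable_def)
  show "AE t in lborel. indicator A t *\<^sub>R (f t * h t) = indicator A t *\<^sub>R (g t * h t)"
    using ae by eventually_elim (auto split: split_indicator)
qed

lemma L2_inner_cong_AE_right:
  assumes "f \<in> L2_on A" "g \<in> L2_on A" "h \<in> L2_on A" "AE t\<in>A in lborel. f t = g t"
  shows "L2_inner A h f = L2_inner A h g"
  using L2_inner_cong_AE_left[OF assms] by (simp add: L2_inner_commute[of A h])

lemma L2_inner_self_nonneg: "L2_inner A f f \<ge> 0"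
  unfolding L2_inner_def set_lebesgue_integral_def by (auto intro!: integral_nonneg)

lemma L2_norm_on_power2: "(L2_norm_on A f)\<^sup>2 = L2_inner A f f"
  by (simp add: L2_norm_on_def L2_inner_self_nonneg)

lemma L2_inner_add_self:
  assumes "f \<in> L2_on A" "g \<in> L2_on A"
  shows "L2_inner A (\<lambda>t. f t + g t) (\<lambda>t. f t + g t) = L2_inner A f f + 2 * L2_inner A g f + L2_inner A g g"
  unfolding L2_inner_add_left[OF assms L2_on_add[OF assms]]
    L2_inner_add_right[OF assms assms(1)] L2_inner_add_right[OF assms assms(2)]
  using L2_inner_commute[of A f g] by simp

lemma L2_inner_scale_self: "L2_inner A (\<lambda>t. c * f t) (\<lambda>t. c * f t) = c\<^sup>2 * L2_inner A f f"
  unfolding L2_inner_scale_left L2_inner_commute[of A f "\<lambda>t. c * f t"] by (simp add: power2_eq_square)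

text \<open>Duality of synthesis and analysis: let h be the combination of the \<open>e i\<close>
  whose coefficients are their inner products with \<open>u\<close>, and expand 0 \<le> ||u -
  h/b||^2. The inner product of h and u is the sum of the squared coefficients.\<close>

lemma bessel_from_synthesis:
  assumes I: "finite I" and e: "\<And>i. i \<in> I \<Longrightarrow> e i \<in> L2_on A" and u: "u \<in> L2_on A" and b: "b > 0"
    and synth: "\<And>c. L2_inner A (\<lambda>t. \<Sum>i\<in>I. c i * e i t) (\<lambda>t. \<Sum>i\<in>I. c i * e i t) \<le> b * (\<Sum>i\<in>I. (c i)\<^sup>2)"
  shows "(\<Sum>i\<in>I. (L2_inner A (e i) u)\<^sup>2) \<le> b * L2_inner A u u"
proof -
  define c where "c i = L2_inner A (e i) u" for i
  define h where "h t = (\<Sum>i\<in>I. c i * e i t)" for t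
  define S where "S = (\<Sum>i\<in>I. (c i)\<^sup>2)"
  have h: "h \<in> L2_on A" unfolding h_def using e by (intro L2_on_lincomb)
  have hu: "L2_inner A h u = S"
    unfolding h_def using e u by (subst L2_inner_lincomb_left) (auto simp: S_def c_def power2_eq_square)
  have hh: "L2_inner A h h \<le> b * S" unfolding h_def S_def by (rule synth)
  have H: "(\<lambda>t. (- 1 / b) * h t) \<in> L2_on A" by (rule L2_on_scale) (rule h)
  have "0 \<le> L2_inner A (\<lambda>t. u t + (- 1 / b) * h t) (\<lambda>t. u t + (- 1 / b) * h t)"
    by (rule L2_inner_self_nonneg)
  also have "\<dots> = L2_inner A u u + 2 * ((- 1 / b) * L2_inner A h u) + (- 1 / b)\<^sup>2 * L2_inner A h h"
    unfolding L2_inner_add_self[OF u H] L2_inner_scale_self L2_inner_scale_left by simp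
  finally have "0 \<le> L2_inner A u u - 2 * S / b + L2_inner A h h / (b * b)"
    unfolding hu by (simp add: field_simps power2_eq_square)
  also have "L2_inner A h h / (b * b) \<le> b * S / (b * b)" using hh b by (intro divide_right_mono) auto
  also have "b * S / (b * b) = S / b" using b by simp
  finally have "S / b \<le> L2_inner A u u" by simp
  then show ?thesis using b by (simp add: S_def c_def field_simps)
qed

lemma L2_on_UNIV_affine:
  assumes f: "f \<in> L2_on UNIV" and a: "a \<noteq> 0"
  shows "(\<lambda>t. f (a * t + b)) \<in> L2_on UNIV"
proof -
  have m [measurable]: "f \<in> borel_measurable borel" and i: "integrable lborel (\<lambda>t. (f t)\<^sup>2)"
    using f by (auto simp: L2_on_def set_borel_measurable_def set_integrable_def)
  have "integrable lborel (\<lambda>t. (f (b + a * t))\<^sup>2)"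
    using lborel_integrable_real_affine[OF i a, of b] .
  then show ?thesis by (simp add: L2_on_def set_borel_measurable_def set_integrable_def add.commute)
qed

lemma AE_lborel_affine:
  assumes "AE x in lborel. P x" and a: "(a::real) \<noteq> 0"
  shows "AE t in lborel. P (a * t + b)"
proof -
  obtain N where N: "N \<in> null_sets lborel" "{x. \<not> P x} \<subseteq> N"
    using assms(1) by (auto simp: eventually_ae_filter)
  have [measurable]: "N \<in> sets borel" using N by auto
  have "(\<integral>\<^sup>+x. indicator N x \<partial>lborel) = 0" using N by auto
  then have "(\<integral>\<^sup>+x. indicator N (b + a * x) \<partial>lborel) = 0"
    using nn_integral_real_affine[of "indicator N" a b] a by simp
  then have "AE x in lborel. indicator N (b + a * x) = (0::ennreal)"
    by (subst (asm) nn_integral_0_iff_AE) auto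
  then show ?thesis
    by eventually_elim (use N in \<open>auto simp: add.commute split: split_indicator_asm\<close>)
qed

section \<open>Periodization\<close>

text \<open>Refinement produces translation indices such as \<open>2 * i + l\<close>, which leave
  the range below 2^j. Allowing all integers avoids wrapping them at each step; the function depends
  on the index modulo 2^j only.\<close>

definition periodize_int :: "(real \<Rightarrow> real) \<Rightarrow> nat \<Rightarrow> int \<Rightarrow> real \<Rightarrow> real" where
  "periodize_int f j i t = 2 powr (real j / 2) * (\<Sum>\<^sub>\<infinity>m\<in>(UNIV :: int set). f (2 ^ j * (t - of_int m) - of_int i))"

lemma periodize_eq_periodize_int: "periodize f j k = periodize_int f j (int k)"
  by (simp add: periodize_def periodize_int_def fun_eq_iff)

lemma infsum_int_shift:
  fixes g :: "int \<Rightarrow> real"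
  shows "(\<Sum>\<^sub>\<infinity>m\<in>UNIV. g (m + q)) = (\<Sum>\<^sub>\<infinity>m\<in>UNIV. g m)"
proof (rule infsum_reindex_bij_betw)
  show "bij_betw (\<lambda>m. m + q) UNIV UNIV"
    by (rule bij_betwI[where g = "\<lambda>m. m - q"]) auto
qed

lemma periodize_int_shift: "periodize_int f j (i + 2 ^ j * q) t = periodize_int f j i t"
proof -
  have "f (2 ^ j * (t - of_int m) - of_int (i + 2 ^ j * q)) = f (2 ^ j * (t - of_int (m + q)) - of_int i)" for m
    by (simp add: algebra_simps)
  then show ?thesis
    unfolding periodize_int_def using infsum_int_shift[of "\<lambda>m. f (2 ^ j * (t - of_int m) - of_int i)" q] by simp
qed

lemma periodize_int_mod: "periodize_int f j i = periodize f j (nat (i mod 2 ^ j))"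
proof
  fix t
  have "periodize_int f j i t = periodize_int f j (i mod 2 ^ j + 2 ^ j * (i div 2 ^ j)) t" by simp
  then show "periodize_int f j i t = periodize f j (nat (i mod 2 ^ j)) t"
    unfolding periodize_int_shift by (simp add: periodize_eq_periodize_int)
qed

lemma periodize_int_period: "periodize_int f j i (t - of_int q) = periodize_int f j i t"
proof -
  have "f (2 ^ j * (t - of_int q - of_int m) - of_int i) = f (2 ^ j * (t - of_int (m + q)) - of_int i)" for m
    by (simp add: algebra_simps)
  then show ?thesis
    unfolding periodize_int_def using infsum_int_shift[of "\<lambda>m. f (2 ^ j * (t - of_int m) - of_int i)" q] by simp
qed

lemma periodize_int_eq_sum:
  assumes "\<And>m. m \<notin> F \<Longrightarrow> f (2 ^ j * (t - of_int m) - of_int i) = 0" "finite F"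
  shows "periodize_int f j i t = 2 powr (real j / 2) * (\<Sum>m\<in>F. f (2 ^ j * (t - of_int m) - of_int i))"
proof -
  have "(\<Sum>\<^sub>\<infinity>m\<in>UNIV. f (2 ^ j * (t - of_int m) - of_int i)) = (\<Sum>\<^sub>\<infinity>m\<in>F. f (2 ^ j * (t - of_int m) - of_int i))"
    using assms(1) by (intro infsum_cong_neutral) auto
  then show ?thesis using assms(2) by (simp add: periodize_int_def)
qed

definition supported_in :: "real \<Rightarrow> (real \<Rightarrow> real) \<Rightarrow> bool" where
  "supported_in R f \<longleftrightarrow> R \<ge> 0 \<and> (\<forall>x. \<bar>x\<bar> > R \<longrightarrow> f x = 0)"

lemma compactly_supported_imp:
  assumes "compactly_supported f"
  obtains R where "supported_in R f"
proof -
  from assms obtain R where "\<forall>x. \<bar>x\<bar> > R \<longrightarrow> f x = 0" by (auto simp: compactly_supported_def)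
  then have "supported_in (max R 0) f" by (auto simp: supported_in_def)
  then show ?thesis by (rule that)
qed

lemma supported_in_mono: "supported_in R f \<Longrightarrow> R \<le> R' \<Longrightarrow> supported_in R' f"
  by (auto simp: supported_in_def)

text \<open>The bound depends neither on \<open>j\<close> nor on \<open>k\<close>, so on the unit
  interval a number of integer translates fixed for all levels suffices.\<close>

lemma scaled_support:
  assumes f: "supported_in R f" and nz: "f (2 ^ j * s - real k) \<noteq> 0" and k: "k < 2 ^ j"
  shows "\<bar>s\<bar> < R + 1"
proof -
  have *: "\<bar>2 ^ j * s - real k\<bar> \<le> R" and R: "R \<ge> 0" using f nz by (auto simp: supported_in_def not_less[symmetric])
  have k1: "real k < 2 ^ j" using k by (metis of_nat_less_iff of_nat_numeral of_nat_power)
  have "2 ^ j * \<bar>s\<bar> = \<bar>2 ^ j * s\<bar>" by (simp add: abs_mult)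
  also have "\<dots> \<le> R + real k" using * by linarith
  also have "\<dots> < R + 2 ^ j" using k1 by simp
  also have "\<dots> \<le> 2 ^ j * (R + 1)" using R mult_right_mono[of 1 "2 ^ j" R] by (simp add: algebra_simps)
  finally show ?thesis by simp
qed

lemma periodize_unit_interval:
  assumes f: "supported_in R f" and k: "k < 2 ^ j" and t: "t \<in> unit_interval" and N: "real N \<ge> R + 2"
  shows "periodize f j k t = 2 powr (real j / 2) * (\<Sum>m\<in>{- int N..int N}. f (2 ^ j * (t - of_int m) - real k))"
proof -
  have "f (2 ^ j * (t - of_int m) - of_int (int k)) = 0" if "m \<notin> {- int N..int N}" for m
  proof (rule ccontr)
    assume "f (2 ^ j * (t - of_int m) - of_int (int k)) \<noteq> 0"
    then have "\<bar>t - of_int m\<bar> < R + 1" using scaled_support[OF f _ k] by simp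
    then have "\<bar>of_int m :: real\<bar> < real N" using t N by auto
    then show False using that by auto
  qed
  then show ?thesis using periodize_int_eq_sum[of "{- int N..int N}" f j t "int k"] by (simp add: periodize_eq_periodize_int)
qed

lemma periodize_L2:
  assumes f: "f \<in> L2_on UNIV" "compactly_supported f" and k: "k < 2 ^ j"
  shows "periodize f j k \<in> L2_on unit_interval"
proof -
  obtain R where R: "supported_in R f" using f(2) by (rule compactly_supported_imp)
  obtain N :: nat where N: "real N \<ge> R + 2" using real_arch_simple by blast
  let ?g = "\<lambda>t. 2 powr (real j / 2) * (\<Sum>m\<in>{- int N..int N}. f (2 ^ j * (t - of_int m) - real k))"
  have "(\<lambda>t. f (2 ^ j * t + (- (2 ^ j) * of_int m - real k))) \<in> L2_on UNIV" for m
    by (rule L2_on_UNIV_affine[OF f(1)]) simp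
  then have "(\<lambda>t. f (2 ^ j * (t - of_int m) - real k)) \<in> L2_on UNIV" for m :: int
    by (simp add: algebra_simps)
  then have "?g \<in> L2_on UNIV" by (intro L2_on_scale L2_on_sum)
  then have "?g \<in> L2_on unit_interval" by (rule L2_on_mono) auto
  then show ?thesis by (rule L2_onI_cong) (use periodize_unit_interval[OF R k _ N] in auto)
qed

text \<open>The integer translates of the unit interval tile the support of
  \<open>P\<close>.\<close>

lemma integral_unit_translates:
  fixes P :: "real \<Rightarrow> real"
  assumes P: "integrable lborel P" and supp: "\<And>s. \<bar>s\<bar> \<ge> real N \<Longrightarrow> P s = 0"
  shows "(\<Sum>m\<in>{- int N..int N}. LINT t:unit_interval|lborel. P (t - of_int m)) = (LINT s|lborel. P s)"
proof -
  have 1: "(LINT t:unit_interval|lborel. P (t - of_int m)) = (LINT s|lborel. indicator {- of_int m<..<1 - of_int m} s * P s)" for m :: int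
  proof -
    have "(LINT s|lborel. indicator {- of_int m<..<1 - of_int m} s * P s) =
       (LINT t|lborel. indicator {- of_int m<..<1 - of_int m} (- of_int m + 1 * t) * P (- of_int m + 1 * t))"
      by (subst lborel_integral_real_affine[where c = 1 and t = "- of_int m"]) auto
    also have "\<dots> = (LINT t:unit_interval|lborel. P (t - of_int m))"
      unfolding set_lebesgue_integral_def
      by (intro Bochner_Integration.integral_cong) (auto split: split_indicator)
    finally show ?thesis by simp
  qed
  have PI: "integrable lborel (\<lambda>s. indicat_real {- of_int m<..<1 - of_int m} s * P s)" for m :: int
    using integrable_mult_indicator[OF _ P, of "{- of_int m<..<1 - of_int m}"] by simp
  have "(\<Sum>m\<in>{- int N..int N}. LINT t:unit_interval|lborel. P (t - of_int m)) =
     (LINT s|lborel. (\<Sum>m\<in>{- int N..int N}. indicator {- of_int m<..<1 - of_int m} s * P s))"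
    unfolding 1 by (intro Bochner_Integration.integral_sum[symmetric] PI)
  also have "\<dots> = (LINT s|lborel. P s)"
  proof (rule integral_cong_AE)
    show "(\<lambda>s. \<Sum>m\<in>{- int N..int N}. indicat_real {- of_int m<..<1 - of_int m} s * P s) \<in> borel_measurable lborel"
      by (intro borel_measurable_integrable Bochner_Integration.integrable_sum PI)
    show "P \<in> borel_measurable lborel" using P by (rule borel_measurable_integrable)
    \<comment> \<open>The open intervals miss exactly the integers, a null set.\<close>
    have "AE s in lborel. s \<notin> range (of_int :: int \<Rightarrow> real)"
      by (intro AE_not_in countable_imp_null_set_lborel) auto
    then show "AE s in lborel. (\<Sum>m\<in>{- int N..int N}. indicator {- of_int m<..<1 - of_int m} s * P s) = P s"
    proof eventually_elim
      fix s :: real assume s: "s \<notin> range of_int"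
      show "(\<Sum>m\<in>{- int N..int N}. indicator {- of_int m<..<1 - of_int m} s * P s) = P s"
      proof (cases "\<bar>s\<bar> < real N")
        case False
        then show ?thesis using supp[of s] by simp
      next
        case True
        have fl: "of_int \<lfloor>s\<rfloor> \<noteq> s" using s by (metis rangeI)
        have ind: "indicator {- of_int m<..<1 - of_int m} s = (of_bool (m = - \<lfloor>s\<rfloor>) :: real)" for m :: int
        proof -
          have "s \<in> {- of_int m<..<1 - of_int m} \<longleftrightarrow> m = - \<lfloor>s\<rfloor>"
          proof
            assume "s \<in> {- of_int m<..<1 - of_int m}"
            then have "\<lfloor>s\<rfloor> = - m" by (intro floor_unique) auto
            then show "m = - \<lfloor>s\<rfloor>" by simp
          next
            assume "m = - \<lfloor>s\<rfloor>"
            then have "of_int m = - (of_int \<lfloor>s\<rfloor> :: real)" by simp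
            moreover have "of_int \<lfloor>s\<rfloor> < s" "s < of_int \<lfloor>s\<rfloor> + 1" using fl floor_correct[of s] by linarith+
            ultimately show "s \<in> {- of_int m<..<1 - of_int m}" unfolding greaterThanLessThan_iff by linarith
          qed
          then show ?thesis by (simp add: indicator_def)
        qed
        have "- int N \<le> \<lfloor>s\<rfloor>" unfolding le_floor_iff using True by simp
        moreover have "\<lfloor>s\<rfloor> \<le> int N" unfolding floor_le_iff using True by simp
        ultimately have "- \<lfloor>s\<rfloor> \<in> {- int N..int N}" by simp
        then show ?thesis unfolding ind by (simp add: of_bool_def if_distrib[of "\<lambda>x. x * _"] sum.delta cong: if_cong)
      qed
    qed
  qed
  finally show ?thesis .
qed

section \<open>Inner products of periodic functions at one level\<close>

lemma dilate_0: "dilate f 0 k = (\<lambda>x. f (x - of_int k))"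
  by (simp add: dilate_def fun_eq_iff)

lemma L2_inner_dilate_rescale:
  "(LINT s|lborel. (2 powr (real j / 2) * f (2 ^ j * s - real k)) * (2 powr (real j / 2) * g (2 ^ j * s - of_int l))) =
    L2_inner UNIV (dilate f 0 (int k)) (dilate g 0 l)"
proof -
  have p: "2 powr (real j / 2) * 2 powr (real j / 2) = (2 ^ j :: real)"
    by (simp add: powr_realpow flip: powr_add)
  have "(LINT s|lborel. (2 powr (real j / 2) * f (2 ^ j * s - real k)) * (2 powr (real j / 2) * g (2 ^ j * s - of_int l)))
    = (LINT s|lborel. 2 ^ j * (f (2 ^ j * s - real k) * g (2 ^ j * s - of_int l)))"
    by (simp add: p[symmetric] ac_simps)
  also have "\<dots> = 2 ^ j * (LINT s|lborel. f (2 ^ j * s - real k) * g (2 ^ j * s - of_int l))" by simp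
  also have "\<dots> = (LINT x|lborel. f (x - real k) * g (x - of_int l))"
    by (subst (2) lborel_integral_real_affine[where c = "2 ^ j" and t = 0]) auto
  finally show ?thesis
    by (simp add: L2_inner_def set_lebesgue_integral_def dilate_0)
qed

text \<open>Unfolding: the sum over translates in the first factor turns the integral over the unit
  interval into one over the line, because the second factor has period 1. On the support of the
  first generator the second periodization is a finite sum, and a translation by q at level j shifts
  the index by 2^j q.\<close>

lemma L2_inner_periodize:
  assumes f: "f \<in> L2_on UNIV" "compactly_supported f" and g: "g \<in> L2_on UNIV" "compactly_supported g"
    and k: "k < 2 ^ j" and l: "l < 2 ^ j"
  obtains Q :: nat where "L2_inner unit_interval (periodize f j k) (periodize g j l) =
    (\<Sum>q\<in>{- int Q..int Q}. L2_inner UNIV (dilate f 0 (int k)) (dilate g 0 (int l + 2 ^ j * q)))"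
proof -
  obtain R1 R2 where "supported_in R1 f" "supported_in R2 g" using f(2) g(2) by (meson compactly_supported_imp)
  then have Rf: "supported_in (max R1 R2) f" and Rg: "supported_in (max R1 R2) g" by (auto intro: supported_in_mono)
  define R where "R = max R1 R2"
  note Rf = Rf[folded R_def] and Rg = Rg[folded R_def]
  obtain N :: nat where N: "real N \<ge> R + 2" using real_arch_simple by blast
  obtain Q :: nat where Q: "real Q \<ge> 2 * R + 2" using real_arch_simple by blast
  let ?c = "2 powr (real j / 2) :: real"
  define F where "F s = ?c * f (2 ^ j * s - real k)" for s
  define G where "G q s = ?c * g (2 ^ j * s - of_int (int l + 2 ^ j * q))" for q s
  define P where "P s = F s * periodize g j l s" for s
  have F2: "F \<in> L2_on UNIV"
    unfolding F_def using L2_on_UNIV_affine[OF f(1), of "2 ^ j" "- real k"] by (intro L2_on_scale) simp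
  have G2: "G q \<in> L2_on UNIV" for q
    unfolding G_def using L2_on_UNIV_affine[OF g(1), of "2 ^ j" "- of_int (int l + 2 ^ j * q)"] by (intro L2_on_scale) (simp add: algebra_simps)
  have Fnz: "\<bar>s\<bar> < R + 1" if "F s \<noteq> 0" for s using scaled_support[OF Rf _ k, of s] that by (auto simp: F_def)
  have PG: "P s = (\<Sum>q\<in>{- int Q..int Q}. F s * G q s)" for s
  proof (cases "F s = 0")
    case False
    then have s: "\<bar>s\<bar> < R + 1" by (rule Fnz)
    have "g (2 ^ j * (s - of_int q) - of_int (int l)) = 0" if "q \<notin> {- int Q..int Q}" for q
    proof (rule ccontr)
      assume "g (2 ^ j * (s - of_int q) - of_int (int l)) \<noteq> 0"
      then have "\<bar>s - of_int q\<bar> < R + 1" using scaled_support[OF Rg _ l] by simp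
      then have "\<bar>of_int q :: real\<bar> < real Q" using s Q by linarith
      then show False using that by auto
    qed
    then have "periodize g j l s = ?c * (\<Sum>q\<in>{- int Q..int Q}. g (2 ^ j * (s - of_int q) - of_int (int l)))"
      unfolding periodize_eq_periodize_int by (intro periodize_int_eq_sum) auto
    also have "\<dots> = (\<Sum>q\<in>{- int Q..int Q}. G q s)"
      by (simp add: G_def sum_distrib_left algebra_simps)
    finally show ?thesis by (simp add: P_def sum_distrib_left)
  qed (simp add: P_def)
  have FG: "integrable lborel (\<lambda>s. F s * G q s)" for q
    using L2_on_mult_integrable[OF F2 G2[of q]] by (simp add: set_integrable_def)
  have Pi: "integrable lborel P" unfolding PG[abs_def] using FG by (intro Bochner_Integration.integrable_sum)
  have Ps: "P s = 0" if "\<bar>s\<bar> \<ge> real N" for s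
    using Fnz[of s] that N by (cases "F s = 0") (auto simp: P_def)
  have "L2_inner unit_interval (periodize f j k) (periodize g j l) = (LINT t:unit_interval|lborel. (\<Sum>m\<in>{- int N..int N}. P (t - of_int m)))"
    unfolding L2_inner_def set_lebesgue_integral_def
  proof (rule Bochner_Integration.integral_cong)
    fix t :: real
    have "periodize f j k t * periodize g j l t = (\<Sum>m\<in>{- int N..int N}. P (t - of_int m))" if t: "t \<in> unit_interval"
      unfolding periodize_unit_interval[OF Rf k t N] P_def F_def periodize_eq_periodize_int[of g] periodize_int_period
      by (simp add: sum_distrib_left sum_distrib_right mult.assoc)
    then show "indicat_real unit_interval t *\<^sub>R (periodize f j k t * periodize g j l t) = indicat_real unit_interval t *\<^sub>R (\<Sum>m\<in>{- int N..int N}. P (t - of_int m))"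
      by (auto split: split_indicator)
  qed simp
  also have "\<dots> = (\<Sum>m\<in>{- int N..int N}. LINT t:unit_interval|lborel. P (t - of_int m))"
  proof -
    have "integrable lborel (\<lambda>t. P (t - of_int m))" for m :: int
      using lborel_integrable_real_affine[OF Pi, of 1 "- of_int m"] by simp
    then have "set_integrable lborel unit_interval (\<lambda>t. P (t - of_int m))" for m :: int
      unfolding set_integrable_def by (intro integrable_mult_indicator) auto
    then show ?thesis
      unfolding set_lebesgue_integral_def set_integrable_def scaleR_sum_right
      by (intro Bochner_Integration.integral_sum)
  qed
  also have "\<dots> = (LINT s|lborel. P s)" by (rule integral_unit_translates[OF Pi Ps])
  also have "\<dots> = (\<Sum>q\<in>{- int Q..int Q}. LINT s|lborel. F s * G q s)"
    unfolding PG[abs_def] using FG by (intro Bochner_Integration.integral_sum)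
  also have "\<dots> = (\<Sum>q\<in>{- int Q..int Q}. L2_inner UNIV (dilate f 0 (int k)) (dilate g 0 (int l + 2 ^ j * q)))"
    unfolding F_def G_def L2_inner_dilate_rescale ..
  finally show ?thesis by (rule that)
qed

text \<open>Two indices below 2^j are congruent modulo 2^j only if they are equal, so only q = 0 can
  contribute. With \<open>c = 1\<close> this is biorthogonality, with \<open>c = 0\<close>
  orthogonality.\<close>

lemma L2_inner_periodize_biorthogonal:
  assumes f: "f \<in> L2_on UNIV" "compactly_supported f" and g: "g \<in> L2_on UNIV" "compactly_supported g"
    and kl: "k < 2 ^ j" "l < 2 ^ j"
    and bi: "\<And>k l. L2_inner UNIV (dilate f 0 k) (dilate g 0 l) = c * of_bool (k = l)"
  shows "L2_inner unit_interval (periodize f j k) (periodize g j l) = c * of_bool (k = l)"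
proof -
  obtain Q :: nat where Q: "L2_inner unit_interval (periodize f j k) (periodize g j l) =
    (\<Sum>q\<in>{- int Q..int Q}. L2_inner UNIV (dilate f 0 (int k)) (dilate g 0 (int l + 2 ^ j * q)))"
    using L2_inner_periodize[OF f g kl] .
  have "int k = int l + 2 ^ j * q \<longleftrightarrow> q = 0 \<and> k = l" for q
  proof
    assume eq: "int k = int l + 2 ^ j * q"
    have b: "int k < 2 ^ j" "int l < 2 ^ j" using kl by (metis of_nat_less_iff of_nat_numeral of_nat_power)+
    have "int k mod 2 ^ j = int l mod 2 ^ j" unfolding eq by simp
    then have "k = l" using b by simp
    then show "q = 0 \<and> k = l" using eq by simp
  qed simp
  then have "L2_inner unit_interval (periodize f j k) (periodize g j l) = (\<Sum>q\<in>{- int Q..int Q}. if q = 0 then c * of_bool (k = l) else 0)"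
    unfolding Q bi by (intro sum.cong) auto
  also have "\<dots> = c * of_bool (k = l)" by (subst sum.delta) auto
  finally show ?thesis .
qed

lemma riesz_sequence_bounds:
  assumes "riesz_sequence A I e"
  shows "\<exists>a b. a > 0 \<and> (\<forall>F c. finite F \<and> F \<subseteq> I \<longrightarrow>
        a * (\<Sum>i\<in>F. (c i)\<^sup>2) \<le> L2_inner A (\<lambda>t. \<Sum>i\<in>F. c i * e i t) (\<lambda>t. \<Sum>i\<in>F. c i * e i t) \<and>
        L2_inner A (\<lambda>t. \<Sum>i\<in>F. c i * e i t) (\<lambda>t. \<Sum>i\<in>F. c i * e i t) \<le> b * (\<Sum>i\<in>F. (c i)\<^sup>2))"
proof -
  from assms have "\<exists>a>0. \<exists>b. \<forall>F c. finite F \<and> F \<subseteq> I \<longrightarrow>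
        a * (\<Sum>i\<in>F. (c i)\<^sup>2) \<le> L2_inner A (\<lambda>t. \<Sum>i\<in>F. c i * e i t) (\<lambda>t. \<Sum>i\<in>F. c i * e i t) \<and>
        L2_inner A (\<lambda>t. \<Sum>i\<in>F. c i * e i t) (\<lambda>t. \<Sum>i\<in>F. c i * e i t) \<le> b * (\<Sum>i\<in>F. (c i)\<^sup>2)"
    unfolding riesz_sequence_def L2_norm_on_power2 by (rule conjunct2)
  then show ?thesis by (elim exE conjE) (intro exI conjI)
qed

text \<open>On the unit interval the periodic combination is a rescaled combination of translates on
  the line in which every coefficient is repeated 2 N + 1 times. As \<open>N\<close> depends on the
  support of \<open>f\<close> alone, one \<open>C\<close> serves all levels; enlarging the domain to
  the line only increases the norm.\<close>

lemma periodize_synthesis_bound: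
  assumes f: "f \<in> L2_on UNIV" "compactly_supported f" and riesz: "riesz_sequence UNIV UNIV (dilate f 0)"
  obtains C where "C > 0" "\<And>J (a :: nat \<Rightarrow> real). L2_inner unit_interval (\<lambda>t. \<Sum>k<2^J. a k * periodize f J k t)
      (\<lambda>t. \<Sum>k<2^J. a k * periodize f J k t) \<le> C * (\<Sum>k<2^J. (a k)\<^sup>2)"
proof -
  obtain R where R: "supported_in R f" using f(2) by (rule compactly_supported_imp)
  obtain N :: nat where N: "real N \<ge> R + 2" using real_arch_simple by blast
  from riesz_sequence_bounds[OF riesz] obtain a b where "a > 0" and b: "\<forall>F c. finite F \<and> F \<subseteq> UNIV \<longrightarrow>
        a * (\<Sum>i\<in>F. (c i)\<^sup>2) \<le> L2_inner UNIV (\<lambda>t. \<Sum>i\<in>F. c i * dilate f 0 i t) (\<lambda>t. \<Sum>i\<in>F. c i * dilate f 0 i t) \<and>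
        L2_inner UNIV (\<lambda>t. \<Sum>i\<in>F. c i * dilate f 0 i t) (\<lambda>t. \<Sum>i\<in>F. c i * dilate f 0 i t) \<le> b * (\<Sum>i\<in>F. (c i)\<^sup>2)"
    by (elim exE conjE)
  \<comment> \<open>The maximum with 1 makes the constant positive.\<close>
  define C where "C = max b 1 * (2 * real N + 1)"
  have "C > 0" by (simp add: C_def)
  moreover have "L2_inner unit_interval (\<lambda>t. \<Sum>k<2^J. a k * periodize f J k t)
      (\<lambda>t. \<Sum>k<2^J. a k * periodize f J k t) \<le> C * (\<Sum>k<2^J. (a k)\<^sup>2)" for J :: nat and a :: "nat \<Rightarrow> real"
  proof -
    \<comment> \<open>The period \<open>m\<close> of the function with index \<open>k\<close> is the
      translate on the line with index k + 2^J m.\<close>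
    define e where "e = (\<lambda>(k::nat, m::int). int k + 2 ^ J * m)"
    define D where "D = {..<2^J::nat} \<times> {- int N..int N}"
    define c where "c i = a (nat (i mod 2 ^ J))" for i :: int
    have ek: "nat (e p mod 2 ^ J) = fst p" if "p \<in> D" for p
    proof -
      have "int (fst p) < 2 ^ J" using that by (auto simp: D_def)
      then show ?thesis by (simp add: e_def split_beta)
    qed
    have inj: "inj_on e D"
    proof (rule inj_onI)
      fix p p' assume p: "p \<in> D" "p' \<in> D" "e p = e p'"
      then have "fst p = fst p'" using ek[of p] ek[of p'] by simp
      moreover from this p(3) have "snd p = snd p'" by (simp add: e_def split_beta)
      ultimately show "p = p'" by (simp add: prod_eq_iff)
    qed
    have finD: "finite D" by (simp add: D_def)
    define h where "h x = (\<Sum>i\<in>e ` D. c i * dilate f 0 i x)" for x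
    have h2: "h \<in> L2_on UNIV" unfolding h_def
      using L2_on_UNIV_affine[OF f(1), of 1 "- of_int i" for i] by (intro L2_on_lincomb) (simp add: dilate_0)
    have hD: "h x = (\<Sum>p\<in>D. a (fst p) * f (x - of_int (e p)))" for x
      unfolding h_def by (subst sum.reindex[OF inj]) (auto simp: c_def ek dilate_0 intro!: sum.cong)
    let ?g = "\<lambda>t. \<Sum>k<2^J. a k * periodize f J k t"
    have g: "?g t = 2 powr (real J / 2) * h (2 ^ J * t)" if t: "t \<in> unit_interval" for t
    proof -
      have "?g t = (\<Sum>k<2^J. \<Sum>m\<in>{- int N..int N}. 2 powr (real J / 2) * (a k * f (2 ^ J * (t - of_int m) - real k)))"
        using periodize_unit_interval[OF R _ t N] by (simp add: sum_distrib_left mult.left_commute)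
      also have "\<dots> = (\<Sum>p\<in>D. 2 powr (real J / 2) * (a (fst p) * f (2 ^ J * (t - of_int (snd p)) - real (fst p))))"
        unfolding D_def by (simp add: sum.cartesian_product split_beta)
      also have "\<dots> = 2 powr (real J / 2) * h (2 ^ J * t)"
        unfolding hD sum_distrib_left by (intro sum.cong) (auto simp: e_def split_beta algebra_simps)
      finally show ?thesis .
    qed
    have p: "2 powr (real J / 2) * 2 powr (real J / 2) = (2 ^ J :: real)"
      by (simp add: powr_realpow flip: powr_add)
    have hi: "integrable lborel (\<lambda>x. (h x)\<^sup>2)" using h2 by (simp add: L2_on_iff)
    have hi2: "integrable lborel (\<lambda>t. 2 ^ J * (h (2 ^ J * t))\<^sup>2)"
      using lborel_integrable_real_affine[OF hi, of "2 ^ J" 0] by simp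
    have "L2_inner unit_interval ?g ?g = (LINT t|lborel. indicator unit_interval t *\<^sub>R (2 ^ J * (h (2 ^ J * t))\<^sup>2))"
      unfolding L2_inner_def set_lebesgue_integral_def
      by (intro Bochner_Integration.integral_cong) (auto simp: g p[symmetric] power2_eq_square ac_simps split: split_indicator)
    also have "\<dots> \<le> (LINT t|lborel. 2 ^ J * (h (2 ^ J * t))\<^sup>2)"
      using hi2 by (intro integral_mono integrable_mult_indicator) (auto split: split_indicator)
    also have "\<dots> = 2 ^ J * (LINT t|lborel. (h (2 ^ J * t))\<^sup>2)" by simp
    also have "\<dots> = (LINT x|lborel. (h x)\<^sup>2)"
      by (subst (2) lborel_integral_real_affine[where c = "2 ^ J" and t = 0]) auto
    also have "\<dots> = L2_inner UNIV h h"
      by (simp add: L2_inner_def set_lebesgue_integral_def power2_eq_square)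
    also have "\<dots> \<le> b * (\<Sum>i\<in>e ` D. (c i)\<^sup>2)" unfolding h_def[abs_def] using b[rule_format, of "e ` D" c] finD by simp
    also have "\<dots> \<le> max b 1 * (\<Sum>i\<in>e ` D. (c i)\<^sup>2)" by (intro mult_right_mono) (auto intro: sum_nonneg)
    also have "(\<Sum>i\<in>e ` D. (c i)\<^sup>2) = (\<Sum>p\<in>D. (a (fst p))\<^sup>2)"
      by (subst sum.reindex[OF inj]) (auto simp: c_def ek intro!: sum.cong)
    also have "\<dots> = (\<Sum>k<2^J. \<Sum>m\<in>{- int N..int N}. (a k)\<^sup>2)"
      unfolding D_def sum.cartesian_product by (intro sum.cong) auto
    also have "\<dots> = (2 * real N + 1) * (\<Sum>k<2^J. (a k)\<^sup>2)" by (simp add: sum_distrib_left)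
    finally show ?thesis by (simp add: C_def mult.assoc)
  qed
  ultimately show ?thesis by (rule that)
qed

section \<open>Two-scale relations after periodization\<close>

lemma periodize_int_two_scale:
  assumes \<phi>: "compactly_supported \<phi>" and ts: "two_scale \<phi> f"
  shows "\<exists>K h. finite (K :: int set) \<and>
    (\<forall>j i. AE t in lborel. periodize_int f j i t = (\<Sum>l\<in>K. h l * periodize_int \<phi> (Suc j) (2 * i + l) t))"
proof -
  obtain K h where K: "finite (K :: int set)" and h: "AE x in lborel. f x = (\<Sum>l\<in>K. h l * dilate \<phi> 1 l x)"
    using ts by (auto simp: two_scale_def)
  obtain R where R: "supported_in R \<phi>" using \<phi> by (rule compactly_supported_imp)
  have "AE t in lborel. periodize_int f j i t = (\<Sum>l\<in>K. h l * periodize_int \<phi> (Suc j) (2 * i + l) t)" for j i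
  proof -
    \<comment> \<open>There are countably many translates, hence one null set serves all
      \<open>m\<close>.\<close>
    have "AE t in lborel. \<forall>m :: int. f (2 ^ j * (t - of_int m) - of_int i) = (\<Sum>l\<in>K. h l * dilate \<phi> 1 l (2 ^ j * (t - of_int m) - of_int i))"
      unfolding AE_all_countable
    proof
      fix m :: int
      have "AE t in lborel. f (2 ^ j * t + (- (2 ^ j) * of_int m - of_int i)) =
         (\<Sum>l\<in>K. h l * dilate \<phi> 1 l (2 ^ j * t + (- (2 ^ j) * of_int m - of_int i)))"
        by (rule AE_lborel_affine[OF h]) simp
      then show "AE t in lborel. f (2 ^ j * (t - of_int m) - of_int i) = (\<Sum>l\<in>K. h l * dilate \<phi> 1 l (2 ^ j * (t - of_int m) - of_int i))"
        by (simp add: algebra_simps)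
    qed
    then show ?thesis
    proof eventually_elim
      fix t :: real
      assume *: "\<forall>m :: int. f (2 ^ j * (t - of_int m) - of_int i) = (\<Sum>l\<in>K. h l * dilate \<phi> 1 l (2 ^ j * (t - of_int m) - of_int i))"
      have d: "dilate \<phi> 1 l (2 ^ j * (t - of_int m) - of_int i) = 2 powr (1/2) * \<phi> (2 ^ Suc j * (t - of_int m) - of_int (2 * i + l))" for l m :: int
        by (simp add: dilate_def algebra_simps)
      \<comment> \<open>The periods in which some refined translate is nonzero at \<open>t\<close>;
        finiteness of this set allows the sums over \<open>m\<close> and \<open>l\<close> to be
        interchanged.\<close>
      define F where "F = (\<Union>l\<in>K. {m :: int. \<phi> (2 ^ Suc j * (t - of_int m) - of_int (2 * i + l)) \<noteq> 0})"
      have "finite {m :: int. \<phi> (2 ^ Suc j * (t - of_int m) - of_int (2 * i + l)) \<noteq> 0}" for l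
      proof (rule finite_subset)
        let ?c = "(of_int (2 * i + l)) / 2 ^ Suc j :: real"
        show "{m :: int. \<phi> (2 ^ Suc j * (t - of_int m) - of_int (2 * i + l)) \<noteq> 0} \<subseteq> {\<lfloor>t - ?c - R\<rfloor>..\<lceil>t - ?c + R\<rceil>}"
        proof safe
          fix m :: int assume "\<phi> (2 ^ Suc j * (t - of_int m) - of_int (2 * i + l)) \<noteq> 0"
          then have "\<bar>2 ^ Suc j * (t - of_int m) - of_int (2 * i + l)\<bar> \<le> R" using R by (auto simp: supported_in_def not_less[symmetric])
          moreover have "2 ^ Suc j * (t - of_int m) - of_int (2 * i + l) = 2 ^ Suc j * (t - of_int m - ?c)"
            by (simp add: field_simps)
          ultimately have le: "2 ^ Suc j * \<bar>t - of_int m - ?c\<bar> \<le> R" by (simp only: abs_mult power_abs abs_numeral)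
          have "1 * \<bar>t - of_int m - ?c\<bar> \<le> 2 ^ Suc j * \<bar>t - of_int m - ?c\<bar>" by (intro mult_right_mono one_le_power) auto
          from order_trans[OF this le] have "\<bar>t - of_int m - ?c\<bar> \<le> R" by (simp only: mult_1)
          then have "t - ?c - R \<le> of_int m" "of_int m \<le> t - ?c + R" by linarith+
          then show "m \<in> {\<lfloor>t - ?c - R\<rfloor>..\<lceil>t - ?c + R\<rceil>}" by (simp add: floor_le_iff le_ceiling_iff)
        qed
      qed simp
      then have F: "finite F" using K by (simp add: F_def)
      have Fz: "\<phi> (2 ^ Suc j * (t - of_int m) - of_int (2 * i + l)) = 0" if "m \<notin> F" "l \<in> K" for m l
        using that by (auto simp: F_def)
      have z: "f (2 ^ j * (t - of_int m) - of_int i) = 0" if "m \<notin> F" for m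
      proof -
        have "(\<Sum>l\<in>K. h l * dilate \<phi> 1 l (2 ^ j * (t - of_int m) - of_int i)) = 0"
        proof (rule sum.neutral, rule ballI)
          fix l assume "l \<in> K"
          show "h l * dilate \<phi> 1 l (2 ^ j * (t - of_int m) - of_int i) = 0"
            unfolding d Fz[OF that \<open>l \<in> K\<close>] by simp
        qed
        with * show ?thesis by simp
      qed
      have "periodize_int f j i t = 2 powr (real j / 2) * (\<Sum>m\<in>F. f (2 ^ j * (t - of_int m) - of_int i))"
        using z F by (rule periodize_int_eq_sum)
      also have "\<dots> = 2 powr (real j / 2) * (\<Sum>m\<in>F. \<Sum>l\<in>K. h l * (2 powr (1/2) * \<phi> (2 ^ Suc j * (t - of_int m) - of_int (2 * i + l))))"
        using * d by simp
      also have "\<dots> = 2 powr (real j / 2) * (\<Sum>l\<in>K. \<Sum>m\<in>F. h l * (2 powr (1/2) * \<phi> (2 ^ Suc j * (t - of_int m) - of_int (2 * i + l))))"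
        by (subst sum.swap) simp
      also have "\<dots> = (\<Sum>l\<in>K. h l * (2 powr (real j / 2) * 2 powr (1/2) * (\<Sum>m\<in>F. \<phi> (2 ^ Suc j * (t - of_int m) - of_int (2 * i + l)))))"
        by (simp add: sum_distrib_left mult_ac)
      also have "2 powr (real j / 2) * 2 powr (1/2) = 2 powr (real (Suc j) / 2)"
        by (simp add: add_divide_distrib add.commute flip: powr_add)
      also have "(\<Sum>l\<in>K. h l * (2 powr (real (Suc j) / 2) * (\<Sum>m\<in>F. \<phi> (2 ^ Suc j * (t - of_int m) - of_int (2 * i + l))))) =
         (\<Sum>l\<in>K. h l * periodize_int \<phi> (Suc j) (2 * i + l) t)"
        using F Fz by (intro sum.cong refl arg_cong2[where f = "(*)"] periodize_int_eq_sum[symmetric]) auto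
      finally show "periodize_int f j i t = (\<Sum>l\<in>K. h l * periodize_int \<phi> (Suc j) (2 * i + l) t)" .
    qed
  qed
  with K show ?thesis by (intro exI conjI allI)
qed

text \<open>The periodic primal space of level \<open>J\<close>, up to null sets of the line. The
  reconstructions live in the dual spaces \<open>level_space \<phi>d J\<close>, while the wavelets
  that measure coefficients live here.\<close>

definition scaling_span :: "(real \<Rightarrow> real) \<Rightarrow> nat \<Rightarrow> (real \<Rightarrow> real) \<Rightarrow> bool" where
  "scaling_span \<phi> J u \<longleftrightarrow> (\<exists>c. AE t in lborel. u t = (\<Sum>k<2^J. c k * periodize \<phi> J k t))"

lemma scaling_span_lincomb:
  assumes "finite I" "\<And>i. i \<in> I \<Longrightarrow> scaling_span \<phi> J (u i)" and "AE t in lborel. v t = (\<Sum>i\<in>I. a i * u i t)"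
  shows "scaling_span \<phi> J v"
proof -
  obtain c where c: "\<And>i. i \<in> I \<Longrightarrow> AE t in lborel. u i t = (\<Sum>k<2^J. c i k * periodize \<phi> J k t)"
    using assms(2) unfolding scaling_span_def by metis
  then have "AE t in lborel. \<forall>i\<in>I. u i t = (\<Sum>k<2^J. c i k * periodize \<phi> J k t)"
    using assms(1) by (subst AE_finite_all) auto
  with assms(3) have "AE t in lborel. v t = (\<Sum>k<2^J. (\<Sum>i\<in>I. a i * c i k) * periodize \<phi> J k t)"
  proof eventually_elim
    case (elim t)
    then have "v t = (\<Sum>i\<in>I. \<Sum>k<2^J. a i * (c i k * periodize \<phi> J k t))" by (simp add: sum_distrib_left)
    also have "\<dots> = (\<Sum>k<2^J. \<Sum>i\<in>I. a i * (c i k * periodize \<phi> J k t))" by (rule sum.swap)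
    finally show ?case by (simp add: sum_distrib_right mult.assoc)
  qed
  then show ?thesis unfolding scaling_span_def by (intro exI[of _ "\<lambda>k. \<Sum>i\<in>I. a i * c i k"])
qed

lemma scaling_span_periodize_int: "scaling_span \<phi> J (periodize_int \<phi> J i)"
proof -
  let ?k = "nat (i mod 2 ^ J)"
  have k: "?k < 2 ^ J" by (simp add: nat_less_iff)
  have "periodize_int \<phi> J i t = (\<Sum>k<2^J. (if k = ?k then 1 else 0) * periodize \<phi> J k t)" for t
    unfolding periodize_int_mod using k by (simp add: if_distrib[of "\<lambda>x. x * _"] sum.delta cong: if_cong)
  then show ?thesis unfolding scaling_span_def by (intro exI[of _ "\<lambda>k. if k = ?k then 1 else 0"]) simp
qed

lemma scaling_span_two_scale:
  assumes "compactly_supported \<phi>" "two_scale \<phi> f"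
  shows "scaling_span \<phi> (Suc j) (periodize_int f j i)"
proof -
  from periodize_int_two_scale[OF assms] obtain K h where K: "finite (K :: int set)"
    and h: "\<forall>j i. AE t in lborel. periodize_int f j i t = (\<Sum>l\<in>K. h l * periodize_int \<phi> (Suc j) (2 * i + l) t)"
    by (elim exE conjE)
  show ?thesis by (rule scaling_span_lincomb[OF K _ h[rule_format]]) (rule scaling_span_periodize_int)
qed

lemma scaling_span_Suc:
  assumes "compactly_supported \<phi>" "two_scale \<phi> \<phi>" "scaling_span \<phi> J u"
  shows "scaling_span \<phi> (Suc J) u"
proof -
  obtain c where "AE t in lborel. u t = (\<Sum>k<2^J. c k * periodize \<phi> J k t)"
    using assms(3) by (auto simp: scaling_span_def)
  then show ?thesis
    by (rule scaling_span_lincomb[rotated 2]) (auto simp: periodize_eq_periodize_int intro: scaling_span_two_scale assms)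
qed

lemma scaling_span_mono:
  assumes "compactly_supported \<phi>" "two_scale \<phi> \<phi>" "scaling_span \<phi> J u" "J \<le> J'"
  shows "scaling_span \<phi> J' u"
  using assms(4) by (induction rule: dec_induct) (use assms in \<open>auto intro: scaling_span_Suc\<close>)

section \<open>Discrete wavelets\<close>

lemma Omega_eq_Sigma: "Omega J = Sigma {..<J} (\<lambda>j. {..<2^j})"
  by (auto simp: Omega_def)

lemma finite_Omega [simp]: "finite (Omega J)"
  by (simp add: Omega_eq_Sigma)

lemma card_Omega: "card (Omega J) = 2 ^ J - 1"
proof -
  have "card (Omega J) = (\<Sum>j<J. 2 ^ j)" by (simp add: Omega_eq_Sigma)
  also have "\<dots> = 2 ^ J - 1" by (induction J) auto
  finally show ?thesis .
qed

lemma dot_commute: "dot n x y = dot n y x"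
  by (simp add: dot_def mult.commute)

lemma enorm_on_power2: "(enorm_on n x)\<^sup>2 = dot n x x"
  by (simp add: enorm_on_def dot_def sum_nonneg)

locale periodic_wavelets =
  fixes \<phi> \<psi> \<phi>d \<psi>d :: "real \<Rightarrow> real"
  assumes wavelets: "biorthogonal_wavelets \<phi> \<psi> \<phi>d \<psi>d"
    and periodic: "periodic_multiresolution \<phi> \<psi> \<phi>d \<psi>d"
begin

abbreviation ip :: "(real \<Rightarrow> real) \<Rightarrow> (real \<Rightarrow> real) \<Rightarrow> real" where
  "ip \<equiv> L2_inner unit_interval"

lemma generators:
  "\<phi> \<in> L2_on UNIV" "compactly_supported \<phi>" "\<psi> \<in> L2_on UNIV" "compactly_supported \<psi>"
  "\<phi>d \<in> L2_on UNIV" "compactly_supported \<phi>d" "\<psi>d \<in> L2_on UNIV" "compactly_supported \<psi>d"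
  using wavelets unfolding biorthogonal_wavelets_def by simp_all

lemma two_scales: "two_scale \<phi> \<phi>" "two_scale \<phi> \<psi>"
  using wavelets unfolding biorthogonal_wavelets_def multiresolution_def by simp_all

lemma riesz_scaling: "riesz_sequence UNIV UNIV (dilate \<phi> 0)" "riesz_sequence UNIV UNIV (dilate \<phi>d 0)"
  using wavelets unfolding biorthogonal_wavelets_def multiresolution_def by simp_all

lemma line_biorthogonality:
  "L2_inner UNIV (dilate \<phi> 0 k) (dilate \<phi>d 0 l) = of_bool (k = l)"
  "L2_inner UNIV (dilate \<phi> 0 k) (dilate \<psi>d 0 l) = 0"
  "L2_inner UNIV (dilate \<psi> 0 k) (dilate \<phi>d 0 l) = 0"
  using wavelets unfolding biorthogonal_wavelets_def by simp_all

lemma periodic_L2 [simp]: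
  assumes "k < 2 ^ j"
  shows "periodize \<phi> j k \<in> L2_on unit_interval" "periodize \<psi> j k \<in> L2_on unit_interval"
    "periodize \<phi>d j k \<in> L2_on unit_interval" "periodize \<psi>d j k \<in> L2_on unit_interval"
  using generators assms by (auto intro: periodize_L2)

lemma biorthogonality:
  assumes "k < 2 ^ j" "l < 2 ^ j"
  shows "ip (periodize \<phi> j k) (periodize \<phi>d j l) = of_bool (k = l)"
    "ip (periodize \<phi> j k) (periodize \<psi>d j l) = 0"
    "ip (periodize \<psi> j k) (periodize \<phi>d j l) = 0"
  using L2_inner_periodize_biorthogonal[OF generators(1,2) generators(5,6) assms, of 1]
    L2_inner_periodize_biorthogonal[OF generators(1,2) generators(7,8) assms, of 0]
    L2_inner_periodize_biorthogonal[OF generators(3,4) generators(5,6) assms, of 0]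
  by (simp_all add: line_biorthogonality)

definition synth :: "(real \<Rightarrow> real) \<Rightarrow> nat \<Rightarrow> (nat \<Rightarrow> real) \<Rightarrow> real \<Rightarrow> real" where
  "synth f J c t = (\<Sum>k<2^J. c k * periodize f J k t)"

lemma level_space_eq: "level_space f J = range (synth f J)"
  by (auto simp: level_space_def synth_def fun_eq_iff image_def)

lemma synth_L2: "synth \<phi>d J c \<in> L2_on unit_interval" "synth \<psi>d J c \<in> L2_on unit_interval"
  unfolding synth_def[abs_def] by (rule L2_on_lincomb; simp)+

lemma ip_synth_right:
  assumes "u \<in> L2_on unit_interval"
  shows "ip u (synth \<phi>d J c) = (\<Sum>k<2^J. c k * ip u (periodize \<phi>d J k))"
    "ip u (synth \<psi>d J c) = (\<Sum>k<2^J. c k * ip u (periodize \<psi>d J k))"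
  unfolding synth_def[abs_def] using assms by (auto intro!: L2_inner_lincomb_right)

lemma ip_phi_synth: "k < 2 ^ J \<Longrightarrow> ip (periodize \<phi> J k) (synth \<phi>d J c) = c k"
  by (simp add: ip_synth_right biorthogonality of_bool_def if_distrib[of "\<lambda>x. _ * x"] sum.delta cong: if_cong)

lemma ip_psi_synth: "k < 2 ^ J \<Longrightarrow> ip (periodize \<psi> J k) (synth \<phi>d J c) = 0"
  by (simp add: ip_synth_right biorthogonality)

lemma ip_phi_synth_psi: "k < 2 ^ J \<Longrightarrow> ip (periodize \<phi> J k) (synth \<psi>d J c) = 0"
  by (simp add: ip_synth_right biorthogonality)

text \<open>By biorthogonality the scaling coefficients of a dual combination are its own
  coefficients, so the interpolant uses the samples as coefficients.\<close>

lemma u_star_eq: "u_star \<phi> \<phi>d J x = synth \<phi>d J x"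
  unfolding u_star_def
proof (rule the_equality)
  show "synth \<phi>d J x \<in> level_space \<phi>d J \<and> (\<forall>k<2 ^ J. ip (periodize \<phi> J k) (synth \<phi>d J x) = x k)"
    by (simp add: level_space_eq ip_phi_synth)
next
  fix f assume f: "f \<in> level_space \<phi>d J \<and> (\<forall>k<2 ^ J. ip (periodize \<phi> J k) f = x k)"
  then obtain c where c: "f = synth \<phi>d J c" by (auto simp: level_space_eq)
  with f have "c k = x k" if "k < 2 ^ J" for k using that by (simp add: ip_phi_synth)
  then show "f = synth \<phi>d J x" unfolding c by (auto simp: synth_def fun_eq_iff intro!: sum.cong)
qed

abbreviation dw :: "nat \<Rightarrow> nat \<times> nat \<Rightarrow> nat \<Rightarrow> real" where
  "dw \<equiv> discrete_wavelet \<phi> \<psi> \<phi>d"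

abbreviation psi :: "nat \<times> nat \<Rightarrow> real \<Rightarrow> real" where
  "psi \<omega> \<equiv> periodize \<psi> (fst \<omega>) (snd \<omega>)"

lemma psi_L2: "\<omega> \<in> Omega J \<Longrightarrow> psi \<omega> \<in> L2_on unit_interval"
  by (auto simp: Omega_def)

lemma dw_eq:
  assumes \<omega>: "\<omega> \<in> Omega J"
  shows "dw J \<omega> = (\<lambda>k\<in>{..<2^J}. ip (psi \<omega>) (periodize \<phi>d J k))"
  unfolding discrete_wavelet_def u_star_eq
proof (rule the_equality)
  let ?w = "\<lambda>k\<in>{..<2^J}. ip (psi \<omega>) (periodize \<phi>d J k)"
  have w: "dot (2 ^ J) ?w x = ip (psi \<omega>) (synth \<phi>d J x)" for x
    using psi_L2[OF \<omega>] by (simp add: dot_def ip_synth_right mult.commute)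
  then show "?w \<in> Rn (2 ^ J) \<and> (\<forall>x\<in>Rn (2 ^ J). dot (2 ^ J) ?w x = ip (psi \<omega>) (synth \<phi>d J x))"
    by (simp add: Rn_def)
  fix v assume v: "v \<in> Rn (2 ^ J) \<and> (\<forall>x\<in>Rn (2 ^ J). dot (2 ^ J) v x = ip (psi \<omega>) (synth \<phi>d J x))"
  show "v = ?w"
  proof (rule PiE_ext)
    show "v \<in> {..<2^J} \<rightarrow>\<^sub>E UNIV" "?w \<in> {..<2^J} \<rightarrow>\<^sub>E UNIV" using v by (auto simp: Rn_def)
    fix k :: nat assume k: "k \<in> {..<2^J}"
    let ?x = "\<lambda>i\<in>{..<2^J}. of_bool (i = k) :: real"
    have x: "?x \<in> Rn (2 ^ J)" by (simp add: Rn_def)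
    have "dot (2 ^ J) y ?x = y k" for y
    proof -
      have "dot (2 ^ J) y ?x = (\<Sum>i<2^J. if i = k then y i else 0)" unfolding dot_def by (intro sum.cong) auto
      also have "\<dots> = y k" using k by (subst sum.delta) auto
      finally show ?thesis .
    qed
    then show "v k = ?w k" using v x w by metis
  qed
qed

lemma dw_Rn: "\<omega> \<in> Omega J \<Longrightarrow> dw J \<omega> \<in> Rn (2 ^ J)"
  by (simp add: dw_eq Rn_def)

lemma dot_dw: "\<omega> \<in> Omega J \<Longrightarrow> dot (2 ^ J) (dw J \<omega>) x = ip (psi \<omega>) (synth \<phi>d J x)"
  using psi_L2 by (simp add: dw_eq dot_def ip_synth_right mult.commute)

lemma scaling_expansion:
  assumes span: "scaling_span \<phi> J u" and u: "u \<in> L2_on unit_interval"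
  shows "AE t\<in>unit_interval in lborel. u t = (\<Sum>k<2^J. ip u (periodize \<phi>d J k) * periodize \<phi> J k t)"
proof -
  obtain c where c: "AE t in lborel. u t = (\<Sum>k<2^J. c k * periodize \<phi> J k t)"
    using span by (auto simp: scaling_span_def)
  have "ip u (periodize \<phi>d J k) = c k" if k: "k < 2 ^ J" for k
  proof -
    have "ip u (periodize \<phi>d J k) = ip (\<lambda>t. \<Sum>k<2^J. c k * periodize \<phi> J k t) (periodize \<phi>d J k)"
      using c u k by (intro L2_inner_cong_AE_left L2_on_lincomb) auto
    also have "\<dots> = (\<Sum>l<2^J. c l * ip (periodize \<phi> J l) (periodize \<phi>d J k))"
      using k by (intro L2_inner_lincomb_left) auto
    also have "\<dots> = (\<Sum>l<2^J. if l = k then c l else 0)" using k by (intro sum.cong) (auto simp: biorthogonality)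
    also have "\<dots> = c k" using k by (subst sum.delta) auto
    finally show ?thesis .
  qed
  then show ?thesis using c by auto
qed

lemma ip_scaling_expansion:
  assumes "scaling_span \<phi> J u" "u \<in> L2_on unit_interval" "v \<in> L2_on unit_interval"
  shows "ip u v = (\<Sum>k<2^J. ip u (periodize \<phi>d J k) * ip (periodize \<phi> J k) v)"
proof -
  have "ip u v = ip (\<lambda>t. \<Sum>k<2^J. ip u (periodize \<phi>d J k) * periodize \<phi> J k t) v"
    using assms by (intro L2_inner_cong_AE_left scaling_expansion L2_on_lincomb) auto
  also have "\<dots> = (\<Sum>k<2^J. ip u (periodize \<phi>d J k) * ip (periodize \<phi> J k) v)"
    using assms by (intro L2_inner_lincomb_left) auto
  finally show ?thesis .
qed

section \<open>Relations between different levels\<close>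

lemma span_psi: "j < J \<Longrightarrow> scaling_span \<phi> J (periodize \<psi> j k)"
  unfolding periodize_eq_periodize_int
  by (rule scaling_span_mono[OF _ _ scaling_span_two_scale]) (use generators two_scales in auto)

lemma span_phi: "j \<le> J \<Longrightarrow> scaling_span \<phi> J (periodize \<phi> j k)"
  unfolding periodize_eq_periodize_int
  by (rule scaling_span_mono[OF _ _ scaling_span_periodize_int]) (use generators two_scales in auto)

lemma ip_span_synth_psi:
  assumes "scaling_span \<phi> J u" "u \<in> L2_on unit_interval"
  shows "ip u (synth \<psi>d J c) = 0"
  using assms synth_L2 by (subst ip_scaling_expansion) (auto simp: ip_phi_synth_psi)

text \<open>It is the wavelet, not \<open>u\<close>, that is expanded in scaling functions of level
  \<open>J\<close>; so \<open>u\<close> may be arbitrary.\<close>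

lemma ip_psi_level_coeffs:
  assumes "\<omega> \<in> Omega J" "u \<in> L2_on unit_interval"
  shows "ip (psi \<omega>) u = dot (2 ^ J) (dw J \<omega>) (level_coeffs \<phi> J u)"
proof -
  have "fst \<omega> < J" using assms by (auto simp: Omega_def)
  then show ?thesis
    using assms by (simp add: ip_scaling_expansion[OF span_psi psi_L2] dw_eq dot_def level_coeffs_def)
qed

lemma level_split:
  "\<exists>b c. AE t\<in>unit_interval in lborel. synth \<phi>d (Suc J) a t = synth \<phi>d J b t + synth \<psi>d J c t"
proof -
  have "\<forall>f\<in>level_space \<phi>d (Suc J). \<exists>g\<in>level_space \<phi>d J. \<exists>h\<in>level_space \<psi>d J. AE t\<in>unit_interval in lborel. f t = g t + h t"
    using periodic unfolding periodic_multiresolution_def by simp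
  then show ?thesis unfolding level_space_eq by blast
qed

lemma level_join:
  "\<exists>a. AE t\<in>unit_interval in lborel. synth \<phi>d (Suc J) a t = synth \<phi>d J b t + synth \<psi>d J c t"
proof -
  have "\<forall>g\<in>level_space \<phi>d J. \<forall>h\<in>level_space \<psi>d J. \<exists>f\<in>level_space \<phi>d (Suc J). AE t\<in>unit_interval in lborel. f t = g t + h t"
    using periodic unfolding periodic_multiresolution_def by simp
  then show ?thesis unfolding level_space_eq by blast
qed

lemma psi_coeffs_bij: "bij_betw (level_coeffs \<psi> J) (range (synth \<psi>d J)) (Rn (2 ^ J))"
  using periodic unfolding periodic_multiresolution_def level_space_eq by simp

lemma ip_cong_sum:
  assumes "AE t\<in>unit_interval in lborel. synth \<phi>d (Suc J) a t = synth \<phi>d J b t + synth \<psi>d J c t" "u \<in> L2_on unit_interval"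
  shows "ip u (synth \<phi>d (Suc J) a) = ip u (synth \<phi>d J b) + ip u (synth \<psi>d J c)"
proof -
  have "ip u (synth \<phi>d (Suc J) a) = ip u (\<lambda>t. synth \<phi>d J b t + synth \<psi>d J c t)"
    using assms by (intro L2_inner_cong_AE_right synth_L2 L2_on_add)
  also have "\<dots> = ip u (synth \<phi>d J b) + ip u (synth \<psi>d J c)"
    using assms by (intro L2_inner_add_right synth_L2)
  finally show ?thesis .
qed

lemma level_mono:
  assumes "J \<le> J'"
  shows "\<exists>b. AE t\<in>unit_interval in lborel. synth \<phi>d J a t = synth \<phi>d J' b t"
  using assms
proof (induction rule: dec_induct)
  case base
  show ?case by (intro exI[of _ a]) simp
next
  case (step n)
  then obtain b where b: "AE t\<in>unit_interval in lborel. synth \<phi>d J a t = synth \<phi>d n b t" by blast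
  obtain d where d: "AE t\<in>unit_interval in lborel. synth \<phi>d (Suc n) d t = synth \<phi>d n b t + synth \<psi>d n (\<lambda>_. 0) t"
    using level_join by blast
  have "AE t\<in>unit_interval in lborel. synth \<phi>d J a t = synth \<phi>d (Suc n) d t"
    using b d by eventually_elim (auto simp: synth_def)
  then show ?case by blast
qed

text \<open>The dual spaces increase with the level, and the wavelets of level \<open>j\<close>
  annihilate the dual space of the same level.\<close>

lemma ip_psi_fine:
  assumes "J \<le> j" "k < 2 ^ j"
  shows "ip (periodize \<psi> j k) (synth \<phi>d J a) = 0"
proof -
  obtain b where "AE t\<in>unit_interval in lborel. synth \<phi>d J a t = synth \<phi>d j b t"
    using level_mono[OF assms(1)] by blast
  then have "ip (periodize \<psi> j k) (synth \<phi>d J a) = ip (periodize \<psi> j k) (synth \<phi>d j b)"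
    using assms by (intro L2_inner_cong_AE_right synth_L2) auto
  then show ?thesis using assms by (simp add: ip_psi_synth)
qed

text \<open>Detail components are added from coarse to fine. A new component in the dual wavelet
  space of level \<open>J\<close> is invisible to the scaling function and to all coarser wavelets,
  which lie in the primal space of level \<open>J\<close>; the old part is invisible to the wavelets
  of level \<open>J\<close>. So each prescription is met without disturbing the others.\<close>

lemma synthesis_exists:
  "\<exists>a. ip (periodize \<phi> 0 0) (synth \<phi>d J a) = 0 \<and> (\<forall>\<omega>\<in>Omega J. ip (psi \<omega>) (synth \<phi>d J a) = y \<omega>)"
proof (induction J)
  case 0
  show ?case by (intro exI[of _ "\<lambda>_. 0"]) (simp add: Omega_def ip_synth_right)
next
  case (Suc J)
  then obtain b where b: "ip (periodize \<phi> 0 0) (synth \<phi>d J b) = 0" "\<forall>\<omega>\<in>Omega J. ip (psi \<omega>) (synth \<phi>d J b) = y \<omega>" by blast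
  have "(\<lambda>k\<in>{..<2^J}. y (J, k)) \<in> Rn (2 ^ J)" by (simp add: Rn_def)
  then have "(\<lambda>k\<in>{..<2^J}. y (J, k)) \<in> level_coeffs \<psi> J ` range (synth \<psi>d J)"
    unfolding bij_betw_imp_surj_on[OF psi_coeffs_bij] .
  then obtain c where c: "(\<lambda>k\<in>{..<2^J}. y (J, k)) = level_coeffs \<psi> J (synth \<psi>d J c)"
    by (elim imageE) simp
  have hc: "ip (periodize \<psi> J k) (synth \<psi>d J c) = y (J, k)" if "k < 2 ^ J" for k
    using fun_cong[OF c, of k] that by (simp add: level_coeffs_def)
  obtain a where a: "AE t\<in>unit_interval in lborel. synth \<phi>d (Suc J) a t = synth \<phi>d J b t + synth \<psi>d J c t"
    using level_join by blast
  have 0: "ip (periodize \<phi> 0 0) (synth \<phi>d (Suc J) a) = 0"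
    using b by (simp add: ip_cong_sum[OF a] ip_span_synth_psi[OF span_phi])
  have "ip (psi \<omega>) (synth \<phi>d (Suc J) a) = y \<omega>" if \<omega>: "\<omega> \<in> Omega (Suc J)" for \<omega>
  proof (cases "\<omega> \<in> Omega J")
    case True
    then have "fst \<omega> < J" by (auto simp: Omega_def)
    with True show ?thesis
      using b psi_L2[OF True] by (simp add: ip_cong_sum[OF a] ip_span_synth_psi[OF span_psi])
  next
    case False
    then obtain k where k: "\<omega> = (J, k)" "k < 2 ^ J" using \<omega> by (auto simp: Omega_def less_Suc_eq)
    then show ?thesis by (simp add: ip_cong_sum[OF a] ip_psi_synth hc)
  qed
  with 0 show ?case by blast
qed

text \<open>The finest detail component is peeled off: the wavelets of the finest level see that
  component only, so the coefficient bijection forces it to vanish, and the element agrees almost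
  everywhere with one of the coarser level.\<close>

lemma analysis_injective:
  assumes "ip (periodize \<phi> 0 0) (synth \<phi>d J a) = 0" "\<forall>\<omega>\<in>Omega J. ip (psi \<omega>) (synth \<phi>d J a) = 0" "k < 2 ^ J"
  shows "a k = 0"
  using assms
proof (induction J arbitrary: a k)
  case 0
  then show ?case using ip_phi_synth[of 0 0 a] by simp
next
  case (Suc J)
  obtain b c where bc: "AE t\<in>unit_interval in lborel. synth \<phi>d (Suc J) a t = synth \<phi>d J b t + synth \<psi>d J c t"
    using level_split by blast
  have c0: "ip (periodize \<psi> J l) (synth \<psi>d J c) = 0" if l: "l < 2 ^ J" for l
  proof -
    have "(J, l) \<in> Omega (Suc J)" using l by (simp add: Omega_def)
    then have "ip (periodize \<psi> J l) (synth \<phi>d (Suc J) a) = 0" using Suc.prems(2) by force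
    then show ?thesis using l by (simp add: ip_cong_sum[OF bc] ip_psi_synth)
  qed
  have "level_coeffs \<psi> J (synth \<psi>d J c) = level_coeffs \<psi> J (synth \<psi>d J (\<lambda>_. 0))"
  proof -
    have "ip (periodize \<psi> J l) (synth \<psi>d J (\<lambda>_. 0)) = 0" if "l < 2 ^ J" for l
      using that by (simp add: ip_synth_right)
    then show ?thesis by (auto simp: level_coeffs_def fun_eq_iff c0)
  qed
  then have c: "synth \<psi>d J c = synth \<psi>d J (\<lambda>_. 0)"
    using psi_coeffs_bij[of J] by (auto simp: bij_betw_def dest: inj_onD)
  have u: "ip u (synth \<phi>d (Suc J) a) = ip u (synth \<phi>d J b)" if "u \<in> L2_on unit_interval" for u
    using ip_cong_sum[OF bc that] that unfolding c by (simp add: ip_synth_right)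
  have "b l = 0" if "l < 2 ^ J" for l
  proof (rule Suc.IH[OF _ _ that])
    show "ip (periodize \<phi> 0 0) (synth \<phi>d J b) = 0" using Suc.prems(1) u by simp
    show "\<forall>\<omega>\<in>Omega J. ip (psi \<omega>) (synth \<phi>d J b) = 0"
    proof
      fix \<omega> assume \<omega>: "\<omega> \<in> Omega J"
      then have "\<omega> \<in> Omega (Suc J)" by (auto simp: Omega_def)
      then show "ip (psi \<omega>) (synth \<phi>d J b) = 0" using Suc.prems(2) u psi_L2[OF \<omega>] by metis
    qed
  qed
  \<comment> \<open>The coefficient \<open>a k\<close> is read off by a scaling function of level
    \<open>Suc J\<close>, while the vanishing element is the one written at level
    \<open>J\<close>.\<close>
  moreover have "ip (periodize \<phi> (Suc J) k) (synth \<phi>d (Suc J) a) = ip (periodize \<phi> (Suc J) k) (synth \<phi>d J b)"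
    by (rule u) (use Suc.prems(3) in simp)
  ultimately have "ip (periodize \<phi> (Suc J) k) (synth \<phi>d (Suc J) a) = 0"
    using Suc.prems(3) by (simp add: ip_synth_right(1)[of _ J])
  then show ?case using Suc.prems(3) by (simp add: ip_phi_synth)
qed

section \<open>Inversion of the discrete wavelet transform\<close>

lemma W_op_dw: "\<omega> \<in> Omega J \<Longrightarrow> W_op \<phi> \<psi> \<phi>d J x \<omega> = ip (psi \<omega>) (synth \<phi>d J x)"
  by (simp add: W_op_def dot_dw)

lemma wavelet_part_eq: "wavelet_part \<phi> \<phi>d J = {x \<in> Rn (2 ^ J). ip (periodize \<phi> 0 0) (synth \<phi>d J x) = 0}"
  by (simp add: wavelet_part_def u_star_eq)

lemma synth_cong:
  assumes "\<And>k. k < 2 ^ J \<Longrightarrow> a k = b k"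
  shows "synth \<phi>d J a = synth \<phi>d J b"
  using assms by (auto simp: synth_def fun_eq_iff intro!: sum.cong)

lemma ip_synth_diff:
  assumes "u \<in> L2_on unit_interval"
  shows "ip u (synth \<phi>d J (\<lambda>k. a k - b k)) = ip u (synth \<phi>d J a) - ip u (synth \<phi>d J b)"
  using assms by (simp add: ip_synth_right left_diff_distrib sum_subtractf)

lemma W_op_inj: "inj_on (W_op \<phi> \<psi> \<phi>d J) (wavelet_part \<phi> \<phi>d J)"
proof (rule inj_onI)
  fix x y assume x: "x \<in> wavelet_part \<phi> \<phi>d J" and y: "y \<in> wavelet_part \<phi> \<phi>d J" and eq: "W_op \<phi> \<psi> \<phi>d J x = W_op \<phi> \<psi> \<phi>d J y"
  have "(\<lambda>k. x k - y k) k = 0" if "k < 2 ^ J" for k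
  proof (rule analysis_injective[OF _ _ that])
    show "ip (periodize \<phi> 0 0) (synth \<phi>d J (\<lambda>k. x k - y k)) = 0"
      using x y by (simp add: ip_synth_diff wavelet_part_eq)
    show "\<forall>\<omega>\<in>Omega J. ip (psi \<omega>) (synth \<phi>d J (\<lambda>k. x k - y k)) = 0"
    proof
      fix \<omega> assume \<omega>: "\<omega> \<in> Omega J"
      show "ip (psi \<omega>) (synth \<phi>d J (\<lambda>k. x k - y k)) = 0"
        using fun_cong[OF eq, of \<omega>] psi_L2[OF \<omega>] by (simp add: W_op_dw[OF \<omega>] ip_synth_diff)
    qed
  qed
  then show "x = y"
    using x y by (intro PiE_ext[of x "{..<2^J}" "\<lambda>_. UNIV" y]) (auto simp: wavelet_part_eq Rn_def)
qed

lemma W_op_surj: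
  assumes "y \<in> extensional (Omega J)"
  shows "y \<in> W_op \<phi> \<psi> \<phi>d J ` wavelet_part \<phi> \<phi>d J"
proof -
  obtain a where a: "ip (periodize \<phi> 0 0) (synth \<phi>d J a) = 0" "\<forall>\<omega>\<in>Omega J. ip (psi \<omega>) (synth \<phi>d J a) = y \<omega>"
    using synthesis_exists by blast
  let ?x = "restrict a {..<2^J}"
  have x: "synth \<phi>d J ?x = synth \<phi>d J a" by (rule synth_cong) simp
  have "?x \<in> wavelet_part \<phi> \<phi>d J" using a by (simp add: wavelet_part_eq x Rn_def)
  moreover have "W_op \<phi> \<psi> \<phi>d J ?x = y"
  proof (rule extensionalityI[of _ "Omega J"])
    show "W_op \<phi> \<psi> \<phi>d J ?x \<in> extensional (Omega J)" by (simp add: W_op_def)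
    show "y \<in> extensional (Omega J)" by (rule assms)
    fix \<omega> assume "\<omega> \<in> Omega J"
    then show "W_op \<phi> \<psi> \<phi>d J ?x \<omega> = y \<omega>" using a by (simp add: W_op_dw x)
  qed
  ultimately show ?thesis by blast
qed

text \<open>The thresholded coefficients belong to the image of the wavelet part, as every
  extensional array on \<open>Omega J\<close> does; on this image \<open>W_inv\<close> is a true
  inverse.\<close>

lemma estimator_coeffs:
  assumes "\<omega> \<in> Omega J"
  shows "ip (psi \<omega>) (u_star \<phi> \<phi>d J (estimator \<phi> \<psi> \<phi>d J T v)) = soft J (W_op \<phi> \<psi> \<phi>d J v) T \<omega>"
proof -
  have "soft J (W_op \<phi> \<psi> \<phi>d J v) T \<in> W_op \<phi> \<psi> \<phi>d J ` wavelet_part \<phi> \<phi>d J"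
    by (rule W_op_surj) (simp add: soft_def)
  from f_the_inv_into_f[OF W_op_inj this]
  have "W_op \<phi> \<psi> \<phi>d J (estimator \<phi> \<psi> \<phi>d J T v) = soft J (W_op \<phi> \<psi> \<phi>d J v) T"
    by (simp add: estimator_def W_inv_def)
  from fun_cong[OF this, of \<omega>] show ?thesis
    unfolding u_star_eq W_op_dw[OF assms, of "estimator \<phi> \<psi> \<phi>d J T v", symmetric] .
qed

text \<open>Upper bound: the coefficients are inner products of wavelets with the dual combination
  of \<open>x\<close>, so the Bessel bound of the wavelets is joined with the synthesis bound of
  \<open>\<phi>d\<close>. Lower bound: a combination of wavelets equals the primal combination of
  the corresponding vector, so the lower Riesz bound is joined with the synthesis bound of
  \<open>\<phi>\<close>. The constants are independent of \<open>J\<close>.\<close>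

lemma wavelet_vector_bounds:
  shows "\<exists>B>0. \<forall>J x. (\<Sum>\<omega>\<in>Omega J. (dot (2 ^ J) (dw J \<omega>) x)\<^sup>2) \<le> B * dot (2 ^ J) x x"
    and "\<exists>a>0. \<forall>J c. a * (\<Sum>\<omega>\<in>Omega J. (c \<omega>)\<^sup>2) \<le> (\<Sum>k<2^J. (\<Sum>\<omega>\<in>Omega J. c \<omega> * dw J \<omega> k)\<^sup>2)"
proof -
  obtain C where C: "C > 0" "\<And>J (a :: nat \<Rightarrow> real). ip (\<lambda>t. \<Sum>k<2^J. a k * periodize \<phi> J k t)
      (\<lambda>t. \<Sum>k<2^J. a k * periodize \<phi> J k t) \<le> C * (\<Sum>k<2^J. (a k)\<^sup>2)"
    using periodize_synthesis_bound[OF generators(1,2) riesz_scaling(1)] by blast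
  obtain Cd where Cd: "Cd > 0" "\<And>J (a :: nat \<Rightarrow> real). ip (\<lambda>t. \<Sum>k<2^J. a k * periodize \<phi>d J k t)
      (\<lambda>t. \<Sum>k<2^J. a k * periodize \<phi>d J k t) \<le> Cd * (\<Sum>k<2^J. (a k)\<^sup>2)"
    using periodize_synthesis_bound[OF generators(5,6) riesz_scaling(2)] by blast
  let ?I = "{None} \<union> Some ` {(j, k). k < 2^j}"
  have "riesz_sequence unit_interval ?I (wavelet_system \<phi> \<psi>)"
    using periodic unfolding periodic_multiresolution_def riesz_basis_def by simp
  from riesz_sequence_bounds[OF this] obtain a b where a: "a > 0"
    and ab: "\<forall>F c. finite F \<and> F \<subseteq> ?I \<longrightarrow>
        a * (\<Sum>i\<in>F. (c i)\<^sup>2) \<le> ip (\<lambda>t. \<Sum>i\<in>F. c i * wavelet_system \<phi> \<psi> i t) (\<lambda>t. \<Sum>i\<in>F. c i * wavelet_system \<phi> \<psi> i t) \<and>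
        ip (\<lambda>t. \<Sum>i\<in>F. c i * wavelet_system \<phi> \<psi> i t) (\<lambda>t. \<Sum>i\<in>F. c i * wavelet_system \<phi> \<psi> i t) \<le> b * (\<Sum>i\<in>F. (c i)\<^sup>2)"
    by (elim exE conjE)
  have riesz: "a * (\<Sum>\<omega>\<in>Omega J. (c \<omega>)\<^sup>2) \<le> ip (\<lambda>t. \<Sum>\<omega>\<in>Omega J. c \<omega> * psi \<omega> t) (\<lambda>t. \<Sum>\<omega>\<in>Omega J. c \<omega> * psi \<omega> t) \<and>
      ip (\<lambda>t. \<Sum>\<omega>\<in>Omega J. c \<omega> * psi \<omega> t) (\<lambda>t. \<Sum>\<omega>\<in>Omega J. c \<omega> * psi \<omega> t) \<le> b * (\<Sum>\<omega>\<in>Omega J. (c \<omega>)\<^sup>2)" for J c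
  proof -
    have ws: "wavelet_system \<phi> \<psi> (Some \<omega>) = psi \<omega>" for \<omega> by (cases \<omega>) simp
    have "Some ` Omega J \<subseteq> ?I" by (auto simp: Omega_def)
    then have fin: "finite (Some ` Omega J) \<and> Some ` Omega J \<subseteq> ?I" by simp
    from ab[rule_format, OF fin, of "\<lambda>i. c (the i)"] show ?thesis
      by (simp add: sum.reindex ws)
  qed
  have up: "(\<Sum>\<omega>\<in>Omega J. (dot (2 ^ J) (dw J \<omega>) x)\<^sup>2) \<le> max b 1 * Cd * dot (2 ^ J) x x" for J x
  proof -
    have "(\<Sum>\<omega>\<in>Omega J. (dot (2 ^ J) (dw J \<omega>) x)\<^sup>2) = (\<Sum>\<omega>\<in>Omega J. (ip (psi \<omega>) (synth \<phi>d J x))\<^sup>2)"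
      by (intro sum.cong) (auto simp: dot_dw)
    also have "\<dots> \<le> max b 1 * ip (synth \<phi>d J x) (synth \<phi>d J x)"
    proof (rule bessel_from_synthesis)
      fix c
      have "ip (\<lambda>t. \<Sum>\<omega>\<in>Omega J. c \<omega> * psi \<omega> t) (\<lambda>t. \<Sum>\<omega>\<in>Omega J. c \<omega> * psi \<omega> t) \<le> b * (\<Sum>\<omega>\<in>Omega J. (c \<omega>)\<^sup>2)"
        by (rule conjunct2[OF riesz])
      also have "\<dots> \<le> max b 1 * (\<Sum>\<omega>\<in>Omega J. (c \<omega>)\<^sup>2)" by (intro mult_right_mono) (auto intro: sum_nonneg)
      finally show "ip (\<lambda>t. \<Sum>\<omega>\<in>Omega J. c \<omega> * psi \<omega> t) (\<lambda>t. \<Sum>\<omega>\<in>Omega J. c \<omega> * psi \<omega> t) \<le> max b 1 * (\<Sum>\<omega>\<in>Omega J. (c \<omega>)\<^sup>2)" .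
    qed (auto intro: psi_L2 synth_L2)
    also have "\<dots> \<le> max b 1 * (Cd * (\<Sum>k<2^J. (x k)\<^sup>2))"
      using Cd(2)[where J = J and a = x] unfolding synth_def[abs_def] by (intro mult_left_mono) auto
    finally show ?thesis by (simp add: dot_def power2_eq_square mult.assoc)
  qed
  have low: "a / C * (\<Sum>\<omega>\<in>Omega J. (c \<omega>)\<^sup>2) \<le> (\<Sum>k<2^J. (\<Sum>\<omega>\<in>Omega J. c \<omega> * dw J \<omega> k)\<^sup>2)" for J c
  proof -
    let ?d = "\<lambda>k. \<Sum>\<omega>\<in>Omega J. c \<omega> * dw J \<omega> k"
    let ?u = "\<lambda>t. \<Sum>\<omega>\<in>Omega J. c \<omega> * psi \<omega> t" and ?v = "\<lambda>t. \<Sum>k<2^J. ?d k * periodize \<phi> J k t"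
    have u: "?u \<in> L2_on unit_interval" by (intro L2_on_lincomb psi_L2)
    have v: "?v \<in> L2_on unit_interval" by (intro L2_on_lincomb) simp
    have "AE t in lborel. \<forall>\<omega>\<in>Omega J. t \<in> unit_interval \<longrightarrow> psi \<omega> t = (\<Sum>k<2^J. ip (psi \<omega>) (periodize \<phi>d J k) * periodize \<phi> J k t)"
    proof (subst AE_finite_all)
      show "\<forall>\<omega>\<in>Omega J. AE t\<in>unit_interval in lborel. psi \<omega> t = (\<Sum>k<2^J. ip (psi \<omega>) (periodize \<phi>d J k) * periodize \<phi> J k t)"
      proof
        fix \<omega> assume \<omega>: "\<omega> \<in> Omega J"
        then have "fst \<omega> < J" by (auto simp: Omega_def)
        then show "AE t\<in>unit_interval in lborel. psi \<omega> t = (\<Sum>k<2^J. ip (psi \<omega>) (periodize \<phi>d J k) * periodize \<phi> J k t)"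
          by (intro scaling_expansion span_psi psi_L2[OF \<omega>])
      qed
    qed simp
    then have ae: "AE t\<in>unit_interval in lborel. ?u t = ?v t"
    proof eventually_elim
      case (elim t)
      show ?case
      proof
        assume t: "t \<in> unit_interval"
        have "?u t = (\<Sum>\<omega>\<in>Omega J. \<Sum>k<2^J. c \<omega> * (dw J \<omega> k * periodize \<phi> J k t))"
          using elim t by (intro sum.cong) (auto simp: dw_eq sum_distrib_left)
        also have "\<dots> = (\<Sum>k<2^J. \<Sum>\<omega>\<in>Omega J. c \<omega> * (dw J \<omega> k * periodize \<phi> J k t))" by (rule sum.swap)
        also have "\<dots> = ?v t" by (simp add: sum_distrib_right mult.assoc)
        finally show "?u t = ?v t" .
      qed
    qed
    have "a * (\<Sum>\<omega>\<in>Omega J. (c \<omega>)\<^sup>2) \<le> ip ?u ?u" by (rule conjunct1[OF riesz])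
    also have "\<dots> = ip ?v ?u" by (rule L2_inner_cong_AE_left[OF u v u ae])
    also have "\<dots> = ip ?v ?v" by (rule L2_inner_cong_AE_right[OF u v v ae])
    also have "\<dots> \<le> C * (\<Sum>k<2^J. (?d k)\<^sup>2)" by (rule C(2))
    finally show ?thesis using C(1) by (simp add: field_simps)
  qed
  show "\<exists>B>0. \<forall>J x. (\<Sum>\<omega>\<in>Omega J. (dot (2 ^ J) (dw J \<omega>) x)\<^sup>2) \<le> B * dot (2 ^ J) x x"
    using up Cd(1) by (intro exI[of _ "max b 1 * Cd"]) simp
  show "\<exists>a>0. \<forall>J c. a * (\<Sum>\<omega>\<in>Omega J. (c \<omega>)\<^sup>2) \<le> (\<Sum>k<2^J. (\<Sum>\<omega>\<in>Omega J. c \<omega> * dw J \<omega> k)\<^sup>2)"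
    using low a C(1) by (intro exI[of _ "a / C"]) simp
qed

text \<open>For unit vectors the lower bound with coefficients 1 and s, where s is 1 or -1, reads 2
  a \<le> 2 + 2 s times the correlation.\<close>

lemma correlation_bound:
  assumes unit: "\<And>J \<omega>. \<omega> \<in> Omega J \<Longrightarrow> enorm_on (2^J) (dw J \<omega>) = 1"
  obtains \<rho> where "0 < \<rho>" "\<rho> < 1" "\<And>J \<omega> \<omega>'. \<omega> \<in> Omega J \<Longrightarrow> \<omega>' \<in> Omega J \<Longrightarrow> \<omega> \<noteq> \<omega>' \<Longrightarrow>
     \<bar>dot (2^J) (dw J \<omega>) (dw J \<omega>')\<bar> < \<rho>"
proof -
  obtain a where a: "a > 0" and low: "\<forall>J c. a * (\<Sum>\<omega>\<in>Omega J. (c \<omega>)\<^sup>2) \<le> (\<Sum>k<2^J. (\<Sum>\<omega>\<in>Omega J. c \<omega> * dw J \<omega> k)\<^sup>2)"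
    using wavelet_vector_bounds(2) by (elim exE conjE)
  have corr: "\<bar>dot (2^J) (dw J \<omega>) (dw J \<omega>')\<bar> \<le> 1 - a" if \<omega>: "\<omega> \<in> Omega J" "\<omega>' \<in> Omega J" "\<omega> \<noteq> \<omega>'" for J \<omega> \<omega>'
  proof -
    let ?w = "dw J \<omega>" and ?w' = "dw J \<omega>'"
    have one: "dot (2^J) ?w ?w = 1" "dot (2^J) ?w' ?w' = 1"
      using unit \<omega> enorm_on_power2[of "2^J"] by (metis one_power2)+
    have s: "2 * a \<le> 2 + 2 * s * dot (2^J) ?w ?w'" if s: "s * s = 1" for s
    proof -
      define c where "c i = (if i = \<omega> then 1 else if i = \<omega>' then s else 0)" for i
      have S: "(\<Sum>i\<in>Omega J. c i * f i) = f \<omega> + s * f \<omega>'" for f :: "nat \<times> nat \<Rightarrow> real"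
      proof -
        have "(\<Sum>i\<in>Omega J. c i * f i) = (\<Sum>i\<in>{\<omega>, \<omega>'}. c i * f i)"
          using \<omega> by (intro sum.mono_neutral_right) (auto simp: c_def)
        then show ?thesis using \<omega> by (simp add: c_def)
      qed
      have "a * (\<Sum>i\<in>Omega J. c i * c i) \<le> (\<Sum>k<2^J. (?w k + s * ?w' k)\<^sup>2)"
        using spec[OF spec[OF low, of J], of c] unfolding power2_eq_square S[of "\<lambda>\<omega>. dw J \<omega> k" for k] .
      also have "(\<Sum>k<2^J. (?w k + s * ?w' k)\<^sup>2) = dot (2^J) ?w ?w + s * s * dot (2^J) ?w' ?w' + 2 * s * dot (2^J) ?w ?w'"
        unfolding dot_def by (simp add: power2_eq_square algebra_simps sum.distrib sum_distrib_left)
      also have "(\<Sum>i\<in>Omega J. c i * c i) = 2" unfolding S using \<omega> s by (simp add: c_def)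
      finally show ?thesis using one s by simp
    qed
    from s[of 1] s[of "-1"] show ?thesis by simp
  qed
  \<comment> \<open>Taking a / 2 instead of a makes the inequality strict, and the maximum with 1/2
    keeps the bound positive.\<close>
  show ?thesis
  proof (rule that[of "max (1/2) (1 - a / 2)"])
    fix J \<omega> \<omega>' assume "\<omega> \<in> Omega J" "\<omega>' \<in> Omega J" "\<omega> \<noteq> \<omega>'"
    from corr[OF this] show "\<bar>dot (2^J) (dw J \<omega>) (dw J \<omega>')\<bar> < max (1/2) (1 - a / 2)" using a by linarith
  qed (use a in auto)
qed

text \<open>The \<open>X \<omega>\<close> form a dual system for fixed \<open>J\<close>: every
  element of the wavelet part is their combination with its own wavelet coefficients, and
  Cauchy-Schwarz bounds its norm. The constant may depend on \<open>J\<close>.\<close>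

lemma frame_lower:
  "\<exists>a>0. \<forall>u\<in>wavelet_part \<phi> \<phi>d J. a * (enorm_on (2^J) u)\<^sup>2 \<le> (\<Sum>\<omega>\<in>Omega J. \<bar>dot (2^J) (dw J \<omega>) u\<bar>\<^sup>2)"
proof -
  have "\<forall>\<omega>. \<exists>a. ip (periodize \<phi> 0 0) (synth \<phi>d J a) = 0 \<and> (\<forall>\<omega>'\<in>Omega J. ip (psi \<omega>') (synth \<phi>d J a) = of_bool (\<omega> = \<omega>'))"
    by (rule allI) (rule synthesis_exists)
  from choice[OF this] obtain X where X: "\<forall>\<omega>. ip (periodize \<phi> 0 0) (synth \<phi>d J (X \<omega>)) = 0 \<and>
      (\<forall>\<omega>'\<in>Omega J. ip (psi \<omega>') (synth \<phi>d J (X \<omega>)) = of_bool (\<omega> = \<omega>'))" by (elim exE)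
  have X1: "ip (periodize \<phi> 0 0) (synth \<phi>d J (X \<omega>)) = 0" for \<omega> using X by blast
  have X2: "ip (psi \<omega>') (synth \<phi>d J (X \<omega>)) = of_bool (\<omega> = \<omega>')" if "\<omega>' \<in> Omega J" for \<omega> \<omega>' using X that by blast
  have lin: "ip v (synth \<phi>d J (\<lambda>k. \<Sum>\<omega>\<in>Omega J. y \<omega> * X \<omega> k)) = (\<Sum>\<omega>\<in>Omega J. y \<omega> * ip v (synth \<phi>d J (X \<omega>)))"
    if "v \<in> L2_on unit_interval" for v y
  proof -
    have "ip v (synth \<phi>d J (\<lambda>k. \<Sum>\<omega>\<in>Omega J. y \<omega> * X \<omega> k)) = (\<Sum>k<2^J. \<Sum>\<omega>\<in>Omega J. y \<omega> * X \<omega> k * ip v (periodize \<phi>d J k))"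
      using that by (simp add: ip_synth_right sum_distrib_right)
    also have "\<dots> = (\<Sum>\<omega>\<in>Omega J. \<Sum>k<2^J. y \<omega> * X \<omega> k * ip v (periodize \<phi>d J k))" by (rule sum.swap)
    finally show ?thesis using that by (simp add: ip_synth_right sum_distrib_left mult.assoc)
  qed
  define C where "C = (\<Sum>k<2^J. \<Sum>\<omega>\<in>Omega J. (X \<omega> k)\<^sup>2)"
  have C: "C \<ge> 0" by (simp add: C_def sum_nonneg)
  have "dot (2^J) u u \<le> (\<Sum>\<omega>\<in>Omega J. \<bar>dot (2^J) (dw J \<omega>) u\<bar>\<^sup>2) * C" if u: "u \<in> wavelet_part \<phi> \<phi>d J" for u
  proof -
    define y where "y \<omega> = dot (2^J) (dw J \<omega>) u" for \<omega>
    have "u k - (\<Sum>\<omega>\<in>Omega J. y \<omega> * X \<omega> k) = 0" if "k < 2 ^ J" for k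
    proof (rule analysis_injective[OF _ _ that])
      show "ip (periodize \<phi> 0 0) (synth \<phi>d J (\<lambda>k. u k - (\<Sum>\<omega>\<in>Omega J. y \<omega> * X \<omega> k))) = 0"
        using u by (simp add: ip_synth_diff lin wavelet_part_eq X1)
      show "\<forall>\<omega>'\<in>Omega J. ip (psi \<omega>') (synth \<phi>d J (\<lambda>k. u k - (\<Sum>\<omega>\<in>Omega J. y \<omega> * X \<omega> k))) = 0"
      proof
        fix \<omega>' assume \<omega>': "\<omega>' \<in> Omega J"
        have "(\<Sum>\<omega>\<in>Omega J. y \<omega> * ip (psi \<omega>') (synth \<phi>d J (X \<omega>))) = (\<Sum>\<omega>\<in>Omega J. if \<omega> = \<omega>' then y \<omega> else 0)"
          using X2[OF \<omega>'] by (intro sum.cong) auto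
        also have "\<dots> = y \<omega>'" using \<omega>' by (subst sum.delta) auto
        finally show "ip (psi \<omega>') (synth \<phi>d J (\<lambda>k. u k - (\<Sum>\<omega>\<in>Omega J. y \<omega> * X \<omega> k))) = 0"
          using psi_L2[OF \<omega>'] by (simp add: ip_synth_diff lin y_def dot_dw[OF \<omega>'])
      qed
    qed
    then have "dot (2^J) u u = (\<Sum>k<2^J. (\<Sum>\<omega>\<in>Omega J. y \<omega> * X \<omega> k)\<^sup>2)"
      by (simp add: dot_def power2_eq_square)
    also have "\<dots> \<le> (\<Sum>k<2^J. (\<Sum>\<omega>\<in>Omega J. (y \<omega>)\<^sup>2) * (\<Sum>\<omega>\<in>Omega J. (X \<omega> k)\<^sup>2))"
      by (intro sum_mono Cauchy_Schwarz_ineq_sum)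
    finally show ?thesis by (simp add: C_def y_def sum_distrib_left)
  qed
  \<comment> \<open>\<open>C\<close> may be zero, for instance when \<open>Omega J\<close> is empty,
    so C + 1 serves as divisor.\<close>
  moreover have "s * C \<le> s * (C + 1)" if "s \<ge> 0" for s using that by (simp add: distrib_left)
  ultimately have "dot (2^J) u u \<le> (\<Sum>\<omega>\<in>Omega J. \<bar>dot (2^J) (dw J \<omega>) u\<bar>\<^sup>2) * (C + 1)" if "u \<in> wavelet_part \<phi> \<phi>d J" for u
    using that by (meson order_trans sum_nonneg zero_le_power2)
  then show ?thesis using C by (intro exI[of _ "1 / (C + 1)"]) (simp add: enorm_on_power2 divide_le_eq)
qed

end

section \<open>Besov norms and thresholding\<close>

text \<open>The norm is infinite exactly when its level terms are not summable, so finiteness for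
  \<open>y\<close> gives summability for both sequences.\<close>

lemma besov_seq_norm_mono:
  assumes le: "\<And>j k. k < 2 ^ j \<Longrightarrow> \<bar>x j k\<bar> \<le> \<bar>y j k\<bar>" and p: "p > 0" and q: "q > 0"
    and fin: "besov_seq_norm p q r y < \<infinity>"
  shows "besov_seq_norm p q r x \<le> besov_seq_norm p q r y"
proof -
  define s where "s = r + 1/2 - 1/p"
  define a where "a x j = 2 powr (real j * s * q) * ((\<Sum>k<2^j. \<bar>x j k\<bar> powr p) powr (1/p)) powr q" for x :: "nat \<Rightarrow> nat \<Rightarrow> real" and j
  have norm: "besov_seq_norm p q r z = (if summable (a z) then ennreal ((\<Sum>j. a z j) powr (1/q)) else \<infinity>)" for z
    unfolding besov_seq_norm_def Let_def a_def[abs_def] s_def ..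
  have nn: "0 \<le> a z j" for z j by (simp add: a_def)
  have axy: "a x j \<le> a y j" for j
    unfolding a_def using le p q
    by (intro mult_left_mono powr_mono2 sum_mono sum_nonneg) auto
  have sy: "summable (a y)" using fin unfolding norm by (auto split: if_splits)
  have sx: "summable (a x)" by (rule summable_comparison_test'[OF sy, of 0]) (use nn axy in auto)
  have "(\<Sum>j. a x j) powr (1/q) \<le> (\<Sum>j. a y j) powr (1/q)"
    using q axy nn sx sy by (intro powr_mono2 suminf_le suminf_nonneg) auto
  then show ?thesis unfolding norm using sx sy by (simp add: ennreal_leI)
qed

lemma besov_seq_norm_zero:
  assumes "\<And>j k. k < 2 ^ j \<Longrightarrow> x j k = 0"
  shows "besov_seq_norm p q r x = 0"
  using assms by (simp add: besov_seq_norm_def Let_def)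

lemma besov_seq_norm_eq_0D:
  assumes "besov_seq_norm p q r x = 0" "k < 2 ^ j"
  shows "x j k = 0"
proof -
  define a where "a j = 2 powr (real j * (r + 1/2 - 1/p) * q) * ((\<Sum>k<2^j. \<bar>x j k\<bar> powr p) powr (1/p)) powr q" for j
  have norm: "besov_seq_norm p q r x = (if summable a then ennreal ((\<Sum>j. a j) powr (1/q)) else \<infinity>)"
    unfolding besov_seq_norm_def Let_def a_def[abs_def] ..
  have nn: "0 \<le> a j" for j by (simp add: a_def)
  have s: "summable a" and "ennreal ((\<Sum>j. a j) powr (1/q)) = 0" using assms(1) unfolding norm by (auto split: if_splits)
  then have "(\<Sum>j. a j) powr (1/q) = 0" by (simp add: ennreal_eq_0_iff)
  then have "(\<Sum>j. a j) = 0" by simp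
  then have "a j = 0" using suminf_eq_zero_iff[OF s nn] by simp
  then have "(\<Sum>k<2^j. \<bar>x j k\<bar> powr p) = 0" by (simp add: a_def)
  then have "\<bar>x j k\<bar> powr p = 0" using assms(2) by (subst (asm) sum_nonneg_eq_0_iff) auto
  then show ?thesis by simp
qed

section \<open>Soft thresholding\<close>

lemma sup_norm_le_iff: "sup_norm J y \<le> s \<longleftrightarrow> 0 \<le> s \<and> (\<forall>\<omega>\<in>Omega J. \<bar>y \<omega>\<bar> \<le> s)"
  unfolding sup_norm_def by (subst Max_le_iff) auto

lemma soft_abs_le:
  assumes "\<omega> \<in> Omega J" "0 \<le> T" "\<bar>y \<omega> - a\<bar> \<le> T"
  shows "\<bar>soft J y T \<omega>\<bar> \<le> \<bar>a\<bar>"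
proof -
  have "\<bar>soft J y T \<omega>\<bar> \<le> max (\<bar>y \<omega>\<bar> - T) 0" using assms by (simp add: soft_def abs_mult sgn_if)
  also have "\<dots> \<le> \<bar>a\<bar>" using assms by linarith
  finally show ?thesis .
qed

lemma soft_eq_0_iff:
  assumes "\<omega> \<in> Omega J" "0 \<le> T"
  shows "soft J y T \<omega> = 0 \<longleftrightarrow> \<bar>y \<omega>\<bar> \<le> T"
  using assms by (auto simp: soft_def sgn_if max_def)

context periodic_wavelets
begin

lemma W_op_eq: "\<omega> \<in> Omega J \<Longrightarrow> W_op \<phi> \<psi> \<phi>d J x \<omega> = dot (2 ^ J) (dw J \<omega>) x"
  by (simp add: W_op_def)

lemma smoothness_event:
  assumes T: "0 \<le> T" and p: "p > 0" and q: "q > 0"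
  shows "(\<forall>u\<in>besov_space \<psi> p q r. besov_norm \<psi> p q r (u_star \<phi> \<phi>d J (estimator \<phi> \<psi> \<phi>d J T
        (add_noise (2^J) (level_coeffs \<phi> J u) e))) \<le> besov_norm \<psi> p q r u) \<longleftrightarrow>
     (\<forall>\<omega>\<in>Omega J. \<bar>dot (2 ^ J) (dw J \<omega>) e\<bar> \<le> T)" (is "?L \<longleftrightarrow> ?R")
proof
  let ?est = "\<lambda>u. u_star \<phi> \<phi>d J (estimator \<phi> \<psi> \<phi>d J T (add_noise (2^J) (level_coeffs \<phi> J u) e))"
  have W: "W_op \<phi> \<psi> \<phi>d J (add_noise (2^J) (level_coeffs \<phi> J u) e) \<omega> = ip (psi \<omega>) u + dot (2 ^ J) (dw J \<omega>) e"
    if "\<omega> \<in> Omega J" "u \<in> L2_on unit_interval" for \<omega> u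
    unfolding W_op_eq[OF that(1)] ip_psi_level_coeffs[OF that]
    by (simp add: dot_def add_noise_def distrib_left sum.distrib)
  {
    assume R: ?R
    show ?L
    proof
      fix u assume u: "u \<in> besov_space \<psi> p q r"
      then have u2: "u \<in> L2_on unit_interval" and fin: "besov_norm \<psi> p q r u < \<infinity>" by (auto simp: besov_space_def)
      show "besov_norm \<psi> p q r (?est u) \<le> besov_norm \<psi> p q r u"
        unfolding besov_norm_def
      proof (rule besov_seq_norm_mono[OF _ p q])
        show "besov_seq_norm p q r (\<lambda>j k. ip (periodize \<psi> j k) u) < \<infinity>" using fin by (simp add: besov_norm_def)
        fix j k :: nat assume k: "k < 2 ^ j"
        show "\<bar>ip (periodize \<psi> j k) (?est u)\<bar> \<le> \<bar>ip (periodize \<psi> j k) u\<bar>"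
        proof (cases "j < J")
          case True
          then have \<omega>: "(j, k) \<in> Omega J" using k by (simp add: Omega_def)
          have "\<bar>soft J (W_op \<phi> \<psi> \<phi>d J (add_noise (2^J) (level_coeffs \<phi> J u) e)) T (j, k)\<bar> \<le> \<bar>ip (periodize \<psi> j k) u\<bar>"
            using R W[OF \<omega> u2] \<omega> by (intro soft_abs_le[OF \<omega> T]) auto
          then show ?thesis using estimator_coeffs[OF \<omega>] by simp
        next
          \<comment> \<open>From level \<open>J\<close> on the reconstruction has no wavelet
            coefficients.\<close>
          case False
          then show ?thesis using k by (simp add: u_star_eq ip_psi_fine)
        qed
      qed
    qed
  next
    assume L: ?L
    show ?R
    proof
      fix \<omega> assume \<omega>: "\<omega> \<in> Omega J"
      have z: "besov_norm \<psi> p q r (\<lambda>t. 0) = 0"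
        unfolding besov_norm_def by (rule besov_seq_norm_zero) (simp add: L2_inner_commute[of _ _ "\<lambda>t. 0"] L2_inner_zero_left)
      then have "(\<lambda>t. 0) \<in> besov_space \<psi> p q r" by (simp add: besov_space_def L2_on_zero)
      with L z have "besov_norm \<psi> p q r (?est (\<lambda>t. 0)) = 0" by fastforce
      from besov_seq_norm_eq_0D[OF this[unfolded besov_norm_def], of "snd \<omega>" "fst \<omega>"]
      have "ip (psi \<omega>) (?est (\<lambda>t. 0)) = 0" using \<omega> by (auto simp: Omega_def)
      then have "\<bar>W_op \<phi> \<psi> \<phi>d J (add_noise (2^J) (level_coeffs \<phi> J (\<lambda>t. 0)) e) \<omega>\<bar> \<le> T"
        using estimator_coeffs[OF \<omega>] soft_eq_0_iff[OF \<omega> T] by simp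
      then show "\<bar>dot (2 ^ J) (dw J \<omega>) e\<bar> \<le> T"
        by (simp add: W[OF \<omega> L2_on_zero] L2_inner_commute[of _ _ "\<lambda>t. 0"] L2_inner_zero_left)
    qed
  }
qed

lemma stability:
  assumes unit: "\<And>J \<omega>. \<omega> \<in> Omega J \<Longrightarrow> enorm_on (2^J) (dw J \<omega>) = 1"
  shows "asymptotically_stable (wavelet_part \<phi> \<phi>d) Omega dw"
proof -
  obtain B where B: "B > 0" "\<forall>J x. (\<Sum>\<omega>\<in>Omega J. (dot (2 ^ J) (dw J \<omega>) x)\<^sup>2) \<le> B * dot (2 ^ J) x x"
    using wavelet_vector_bounds(1) by (elim exE conjE)
  have frame: "is_frame (2^J) (wavelet_part \<phi> \<phi>d J) (Omega J) (dw J)" for J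
  proof -
    obtain a where a: "a > 0" "\<forall>u\<in>wavelet_part \<phi> \<phi>d J. a * (enorm_on (2^J) u)\<^sup>2 \<le> (\<Sum>\<omega>\<in>Omega J. \<bar>dot (2^J) (dw J \<omega>) u\<bar>\<^sup>2)"
      using frame_lower[of J] by (elim exE conjE)
    show ?thesis unfolding is_frame_def
    proof (rule exI[of _ a], rule conjI[OF a(1)], rule exI[of _ B], intro ballI conjI)
      fix u assume u: "u \<in> wavelet_part \<phi> \<phi>d J"
      show "a * (enorm_on (2^J) u)\<^sup>2 \<le> (\<Sum>\<omega>\<in>Omega J. \<bar>dot (2^J) (dw J \<omega>) u\<bar>\<^sup>2)" using a(2) u by blast
      show "(\<Sum>\<omega>\<in>Omega J. \<bar>dot (2^J) (dw J \<omega>) u\<bar>\<^sup>2) \<le> B * (enorm_on (2^J) u)\<^sup>2" 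
        using B(2) by (simp add: enorm_on_power2)
    qed
  qed
  obtain \<rho> where \<rho>: "0 < \<rho>" "\<rho> < 1" and corr: "\<And>J \<omega> \<omega>'. \<omega> \<in> Omega J \<Longrightarrow> \<omega>' \<in> Omega J \<Longrightarrow> \<omega> \<noteq> \<omega>' \<Longrightarrow>
     \<bar>dot (2^J) (dw J \<omega>) (dw J \<omega>')\<bar> < \<rho>"
    using correlation_bound[OF unit] by blast
  have empty: "{(\<omega>, \<omega>'). \<omega> \<in> Omega J \<and> \<omega>' \<in> Omega J \<and> \<omega> \<noteq> \<omega>' \<and> \<bar>dot (2^J) (dw J \<omega>) (dw J \<omega>')\<bar> \<ge> \<rho>} = {}" for J
    using corr[of _ J] by (force simp: not_le)
  have upper: "upper_frame_bound (2^J) (Omega J) (dw J) \<le> B" for J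
    unfolding upper_frame_bound_def
  proof (rule cInf_lower)
    show "B \<in> {b. 0 \<le> b \<and> (\<forall>u\<in>Rn (2 ^ J). (\<Sum>\<omega>\<in>Omega J. \<bar>dot (2 ^ J) (dw J \<omega>) u\<bar>\<^sup>2) \<le> b * (enorm_on (2 ^ J) u)\<^sup>2)}"
      using B by (simp add: enorm_on_power2)
    show "bdd_below {b. 0 \<le> b \<and> (\<forall>u\<in>Rn (2 ^ J). (\<Sum>\<omega>\<in>Omega J. \<bar>dot (2 ^ J) (dw J \<omega>) u\<bar>\<^sup>2) \<le> b * (enorm_on (2 ^ J) u)\<^sup>2)}"
      by (rule bdd_belowI[of _ 0]) simp
  qed
  show ?thesis unfolding asymptotically_stable_def
  proof (intro conjI allI ballI)
    show "\<exists>\<rho>. 0 < \<rho> \<and> \<rho> < 1 \<and>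
        (\<lambda>J. real (card {(\<omega>, \<omega>'). \<omega> \<in> Omega J \<and> \<omega>' \<in> Omega J \<and> \<omega> \<noteq> \<omega>' \<and>
                          \<bar>dot (2^J) (dw J \<omega>) (dw J \<omega>')\<bar> \<ge> \<rho>}))
          \<in> o(\<lambda>J. real (card (Omega J)) / sqrt (ln (real (card (Omega J)))))"
      using \<rho> by (intro exI[of _ \<rho>] conjI) (simp_all add: empty)
  qed (use frame upper unit dw_Rn in auto)
qed

end

text \<open>Monotonicity replaces uniform convergence: the moving argument is enclosed by fixed
  points near \<open>z0\<close>, where continuity of \<open>G\<close> controls the limits.\<close>

lemma limit_at_moving_argument:
  fixes F :: "nat \<Rightarrow> real \<Rightarrow> real" and G :: "real \<Rightarrow> real"
  assumes mono: "\<And>J z z'. z \<le> z' \<Longrightarrow> F J z \<le> F J z'" and lim: "\<And>z. (\<lambda>J. F J z) \<longlonglongrightarrow> G z"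
    and G: "isCont G z0" and z: "z \<longlonglongrightarrow> z0"
  shows "(\<lambda>J. F J (z J)) \<longlonglongrightarrow> G z0"
proof (rule order_tendstoI)
  fix l assume l: "l < G z0"
  have "(G \<longlongrightarrow> G z0) (at_left z0)" using G by (simp add: isCont_def filterlim_at_split)
  then have "eventually (\<lambda>z. l < G z) (at_left z0)" using l by (rule order_tendstoD)
  then have "eventually (\<lambda>z. l < G z \<and> z < z0) (at_left z0)"
    by (rule eventually_conj) (simp add: eventually_at_filter)
  then obtain z1 where z1: "l < G z1" "z1 < z0"
    using eventually_happens'[OF trivial_limit_at_left_real] by blast
  have "eventually (\<lambda>J. l < F J z1) sequentially" using lim[of z1] z1(1) by (rule order_tendstoD)
  moreover have "eventually (\<lambda>J. z1 < z J) sequentially" using z z1(2) by (rule order_tendstoD)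
  ultimately show "eventually (\<lambda>J. l < F J (z J)) sequentially"
  proof eventually_elim
    case (elim J)
    then show ?case using mono[of z1 "z J" J] by linarith
  qed
next
  fix u assume u: "G z0 < u"
  have "(G \<longlongrightarrow> G z0) (at_right z0)" using G by (simp add: isCont_def filterlim_at_split)
  then have "eventually (\<lambda>z. G z < u) (at_right z0)" using u by (rule order_tendstoD)
  then have "eventually (\<lambda>z. G z < u \<and> z0 < z) (at_right z0)"
    by (rule eventually_conj) (simp add: eventually_at_filter)
  then obtain z1 where z1: "G z1 < u" "z0 < z1"
    using eventually_happens'[OF trivial_limit_at_right_real] by blast
  have "eventually (\<lambda>J. F J z1 < u) sequentially" using lim[of z1] z1(1) by (rule order_tendstoD)
  moreover have "eventually (\<lambda>J. z J < z1) sequentially" using z z1(2) by (rule order_tendstoD)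
  ultimately show "eventually (\<lambda>J. F J (z J) < u) sequentially"
  proof eventually_elim
    case (elim J)
    then show ?case using mono[of "z J" z1 J] by linarith
  qed
qed

text \<open>This is for limiting level \<alpha> = 0, where the argument tends to infinity. The upper
  estimate is the bound \<open>c\<close> itself; the lower one compares with a fixed large
  argument.\<close>

lemma limit_at_unbounded_argument:
  fixes F :: "nat \<Rightarrow> real \<Rightarrow> real" and G :: "real \<Rightarrow> real"
  assumes mono: "\<And>J z z'. z \<le> z' \<Longrightarrow> F J z \<le> F J z'" and lim: "\<And>z. (\<lambda>J. F J z) \<longlonglongrightarrow> G z"
    and G: "(G \<longlongrightarrow> c) at_top" and le: "\<And>J z. F J z \<le> c" and z: "filterlim z at_top sequentially"
  shows "(\<lambda>J. F J (z J)) \<longlonglongrightarrow> c"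
proof (rule order_tendstoI)
  fix l assume l: "l < c"
  obtain z1 where z1: "l < G z1"
    using eventually_happens'[OF trivial_limit_at_top_linorder order_tendstoD(1)[OF G l]] by blast
  have "eventually (\<lambda>J. l < F J z1) sequentially" using lim[of z1] z1(1) by (rule order_tendstoD)
  moreover have "eventually (\<lambda>J. z1 \<le> z J) sequentially" using z by (simp add: filterlim_at_top)
  ultimately show "eventually (\<lambda>J. l < F J (z J)) sequentially"
  proof eventually_elim
    case (elim J)
    then show ?case using mono[of z1 "z J" J] by linarith
  qed
next
  fix u assume "c < u"
  then show "eventually (\<lambda>J. F J (z J) < u) sequentially" using le by (intro always_eventually allI) (meson le_less_trans)
qed

theorem theorem4p4:
  fixes \<phi> \<psi> \<phi>d \<psi>d :: "real \<Rightarrow> real"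
    and M :: "nat \<Rightarrow> 'a measure"
    and \<epsilon> :: "nat \<Rightarrow> nat \<Rightarrow> 'a \<Rightarrow> real"
    and \<sigma> :: real
  assumes wavelets: "biorthogonal_wavelets \<phi> \<psi> \<phi>d \<psi>d"
    and unit: "L2_norm_on UNIV \<phi> = 1" "L2_norm_on UNIV \<psi> = 1"
    and periodic: "periodic_multiresolution \<phi> \<psi> \<phi>d \<psi>d"
    and discrete_unit:
      "\<And>J \<omega>. \<omega> \<in> Omega J \<Longrightarrow> enorm_on (2^J) (discrete_wavelet \<phi> \<psi> \<phi>d J \<omega>) = 1"
    and \<sigma>: "\<sigma> > 0"
    and prob: "\<And>J. prob_space (M J)"
    and indep: "\<And>J. prob_space.indep_vars (M J) (\<lambda>_. borel) (\<epsilon> J) {..<2^J}"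
    and normal: "\<And>J k. k < 2^J \<Longrightarrow> distributed (M J) lborel (\<epsilon> J k) (normal_density 0 \<sigma>)"
  shows
    "asymptotically_stable (wavelet_part \<phi> \<phi>d) Omega (discrete_wavelet \<phi> \<psi> \<phi>d) \<and>
     (\<forall>z. (\<lambda>J. measure (M J) {x \<in> space (M J).
               sup_norm J (W_op \<phi> \<psi> \<phi>d J (\<lambda>k\<in>{..<2^J}. \<epsilon> J k x))
                 \<le> \<sigma> * a_chi (2^J) * z + \<sigma> * b_chi (2^J)})
            \<longlonglongrightarrow> exp (- exp (- z))) \<and>
     (\<forall>(\<alpha>s :: nat \<Rightarrow> real) \<alpha>. (\<forall>J. 0 < \<alpha>s J \<and> \<alpha>s J < 1) \<and> 0 \<le> \<alpha> \<and> \<alpha> < 1 \<and> \<alpha>s \<longlonglongrightarrow> \<alpha> \<longrightarrow>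
        (\<lambda>J. measure (M J) {x \<in> space (M J). \<forall>u\<in>Rn (2^J).
               sup_norm J (W_op \<phi> \<psi> \<phi>d J
                   (\<lambda>k\<in>{..<2^J}. u k - add_noise (2^J) u (\<lambda>k. \<epsilon> J k x) k))
                 \<le> threshold \<sigma> (\<alpha>s J) (2^J)})
          \<longlonglongrightarrow> 1 - \<alpha> \<and>
        (\<forall>p q r (m :: nat). p \<ge> 1 \<and> q \<ge> 1 \<and> r \<ge> 0 \<and> real m > r \<and>
             vanishing_moments m \<psi> \<and> continuously_differentiable m \<psi> \<longrightarrow>
           liminf (\<lambda>J. ereal (measure (M J) {x \<in> space (M J). \<forall>u\<in>besov_space \<psi> p q r.
               besov_norm \<psi> p q r
                 (u_star \<phi> \<phi>d J
                   (estimator \<phi> \<psi> \<phi>d J (threshold \<sigma> (\<alpha>s J) (2^J))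
                     (add_noise (2^J) (level_coeffs \<phi> J u) (\<lambda>k. \<epsilon> J k x))))
                 \<le> besov_norm \<psi> p q r u}))
             \<ge> ereal (1 - \<alpha>)))"
proof -
  interpret periodic_wavelets \<phi> \<psi> \<phi>d \<psi>d by standard (rule wavelets, rule periodic)
  let ?L = "\<lambda>J. real J * ln 2"
  let ?dist = "\<lambda>z J. measure (M J) {x \<in> space (M J).
               sup_norm J (W_op \<phi> \<psi> \<phi>d J (\<lambda>k\<in>{..<2^J}. \<epsilon> J k x))
                 \<le> \<sigma> * a_chi (2^J) * z + \<sigma> * b_chi (2^J)}"
  let ?conf = "\<lambda>\<alpha>s J. measure (M J) {x \<in> space (M J). \<forall>u\<in>Rn (2^J).
               sup_norm J (W_op \<phi> \<psi> \<phi>d J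
                   (\<lambda>k\<in>{..<2^J}. u k - add_noise (2^J) u (\<lambda>k. \<epsilon> J k x) k))
                 \<le> threshold \<sigma> (\<alpha>s J) (2^J)}"
  let ?smooth = "\<lambda>\<alpha>s p q r J. measure (M J) {x \<in> space (M J). \<forall>u\<in>besov_space \<psi> p q r.
               besov_norm \<psi> p q r
                 (u_star \<phi> \<phi>d J
                   (estimator \<phi> \<psi> \<phi>d J (threshold \<sigma> (\<alpha>s J) (2^J))
                     (add_noise (2^J) (level_coeffs \<phi> J u) (\<lambda>k. \<epsilon> J k x))))
                 \<le> besov_norm \<psi> p q r u}"
  \<comment> \<open>The distribution function of the largest noise coefficient on the Gumbel scale.
    The three probabilities of the theorem agree with \<open>F\<close> at suitable arguments for
    large \<open>J\<close>.\<close>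
  define F where "F J z = measure (M J) {x \<in> space (M J). \<forall>\<omega>\<in>Omega J. \<bar>dot (2^J) (dw J \<omega>) (\<lambda>k. \<epsilon> J k x)\<bar> \<le> \<sigma> * gumbel_level z (?L J)}" for J z
  have unit_dot: "dot (2^J) (dw J \<omega>) (dw J \<omega>) = 1" if "\<omega> \<in> Omega J" for J \<omega>
    using discrete_unit[OF that] enorm_on_power2[of "2^J" "dw J \<omega>"] by simp
  have fam: "std_normal_family (M J) (\<lambda>k x. \<epsilon> J k x / \<sigma>) {..<2^J}" for J
  proof -
    interpret prob_space "M J" by (rule prob)
    show ?thesis
    proof
      show "indep_vars (\<lambda>_. borel) (\<lambda>k x. \<epsilon> J k x / \<sigma>) {..<2^J}"
        by (rule indep_vars_compose2[OF indep]) simp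
      show "distributed (M J) lborel (\<lambda>x. \<epsilon> J k x / \<sigma>) std_normal_density" if "k \<in> {..<2^J}" for k
        using normal_standard_normal_convert[OF \<sigma>, of "\<epsilon> J k" 0] normal[of k J] that by simp
    qed simp
  qed
  have scaled: "(\<Sum>k<2^J. v k * (\<epsilon> J k x / \<sigma>)) = dot (2^J) v (\<lambda>k. \<epsilon> J k x) / \<sigma>" for J v x
    by (simp add: dot_def sum_divide_distrib)
  have F_lim: "(\<lambda>J. F J z) \<longlonglongrightarrow> exp (- exp (- z))" for z
  proof -
    obtain \<rho> where \<rho>: "0 < \<rho>" "\<rho> < 1" and corr: "\<And>J \<omega> \<omega>'. \<omega> \<in> Omega J \<Longrightarrow> \<omega>' \<in> Omega J \<Longrightarrow> \<omega> \<noteq> \<omega>' \<Longrightarrow>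
       \<bar>dot (2^J) (dw J \<omega>) (dw J \<omega>')\<bar> < \<rho>"
      using correlation_bound[OF discrete_unit] by blast
    obtain B where B: "B > 0" "\<forall>J x. (\<Sum>\<omega>\<in>Omega J. (dot (2 ^ J) (dw J \<omega>) x)\<^sup>2) \<le> B * dot (2 ^ J) x x"
      using wavelet_vector_bounds(1) by (elim exE conjE)
    have "(\<lambda>J. measure (M J) {x \<in> space (M J). \<forall>\<omega>\<in>Omega J.
        \<bar>\<Sum>k<2^J. dw J \<omega> k * (\<epsilon> J k x / \<sigma>)\<bar> \<le> gumbel_level z (?L J)}) \<longlonglongrightarrow> exp (- exp (- z))"
    proof (rule gumbel_limit[OF fam finite_Omega])
      show "card (Omega J) \<le> 2 ^ J" for J by (simp add: card_Omega)
      have "(\<lambda>J. 1 - 1 / 2 ^ J :: real) \<longlonglongrightarrow> 1" by real_asymp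
      then show "(\<lambda>J. real (card (Omega J)) / 2 ^ J) \<longlonglongrightarrow> 1"
        by (simp add: card_Omega of_nat_diff diff_divide_distrib)
      show "\<bar>dot (2^J) (dw J \<omega>) (dw J \<omega>')\<bar> \<le> \<rho>" if "\<omega> \<in> Omega J" "\<omega>' \<in> Omega J" "\<omega> \<noteq> \<omega>'" for J \<omega> \<omega>'
        using corr[OF that] by simp
      show "(\<Sum>\<omega>'\<in>Omega J. (dot (2^J) (dw J \<omega>) (dw J \<omega>'))\<^sup>2) \<le> B" if "\<omega> \<in> Omega J" for J \<omega>
      proof -
        have "(\<Sum>\<omega>'\<in>Omega J. (dot (2^J) (dw J \<omega>) (dw J \<omega>'))\<^sup>2) = (\<Sum>\<omega>'\<in>Omega J. (dot (2^J) (dw J \<omega>') (dw J \<omega>))\<^sup>2)"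
          by (intro sum.cong refl arg_cong[where f = "\<lambda>t. t\<^sup>2"] dot_commute)
        also have "\<dots> \<le> B * dot (2^J) (dw J \<omega>) (dw J \<omega>)" using B(2) by blast
        finally show ?thesis by (simp add: unit_dot[OF that])
      qed
    qed (use unit_dot \<rho> B(1) in auto)
    then show ?thesis unfolding F_def scaled using \<sigma> by (simp add: abs_divide divide_le_eq mult.commute)
  qed
  have F_mono: "F J z \<le> F J z'" if "z \<le> z'" for J z z'
  proof -
    interpret std_normal_family "M J" "\<lambda>k x. \<epsilon> J k x / \<sigma>" "{..<2^J}" by (rule fam)
    have [measurable]: "\<epsilon> J k \<in> borel_measurable (M J)" if "k < 2^J" for k
      using distributed_measurable[OF normal[OF that]] by simp
    have [measurable]: "(\<lambda>x. dot (2^J) v (\<lambda>k. \<epsilon> J k x)) \<in> borel_measurable (M J)" for v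
      unfolding dot_def by measurable
    have "gumbel_level z (?L J) \<le> gumbel_level z' (?L J)"
      unfolding gumbel_level_def using that by (intro add_left_mono divide_right_mono) auto
    then have "\<sigma> * gumbel_level z (?L J) \<le> \<sigma> * gumbel_level z' (?L J)" using \<sigma> by simp
    then show ?thesis unfolding F_def
      by (intro finite_measure_mono) (auto intro: order_trans)
  qed
  have F_le: "F J z \<le> 1" for J z
    unfolding F_def using prob_space.prob_le_1[OF prob] .
  have norm_const: "\<sigma> * a_chi (2^J) * z + \<sigma> * b_chi (2^J) = \<sigma> * gumbel_level z (?L J)" for J z
    by (simp add: a_chi_def b_chi_def gumbel_level_def ln_realpow algebra_simps)
  \<comment> \<open>The threshold is the level at the Gumbel quantile of 1 - \<alpha>, that is, at
    the z with exp(-exp(-z)) = 1 - \<alpha>.\<close>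
  have thr: "threshold \<sigma> \<alpha> (2^J) = \<sigma> * gumbel_level (- ln (ln (1 / (1 - \<alpha>)))) (?L J)" for \<alpha> J
    unfolding norm_const[symmetric] threshold_def by simp
  have L: "filterlim ?L at_top sequentially" by real_asymp
  \<comment> \<open>The sup norm and the thresholding lemmas are used at nonnegative levels, which
    is guaranteed eventually because the Gumbel level tends to infinity.\<close>
  have level_pos: "eventually (\<lambda>J. 0 \<le> \<sigma> * gumbel_level z (?L J)) sequentially" for z
  proof -
    have "eventually (\<lambda>L. 0 \<le> gumbel_level z L) at_top"
      using gumbel_level_at_top by (auto simp: filterlim_at_top)
    from eventually_compose_filterlim[OF this L] show ?thesis by eventually_elim (use \<sigma> in simp)
  qed
  have sup_W: "sup_norm J (W_op \<phi> \<psi> \<phi>d J y) \<le> s \<longleftrightarrow> 0 \<le> s \<and> (\<forall>\<omega>\<in>Omega J. \<bar>dot (2^J) (dw J \<omega>) y\<bar> \<le> s)" for J y s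
    by (simp add: sup_norm_le_iff W_op_eq)
  have distribution: "(\<lambda>J. ?dist z J) \<longlonglongrightarrow> exp (- exp (- z))" for z
  proof (rule Lim_transform_eventually[OF F_lim])
    show "eventually (\<lambda>J. F J z = ?dist z J) sequentially"
      using level_pos[of z]
    proof eventually_elim
      case (elim J)
      have "dot (2^J) v (\<lambda>k\<in>{..<2^J}. \<epsilon> J k x) = dot (2^J) v (\<lambda>k. \<epsilon> J k x)" for v x
        by (simp add: dot_def)
      then show ?case using elim by (simp add: F_def norm_const sup_W)
    qed
  qed
  have confidence: "(\<lambda>J. ?conf \<alpha>s J) \<longlonglongrightarrow> 1 - \<alpha>"
    and smoothness: "liminf (\<lambda>J. ereal (?smooth \<alpha>s p q r J)) \<ge> ereal (1 - \<alpha>)"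
    if \<alpha>s: "\<forall>J. 0 < \<alpha>s J \<and> \<alpha>s J < 1" and \<alpha>: "0 \<le> \<alpha>" "\<alpha> < 1" and conv: "\<alpha>s \<longlonglongrightarrow> \<alpha>"
      and pq: "p \<ge> 1" "q \<ge> 1"
    for \<alpha>s \<alpha> and p q r :: real
  proof -
    define z where "z J = - ln (ln (1 / (1 - \<alpha>s J)))" for J
    have lnpos: "ln (1 / (1 - \<beta>)) > 0" if "0 < \<beta>" "\<beta> < 1" for \<beta> :: real
      using that by (intro ln_gt_zero) (simp add: field_simps)
    have lim: "(\<lambda>J. ln (1 / (1 - \<alpha>s J))) \<longlonglongrightarrow> ln (1 / (1 - \<alpha>))"
      using \<alpha> conv by (intro tendsto_intros) auto
    \<comment> \<open>The lower bound on \<open>z\<close>, valid for convergent as well as for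
      diverging quantiles, is recorded because it makes the thresholds eventually
      nonnegative.\<close>
    have Fz: "(\<lambda>J. F J (z J)) \<longlonglongrightarrow> 1 - \<alpha>" and zb: "\<exists>z0. eventually (\<lambda>J. z0 \<le> z J) sequentially"
    proof -
      have "(\<lambda>J. F J (z J)) \<longlonglongrightarrow> 1 - \<alpha> \<and> (\<exists>z0. eventually (\<lambda>J. z0 \<le> z J) sequentially)"
      proof (cases "\<alpha> = 0")
        case True
        \<comment> \<open>The inner logarithm tends to 0 from the right, since every
          \<open>\<alpha>s J\<close> is positive; hence the outer one tends to minus
          infinity.\<close>
        have "filterlim (\<lambda>J. ln (1 / (1 - \<alpha>s J))) (at_right 0) sequentially"
        proof (rule tendsto_imp_filterlim_at_right)
          show "(\<lambda>J. ln (1 / (1 - \<alpha>s J))) \<longlonglongrightarrow> 0" using lim True by simp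
          show "eventually (\<lambda>J. 0 < ln (1 / (1 - \<alpha>s J))) sequentially"
            using lnpos \<alpha>s by (intro always_eventually allI) blast
        qed
        then have "filterlim (\<lambda>J. ln (ln (1 / (1 - \<alpha>s J)))) at_bot sequentially"
          by (rule filterlim_compose[OF ln_at_0])
        then have z: "filterlim z at_top sequentially" unfolding z_def by (simp add: filterlim_uminus_at_top)
        have "((\<lambda>z::real. exp (- exp (- z))) \<longlongrightarrow> 1) at_top" by real_asymp
        from limit_at_unbounded_argument[OF F_mono F_lim this F_le z]
        have "(\<lambda>J. F J (z J)) \<longlonglongrightarrow> 1 - \<alpha>" using True by simp
        moreover have "eventually (\<lambda>J. 0 \<le> z J) sequentially" using z by (simp add: filterlim_at_top)
        ultimately show ?thesis by blast
      next
        case False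
        define z0 where "z0 = - ln (ln (1 / (1 - \<alpha>)))"
        have pos: "ln (1 / (1 - \<alpha>)) > 0" using False \<alpha> by (intro lnpos) auto
        have z: "z \<longlonglongrightarrow> z0" unfolding z_def z0_def by (intro tendsto_minus tendsto_ln lim) (use pos in auto)
        have "(\<lambda>J. F J (z J)) \<longlonglongrightarrow> exp (- exp (- z0))"
        proof (rule limit_at_moving_argument[OF F_mono F_lim _ z])
          show "isCont (\<lambda>z. exp (- exp (- z))) z0" by (intro continuous_intros)
        qed
        moreover have "exp (- exp (- z0)) = 1 - \<alpha>" using pos \<alpha> by (simp add: z0_def ln_div)
        moreover have "eventually (\<lambda>J. z0 - 1 < z J) sequentially" using z by (rule order_tendstoD) simp
        then have "eventually (\<lambda>J. z0 - 1 \<le> z J) sequentially" by eventually_elim simp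
        ultimately show ?thesis by auto
      qed
      then show "(\<lambda>J. F J (z J)) \<longlonglongrightarrow> 1 - \<alpha>" "\<exists>z0. eventually (\<lambda>J. z0 \<le> z J) sequentially" by auto
    qed
    obtain z0 where z0: "eventually (\<lambda>J. z0 \<le> z J) sequentially" using zb by blast
    have T: "eventually (\<lambda>J. 0 \<le> threshold \<sigma> (\<alpha>s J) (2^J)) sequentially"
      using z0 level_pos[of z0]
    proof eventually_elim
      case (elim J)
      have "gumbel_level z0 (?L J) \<le> gumbel_level (z J) (?L J)"
        unfolding gumbel_level_def using elim(1) by (intro add_left_mono divide_right_mono) auto
      then have "\<sigma> * gumbel_level z0 (?L J) \<le> \<sigma> * gumbel_level (z J) (?L J)" using \<sigma> by simp
      then show ?case unfolding thr z_def[symmetric] using elim(2) by linarith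
    qed
    have F_eq: "F J (z J) = measure (M J) {x \<in> space (M J). \<forall>\<omega>\<in>Omega J. \<bar>dot (2^J) (dw J \<omega>) (\<lambda>k. \<epsilon> J k x)\<bar> \<le> threshold \<sigma> (\<alpha>s J) (2^J)}" for J
      unfolding F_def thr z_def ..
    show "(\<lambda>J. ?conf \<alpha>s J) \<longlonglongrightarrow> 1 - \<alpha>"
    proof (rule Lim_transform_eventually[OF Fz])
      show "eventually (\<lambda>J. F J (z J) = ?conf \<alpha>s J) sequentially"
        using T
      proof eventually_elim
        case (elim J)
        have "dot (2^J) v (\<lambda>k\<in>{..<2^J}. u k - add_noise (2^J) u (\<lambda>k. \<epsilon> J k x) k) = - dot (2^J) v (\<lambda>k. \<epsilon> J k x)" for v u x
          by (simp add: dot_def add_noise_def sum_negf)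
        moreover have "\<exists>u. u \<in> Rn (2^J)" unfolding Rn_def by (simp add: ex_in_conv PiE_eq_empty_iff)
        ultimately show ?case using elim by (simp add: F_eq sup_W)
      qed
    qed
    \<comment> \<open>The probabilities even converge, because the smoothness event is the noise
      event as soon as the threshold is nonnegative.\<close>
    have "(\<lambda>J. ereal (?smooth \<alpha>s p q r J)) \<longlonglongrightarrow> ereal (1 - \<alpha>)"
    proof (rule Lim_transform_eventually)
      show "(\<lambda>J. ereal (F J (z J))) \<longlonglongrightarrow> ereal (1 - \<alpha>)" using Fz by simp
      show "eventually (\<lambda>J. ereal (F J (z J)) = ereal (?smooth \<alpha>s p q r J)) sequentially"
        using T
      proof eventually_elim
        case (elim J)
        have "p > 0" "q > 0" using pq by auto
        from smoothness_event[OF elim this] show ?case by (simp only: F_eq)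
      qed
    qed
    from lim_imp_Liminf[OF _ this] show "liminf (\<lambda>J. ereal (?smooth \<alpha>s p q r J)) \<ge> ereal (1 - \<alpha>)" by simp
  qed
  show ?thesis
  proof (intro conjI allI impI)
    show "asymptotically_stable (wavelet_part \<phi> \<phi>d) Omega (discrete_wavelet \<phi> \<psi> \<phi>d)"
      by (rule stability[OF discrete_unit])
  next
    fix \<alpha>s :: "nat \<Rightarrow> real" and \<alpha> :: real
    assume H: "(\<forall>J. 0 < \<alpha>s J \<and> \<alpha>s J < 1) \<and> 0 \<le> \<alpha> \<and> \<alpha> < 1 \<and> \<alpha>s \<longlonglongrightarrow> \<alpha>"
    show "(\<lambda>J. ?conf \<alpha>s J) \<longlonglongrightarrow> 1 - \<alpha>"
      by (rule confidence[of \<alpha>s \<alpha> 1 1]) (use H in auto)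
    fix p q r :: real and m :: nat
    assume "p \<ge> 1 \<and> q \<ge> 1 \<and> r \<ge> 0 \<and> real m > r \<and> vanishing_moments m \<psi> \<and> continuously_differentiable m \<psi>"
    then show "liminf (\<lambda>J. ereal (?smooth \<alpha>s p q r J)) \<ge> ereal (1 - \<alpha>)"
      using H by (intro smoothness[of \<alpha>s]) auto
  qed (rule distribution)
qed

end
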